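(* For $r>0$ let $u(r)\in(0,1)$ be the prevertex parameter of $P_r$ and put $v(r):=1-u(r)$. Then $u,v:(0,\infty)\to(0,1)$ are real-analytic, and the following hold for every $r>0$. (i) The Cardy--Smirnov function of $P_r$ is $$\Pi_h^{\mathrm{par}}(r)=\frac{1}{B(\tfrac13,\tfrac13)}\int_{u(r)}^1 w^{-2/3}(1-w)^{-2/3}\,dw=\frac{3\,v(r)^{1/3}}{B(\tfrac13,\tfrac13)}\,{}_2F_1\!\left(\tfrac13,\tfrac23;\tfrac43;v(r)\right),$$ where $B(a,b)=\Gamma(a)\Gamma(b)/\Gamma(a+b)$ is the Euler beta function; in particular $B(\tfrac13,\tfrac13)=\Gamma(1/3)^2/\Gamma(2/3)=\sqrt3\,\Gamma(1/3)^3/(2\pi)$. (ii) Writing $\tau=ir/\sqrt3$, $$v(r)=\frac{27\,\eta(3\tau)^{12}}{\eta(\tau)^{12}+27\,\eta(3\tau)^{12}},\qquad u(r)=1-v(r).$$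
   Context: For $r>0$, $P_r\subset\mathbb C$ is the closed parallelogram with vertices $0,\ r,\ r+e^{i\pi/3},\ e^{i\pi/3}$ in cyclic order. $\Delta\subset\mathbb C$ is the closed equilateral triangle with vertices $0,1,e^{i\pi/3}$. Cardy--Smirnov function of $P_r$ (defined purely conformally, as a Carleson length). Let $g:P_r\to\Delta$ be the unique homeomorphism that is conformal (biholomorphic) between the interiors and satisfies $g(0)=0$, $g(r+e^{i\pi/3})=1$, $g(e^{i\pi/3})=e^{i\pi/3}$. Then $g(r)\in(0,1)$, and $\Pi_h^{\mathrm{par}}(r):=1-g(r)$, the Euclidean length of the segment $[g(r),1]$. Prevertex parameter. Let $\widehat{\mathbb H}=\mathbb H\cup\mathbb R\cup\{\infty\}$ be the closed upper half-plane in the Riemann sphere. For each $r>0$ there is a unique $u=u(r)\in(0,1)$ for which there is a homeomorphism $\widehat{\mathbb H}\to P_r$, conformal in the interior (the Schwarz--Christoffel map, of the form $z\mapsto C\int_0^z w^{-2/3}(w-u)^{-1/3}(w-1)^{-2/3}\,dw$), sending $(0,u,1,\infty)$ to $(0,\ r,\ r+e^{i\pi/3},\ e^{i\pi/3})$ respectively. $\eta(\tau)=q^{1/24}\prod_{n\ge1}(1-q^n)$, $q=e^{2\pi i\tau}$ (with $q^{1/24}=e^{2\pi i\tau/24}$), is the Dedekind eta function; ${}_2F_1$ is the Gauss hypergeometric function. *)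

theory Defs
  imports "HOL-Analysis.Analysis"
begin

definition biholomorphic_on :: "(complex \<Rightarrow> complex) \<Rightarrow> complex set \<Rightarrow> complex set \<Rightarrow> bool" where
  "biholomorphic_on f S T \<longleftrightarrow>
     f holomorphic_on S \<and> bij_betw f S T \<and> inv_into S f holomorphic_on T"

definition real_analytic_on :: "(real \<Rightarrow> real) \<Rightarrow> real set \<Rightarrow> bool" where
  "real_analytic_on f S \<longleftrightarrow>
     (\<forall>x\<in>S. \<exists>e>0. \<exists>a. \<forall>y. \<bar>y - x\<bar> < e \<longrightarrow> (\<lambda>n. a n * (y - x) ^ n) sums f y)"

definition omega :: complex where
  "omega = exp (\<i> * complex_of_real (pi / 3))"

definition parallelogram :: "real \<Rightarrow> complex set" where
  "parallelogram r =
     convex hull {0, complex_of_real r, complex_of_real r + omega, omega}"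

definition triangle :: "complex set" where
  "triangle = convex hull {0, 1, omega}"

definition is_cardy_map :: "real \<Rightarrow> (complex \<Rightarrow> complex) \<Rightarrow> bool" where
  "is_cardy_map r g \<longleftrightarrow>
     homeomorphic_map (top_of_set (parallelogram r)) (top_of_set triangle) g \<and>
     biholomorphic_on g (interior (parallelogram r)) (interior triangle) \<and>
     g 0 = 0 \<and> g (complex_of_real r + omega) = 1 \<and> g omega = omega"

(* The map is determined only on the parallelogram; extensionality pins down its value
   elsewhere, so that it is unique as a total function. *)
definition cardy_map :: "real \<Rightarrow> complex \<Rightarrow> complex" where
  "cardy_map r = (THE g. is_cardy_map r g \<and> g \<in> extensional (parallelogram r))"

(* Complex-valued: an identity "cardy_smirnov r = complex_of_real x" thus also says
   that the point cardy_map r r is real. *)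
definition cardy_smirnov :: "real \<Rightarrow> complex" where
  "cardy_smirnov r = 1 - cardy_map r (complex_of_real r)"

abbreviation upper_half_plane :: "complex set" where
  "upper_half_plane \<equiv> {z. Im z > 0}"

(* The Riemann sphere is the one-point compactification of the complex plane, with
   underlying type complex option: a finite point z is Some z, and None is infinity. *)
abbreviation riemann_sphere :: "complex option topology" where
  "riemann_sphere \<equiv> Alexandroff_compactification euclidean"

definition closed_half_plane :: "complex option topology" where
  "closed_half_plane = subtopology riemann_sphere (insert None (Some ` {z. Im z \<ge> 0}))"

definition is_prevertex :: "real \<Rightarrow> real \<Rightarrow> bool" where
  "is_prevertex r u \<longleftrightarrow> 0 < u \<and> u < 1 \<and>
     (\<exists>f. homeomorphic_map closed_half_plane (top_of_set (parallelogram r)) f \<and>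
          biholomorphic_on (\<lambda>z. f (Some z)) upper_half_plane (interior (parallelogram r)) \<and>
          f (Some 0) = 0 \<and>
          f (Some (complex_of_real u)) = complex_of_real r \<and>
          f (Some 1) = complex_of_real r + omega \<and>
          f None = omega)"

definition u_par :: "real \<Rightarrow> real" where
  "u_par r = (THE u. is_prevertex r u)"

definition v_par :: "real \<Rightarrow> real" where
  "v_par r = 1 - u_par r"

definition dedekind_eta :: "complex \<Rightarrow> complex" where
  "dedekind_eta \<tau> = exp (2 * of_real pi * \<i> * \<tau> / 24) *
     (\<Prod>n. 1 - exp (2 * of_real pi * \<i> * \<tau>) ^ Suc n)"

definition hyp2F1 :: "real \<Rightarrow> real \<Rightarrow> real \<Rightarrow> real \<Rightarrow> real" where
  "hyp2F1 a b c z = eval_fps (fps_hypergeo [a, b] [c] 1) z"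

end

theory Submission
  imports Defs "HOL-Complex_Analysis.Complex_Analysis"
    "HOL-Computational_Algebra.Fundamental_Theorem_Algebra" "HOL-Real_Asymp.Real_Asymp"
begin

text \<open>
  Put \<open>F(t) = 2F1(1/3, 2/3; 1; t)\<close>, \<open>M(t) = F(1 - t) / F(t)\<close> and \<open>v = 1 - u\<close>.

  Computing the side lengths of the Schwarz--Christoffel polygon by Euler's integral shows that a
  prevertex parameter \<open>u\<close> of the parallelogram belongs to the side length \<open>r = M(v)\<close>. The
  Schwarz--Christoffel map is a homeomorphism by a clopen argument: it maps the real line
  bijectively onto the polygon, and the set of points with two preimages is open and closed in the
  interior but avoids a neighbourhood of a boundary point. Uniqueness of all conformal maps
  follows from Schwarz reflection: a self-map of the closed half-plane that fixes \<open>0, 1\<close> and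
  infinity extends to an injective proper entire function, hence is the identity. So
  the Cardy--Smirnov map is the Schwarz--Christoffel map of the triangle composed with the inverse
  of that of the parallelogram.

  To solve \<open>M(v) = r\<close>, let \<open>T(r)\<close> be the eta quotient of the theorem. For
  \<open>y = (1 - x) / (1 + 2x)\<close> both sides of \<open>F(1 - y\<^sup>3) = (1 + 2x) F(x\<^sup>3)\<close> satisfy the same
  self-adjoint differential equation and are regular at \<open>0\<close>, so the weighted Wronskian
  vanishes; hence \<open>M(1 - y\<^sup>3) = M(x\<^sup>3) / 3\<close>. Jacobi's series for the cube of the Euler product,
  dissected modulo 3 and multiplied over the cube roots of unity, gives \<open>T(3r) = x\<^sup>3\<close> and
  \<open>T(r) = 1 - y\<^sup>3\<close> for some \<open>x\<close>. Therefore \<open>M(T(r)) = M(T(3\<^sup>nr)) / 3\<^sup>n\<close>, and letting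
  \<open>n\<close> tend to infinity, the logarithmic singularity of \<open>F\<close> at \<open>1\<close> yields \<open>M(T(r)) = r\<close>.
\<close>

section \<open>The cubic hypergeometric function\<close>

text \<open>In the Borweins' notation \<open>cubic_T\<close> is c^3 / a^3 for the cubic theta
  functions a^3 = b^3 + c^3, with b^3 = eta(tau)^9 / eta(3 tau)^3 and c^3 = 27 eta(3 tau)^9 /
  eta(tau)^3; hence the 27 and the twelfth powers. Tripling tau acts on c / a through the map x ->
  (1 - x) / (1 + 2x), and the same map is a symmetry of the hypergeometric equation. So M(T(r)) / r
  is invariant under r -> 3r, and it remains to see that it tends to 1, which involves only the
  leading behaviour of the eta products at q = 0 and of F at its logarithmic singularity. On the
  conformal side the obstacle is the boundary: the integrand is singular at the prevertices and at
  infinity, yet homeomorphisms of closed regions are claimed. A Hoelder estimate up to the real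
  line, repeated in the coordinate -1/z, gives a continuous map on a compact space, so that
  bijectivity is the remaining point. Only the two sides of the parallelogram that meet at the image
  of u are measured by integrals; the lengths of the other two follow because the polygon
  closes.\<close>

declare fps_hypergeo_nth [simp del]

lemma fps_hypergeo_21_Suc:
  fixes a b c :: real
  shows "fps_nth (fps_hypergeo [a, b] [c] 1) (Suc n) =
    (a + real n) * (b + real n) / ((1 + real n) * (c + real n)) * fps_nth (fps_hypergeo [a, b] [c] 1) n"
  by (simp only: fps_hypergeo_rec) simp

lemma fps_conv_radius_hypergeo_21:
  fixes a b c :: real
  assumes "a > 0" "b > 0" "c > 0"
  shows "fps_conv_radius (fps_hypergeo [a, b] [c] 1) = 1"
proof -
  let ?f = "fps_nth (fps_hypergeo [a, b] [c] (1::real))"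
  have nz: "?f n \<noteq> 0" for n
    using assms by (auto simp: fps_hypergeo_nth pochhammer_eq_0_iff add_pos_nonneg)
  have eq: "norm (?f n) / norm (?f (Suc n)) =
      (c + real n) * (1 + real n) / ((a + real n) * (b + real n))" for n
  proof -
    note fps_hypergeo_21_Suc[of a b c n]
    moreover have "a + real n > 0" "b + real n > 0" "c + real n > 0" using assms by auto
    ultimately show ?thesis using nz[of n]
      by (simp add: abs_mult)
  qed
  have "(\<lambda>n. (c + real n) * (1 + real n) / ((a + real n) * (b + real n))) \<longlonglongrightarrow> 1"
    by real_asymp
  hence lim: "(\<lambda>n. norm (?f n) / norm (?f (Suc n))) \<longlonglongrightarrow> 1"
    unfolding eq .
  have "conv_radius ?f = ereal 1"
    by (rule conv_radius_ratio_limit_nonzero) (use nz lim in auto)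
  thus ?thesis by (simp add: fps_conv_radius_def one_ereal_def)
qed

definition cubic_F :: "real \<Rightarrow> real" where
  "cubic_F = hyp2F1 (1/3) (2/3) 1"

definition cubic_F' :: "real \<Rightarrow> real" where
  "cubic_F' = eval_fps (fps_deriv (fps_hypergeo [1/3, 2/3] [1] 1))"

abbreviation cubic_coeff :: "nat \<Rightarrow> real" where
  "cubic_coeff \<equiv> fps_nth (fps_hypergeo [1/3, 2/3] [1] 1)"

lemma cubic_conv_radius: "fps_conv_radius (fps_hypergeo [1/3, 2/3] [1] (1::real)) = 1"
  by (rule fps_conv_radius_hypergeo_21) auto

lemma cubic_coeff_pos: "cubic_coeff n > 0"
  by (simp add: fps_hypergeo_nth pochhammer_pos)

text \<open>The factor on the right is (n + 1/3)(n + 2/3) multiplied out. In this form the recursion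
  is the hypergeometric differential equation, read off coefficient by coefficient.\<close>

lemma cubic_coeff_Suc:
  "(real n + 1)\<^sup>2 * cubic_coeff (Suc n) = ((real n)\<^sup>2 + real n + 2/9) * cubic_coeff n"
proof -
  note fps_hypergeo_21_Suc[of "1/3" "2/3" 1 n]
  moreover have "1 + real n > 0" by auto
  ultimately show ?thesis
    by (simp add: divide_simps power2_eq_square) (simp add: algebra_simps)
qed

lemma cubic_F_sums: "\<bar>x\<bar> < 1 \<Longrightarrow> (\<lambda>n. cubic_coeff n * x ^ n) sums cubic_F x"
  unfolding cubic_F_def hyp2F1_def
  by (rule sums_eval_fps) (simp add: cubic_conv_radius one_ereal_def)

lemma cubic_F'_sums: "\<bar>x\<bar> < 1 \<Longrightarrow> (\<lambda>n. (real n + 1) * cubic_coeff (Suc n) * x ^ n) sums cubic_F' x"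
proof -
  assume x: "\<bar>x\<bar> < 1"
  have "ereal 1 \<le> fps_conv_radius (fps_deriv (fps_hypergeo [1/3, 2/3] [1] (1::real)))"
    using fps_conv_radius_deriv[of "fps_hypergeo [1/3, 2/3] [1] (1::real)"]
    by (simp add: cubic_conv_radius one_ereal_def)
  hence "ereal (norm x) < fps_conv_radius (fps_deriv (fps_hypergeo [1/3, 2/3] [1] (1::real)))"
    using x by (auto intro: order.strict_trans2[of _ "ereal 1"])
  from sums_eval_fps[OF this] show ?thesis
    by (simp add: cubic_F'_def add.commute)
qed

lemma cubic_F_has_derivative:
  assumes "\<bar>x\<bar> < 1" shows "(cubic_F has_real_derivative cubic_F' x) (at x within A)"
  unfolding cubic_F_def hyp2F1_def cubic_F'_def
  by (rule has_field_derivative_eval_fps) (use assms in \<open>simp add: cubic_conv_radius one_ereal_def\<close>)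

lemma cubic_F_ge_1: "0 \<le> x \<Longrightarrow> x < 1 \<Longrightarrow> cubic_F x \<ge> 1"
proof -
  assume x: "0 \<le> x" "x < 1"
  have "(\<Sum>n<1. cubic_coeff n * x ^ n) \<le> (\<Sum>n. cubic_coeff n * x ^ n)"
    using x cubic_F_sums[of x] cubic_coeff_pos
    by (intro sum_le_suminf) (auto simp: sums_iff less_imp_le)
  thus ?thesis using cubic_F_sums[of x] x by (simp add: sums_iff)
qed

lemma cubic_F_0 [simp]: "cubic_F 0 = 1"
  using cubic_F_sums[of 0] by (simp add: sums_iff)

text \<open>The quantity under the outer derivative in the self-adjoint form (x (1 - x) F')' = (2/9)
  F of the hypergeometric equation. The pair \<open>cubic_F\<close>, \<open>cubic_P\<close> turns
  the second-order equation into a first-order system.\<close>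

definition cubic_P :: "real \<Rightarrow> real" where
  "cubic_P x = x * (1 - x) * cubic_F' x"

lemma cubic_P_has_derivative:
  assumes "\<bar>x\<bar> < 1" shows "(cubic_P has_real_derivative 2/9 * cubic_F x) (at x within A)"
proof -
  define f where "f = fps_hypergeo [1/3, 2/3] [1] (1::real)"
  define g where "g = fps_X * (1 - fps_X) * fps_deriv f"
  have rf: "fps_conv_radius f = 1" by (simp add: f_def cubic_conv_radius)
  have rf': "fps_conv_radius (fps_deriv f) \<ge> 1" using fps_conv_radius_deriv[of f] rf by simp
  have r1: "fps_conv_radius (1 - fps_X :: real fps) = \<infinity>"
    using fps_conv_radius_diff[of 1 "fps_X::real fps"] by simp
  have r2: "fps_conv_radius (fps_X * (1 - fps_X) :: real fps) = \<infinity>"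
    using fps_conv_radius_mult[of "fps_X::real fps" "1 - fps_X"] r1 by simp
  have rg: "fps_conv_radius g \<ge> 1"
    using order.trans[OF _ fps_conv_radius_mult[of "fps_X * (1 - fps_X)" "fps_deriv f"], of 1] rf' r2
    by (simp add: g_def)
  have less: "ereal (norm y) < R" if "\<bar>y\<bar> < 1" "R \<ge> 1" for y :: real and R
    using that by (auto intro: order.strict_trans2[of _ "ereal 1"] simp: one_ereal_def)
  have ev: "eval_fps g y = cubic_P y" if "\<bar>y\<bar> < 1" for y
  proof -
    have y: "ereal (norm y) < fps_conv_radius (fps_deriv f)" using that rf' by (rule less)
    have "eval_fps g y = eval_fps (fps_X * (1 - fps_X)) y * eval_fps (fps_deriv f) y"
      unfolding g_def by (rule eval_fps_mult) (use y r2 in auto)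
    also have "eval_fps (fps_X * (1 - fps_X)) y = y * (1 - y)"
      by (subst eval_fps_mult) (auto simp: r1 eval_fps_diff)
    finally show ?thesis by (simp add: cubic_P_def cubic_F'_def f_def)
  qed
  \<comment> \<open>Coefficient n on the left is (n + 1) ((n + 1) f_(n+1) - n f_n), which the
    recursion reduces to (2/9) f_n.\<close>
  have dg: "fps_deriv g = fps_const (2/9) * f"
  proof (rule fps_ext)
    fix n
    have "g = fps_X * fps_deriv f - fps_X * (fps_X * fps_deriv f)"
      by (simp add: g_def algebra_simps)
    hence "fps_nth g (Suc n) = fps_nth (fps_X * fps_deriv f - fps_X * (fps_X * fps_deriv f)) (Suc n)"
      by (rule arg_cong)
    hence g: "fps_nth g (Suc n) = (real n + 1) * fps_nth f (Suc n) - real n * fps_nth f n"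
      by (cases n) (simp_all add: field_simps)
    have "(real n + 1)\<^sup>2 * fps_nth f (Suc n) = ((real n)\<^sup>2 + real n + 2/9) * fps_nth f n"
      using cubic_coeff_Suc[of n] by (simp only: f_def)
    thus "fps_nth (fps_deriv g) n = fps_nth (fps_const (2/9) * f) n"
      by (simp add: g) (simp add: algebra_simps power2_eq_square)
  qed
  have x: "ereal (norm x) < fps_conv_radius g" using assms rg by (rule less)
  have "(eval_fps g has_real_derivative eval_fps (fps_deriv g) x) (at x)"
    by (rule has_field_derivative_eval_fps[OF x])
  moreover have "eval_fps (fps_deriv g) x = 2/9 * cubic_F x"
  proof -
    have "cubic_F x = eval_fps f x" by (simp add: cubic_F_def hyp2F1_def f_def)
    moreover have "eval_fps (fps_const (2/9) * f) x = eval_fps (fps_const (2/9)) x * eval_fps f x"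
      by (rule eval_fps_mult) (use assms in \<open>auto simp: rf one_ereal_def\<close>)
    ultimately show ?thesis by (simp add: dg)
  qed
  ultimately have *: "(eval_fps g has_real_derivative 2/9 * cubic_F x) (at x)" by simp
  have "(cubic_P has_real_derivative 2/9 * cubic_F x) (at x)"
    by (rule has_field_derivative_transform_within_open[OF *, of "{-1<..<1}"]) (use assms ev in auto)
  thus ?thesis by (rule has_field_derivative_at_within)
qed

section \<open>The cubic transformation and the period ratio\<close>

lemma cubic_F_transformation:
  assumes x: "0 \<le> x" "x < 1"
  shows "cubic_F (1 - ((1 - x) / (1 + 2 * x)) ^ 3) = (1 + 2 * x) * cubic_F (x ^ 3)"
proof -
  define h where "h = (\<lambda>x::real. 1 - ((1 - x) / (1 + 2 * x)) ^ 3)"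
  define A where "A = (\<lambda>x::real. x * (1 - x^3) / (1 + 2*x)^2)"
  \<comment> \<open>\<open>W\<close> is \<open>A\<close> times the Wronskian of the two sides; \<open>A\<close> vanishes at 0.\<close>
  define W where "W = (\<lambda>x. cubic_P (h x) * ((1 + 2*x) * cubic_F (x^3)) -
      cubic_F (h x) * (2 * A x * cubic_F (x^3) + 3 * cubic_P (x^3) / (1 + 2*x)))"
  define h' where "h' = (\<lambda>x::real. 9 * (1 - x)^2 / (1 + 2*x)^4)"
  have cube: "0 \<le> t^3 \<and> t^3 < 1" if "0 \<le> t" "t < 1" for t :: real
    using that by (auto simp: power_less_one_iff)
  have h_in: "0 \<le> h t" "h t < 1" if "0 \<le> t" "t < 1" for t
    using that by (auto simp: h_def power_le_one divide_simps)
  have dh: "(h has_real_derivative h' t) (at t within B)" if "0 \<le> t" "t < 1" for t B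
  proof -
    define m where "m = 1 + 2*t"
    have m: "m > 0" using that by (simp add: m_def)
    have d: "((\<lambda>t. (1 - t) / (1 + 2*t)) has_real_derivative (- (1 + 2*t) - (1 - t) * 2) / ((1 + 2*t) * (1 + 2*t))) (at t within B)"
      using that by (auto intro!: derivative_eq_intros)
    have e: "(- (1 + 2*t) - (1 - t) * 2) / ((1 + 2*t) * (1 + 2*t)) = - 3 / m^2"
      by (simp add: m_def power2_eq_square)
    have "(h has_real_derivative 0 - of_nat 3 * (- 3 / m^2 * ((1 - t) / (1 + 2*t)) ^ (3 - Suc 0))) (at t within B)"
      unfolding h_def by (rule DERIV_diff[OF DERIV_const DERIV_power[OF d[unfolded e]]])
    moreover have "0 - of_nat 3 * (- 3 / m^2 * ((1 - t) / (1 + 2*t)) ^ (3 - Suc 0)) = h' t"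
      using m unfolding h'_def m_def[symmetric] by (simp add: divide_simps)
    ultimately show ?thesis by (simp only:)
  qed
  have dA: "(A has_real_derivative (1 - 2*t - 4*t^3 - 4*t^4) / (1 + 2*t)^3) (at t within B)"
    if "0 \<le> t" "t < 1" for t B
  proof -
    define m where "m = 1 + 2*t"
    have m: "m > 0" using that by (simp add: m_def)
    have "(A has_real_derivative
        ((1 - 4 * t^3) * (1 + 2*t)^2 - (t * (1 - t^3)) * (4 * (1 + 2*t))) / ((1 + 2*t)^2 * (1 + 2*t)^2)) (at t within B)"
      unfolding A_def
      apply (rule derivative_eq_intros refl | (use that in force))+
      by (simp add: power2_eq_square) (simp add: algebra_simps eval_nat_numeral)
    moreover have "((1 - 4 * t^3) * (1 + 2*t)^2 - (t * (1 - t^3)) * (4 * (1 + 2*t))) / ((1 + 2*t)^2 * (1 + 2*t)^2) =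
        ((1 - 4 * t^3) * m - 4 * (t * (1 - t^3))) / m^3"
      unfolding m_def[symmetric] using m by (simp add: divide_simps eval_nat_numeral) (simp add: algebra_simps)
    moreover have "(1 - 4 * t^3) * m - 4 * (t * (1 - t^3)) = 1 - 2*t - 4*t^3 - 4*t^4"
      by (simp add: m_def algebra_simps eval_nat_numeral)
    ultimately show ?thesis by (simp only: m_def)
  qed
  have dFh: "((\<lambda>t. cubic_F (h t)) has_real_derivative cubic_F' (h t) * h' t) (at t within B)"
     and dPh: "((\<lambda>t. cubic_P (h t)) has_real_derivative 2/9 * cubic_F (h t) * h' t) (at t within B)"
    if "0 \<le> t" "t < 1" for t B
    using that h_in[of t]
    by (intro DERIV_chain2[OF _ dh] cubic_F_has_derivative cubic_P_has_derivative; simp)+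
  have dF3: "((\<lambda>t. cubic_F (t^3)) has_real_derivative cubic_F' (t^3) * (3 * t^2)) (at t within B)"
    and dP3: "((\<lambda>t. cubic_P (t^3)) has_real_derivative 2/9 * cubic_F (t^3) * (3 * t^2)) (at t within B)"
    if "0 \<le> t" "t < 1" for t B
  proof -
    have d3: "((\<lambda>t. t^3) has_real_derivative 3 * t^2) (at t within B)"
      using DERIV_power[OF DERIV_ident, of 3 t B] by simp
    show "((\<lambda>t. cubic_F (t^3)) has_real_derivative cubic_F' (t^3) * (3 * t^2)) (at t within B)"
      and "((\<lambda>t. cubic_P (t^3)) has_real_derivative 2/9 * cubic_F (t^3) * (3 * t^2)) (at t within B)"
      using that cube[of t]
      by (intro DERIV_chain2[OF _ d3] cubic_F_has_derivative cubic_P_has_derivative; simp)+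
  qed
  have m: "1 + 2 * t > 0" if "0 \<le> t" for t :: real using that by auto
  \<comment> \<open>The weight \<open>A\<close> is made for this relation: it turns P(h) into
    \<open>A\<close> times the derivative of F(h), so both sides of the claim can be compared
    through the operator y -> (A y')'.\<close>
  have hh: "h t * (1 - h t) = h' t * A t" if "0 \<le> t" "t < 1" for t
    using m[of t] that unfolding h_def h'_def A_def 
    by (simp add: divide_simps) (simp add: algebra_simps eval_nat_numeral)
  have dW: "(W has_real_derivative 0) (at t)" if t: "0 < t" "t < 1" for t
  proof -
    define m where "m = 1 + 2*t"
    define F P F3 P3 where defs: "F = cubic_F (h t)" "P = cubic_P (h t)" "F3 = cubic_F (t^3)" "P3 = cubic_P (t^3)"
    have m0: "m > 0" using t by (simp add: m_def)
    have t3: "1 - t^3 > 0" using cube[of t] t by auto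
    have Apos: "A t > 0" using t t3 by (simp add: A_def)
    have h'pos: "h' t > 0" using t by (simp add: h'_def)
    have "cubic_P (h t) = h' t * A t * cubic_F' (h t)"
      using hh[of t] t by (simp add: cubic_P_def)
    hence FF: "cubic_F' (h t) * h' t = P / A t"
      using Apos by (simp add: defs)
    have FF3: "cubic_F' (t^3) * (3 * t^2) = 3 * P3 / (t * (1 - t^3))"
      using t t3 by (simp add: defs cubic_P_def eval_nat_numeral)
    have "(W has_real_derivative
       (2/9 * F * h' t * (m * F3) + P * (2 * F3 + m * (3 * P3 / (t * (1 - t^3)))) -
       ((P / A t) * (2 * A t * F3 + 3 * P3 / m) +
        F * (2 * ((1 - 2*t - 4*t^3 - 4*t^4) / m^3) * F3 + 2 * A t * (3 * P3 / (t * (1 - t^3))) +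
          (3 * (2/9 * F3 * (3 * t^2)) * m - 3 * P3 * 2) / (m * m))))) (at t)"
      (is "(_ has_real_derivative ?V) _")
      unfolding W_def
      apply (rule derivative_eq_intros dFh dPh dA dF3 dP3 refl | (use t in force))+
      using t FF FF3 by (simp add: defs m_def algebra_simps)
    moreover have "?V = 0"
    proof -
      have Aeq: "A t = t * (1 - t^3) / m^2" by (simp add: A_def m_def)
      have h'eq: "h' t = 9 * (1 - t)^2 / m^4" by (simp add: h'_def m_def)
      define k where "k = 1 - t^3"
      have k: "k > 0" using t3 by (simp add: k_def)
      have e1: "P * (m * (3 * P3 / (t * k))) = (P / A t) * (3 * P3 / m)"
        using t m0 k unfolding Aeq k_def[symmetric] by (simp add: field_simps eval_nat_numeral)
      have e2: "(P / A t) * (2 * A t * F3) = P * (2 * F3)" using Apos by simp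
      have e3: "2 * A t * (3 * P3 / (t * k)) = 6 * P3 / m^2"
        using t m0 k unfolding Aeq k_def[symmetric] by (simp add: field_simps eval_nat_numeral)
      \<comment> \<open>Here the two differential equations are seen to coincide: for y = (1 + 2t)
        F(t^3) this is the coefficient of F(t^3) in (A y')' = (2/9) h' y. The terms with P(t^3) in
        (A y')' cancel by \<open>e3\<close> and \<open>e5\<close>.\<close>
      have e4: "2/9 * h' t * m = 2 * ((1 - 2*t - 4*t^3 - 4*t^4) / m^3) + 3 * (2/9 * (3 * t^2)) / m"
        using m0 unfolding h'eq by (simp add: divide_simps) (simp add: m_def algebra_simps eval_nat_numeral)
      have e5: "(3 * (2/9 * F3 * (3 * t^2)) * m - 3 * P3 * 2) / (m * m) = F3 * (3 * (2/9 * (3 * t^2)) / m) - 6 * P3 / m^2"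
        using m0 by (simp add: field_simps power2_eq_square)
      define c1 c2 where "c1 = (1 - 2*t - 4*t^3 - 4*t^4) / m^3" and "c2 = 3 * (2/9 * (3 * t^2)) / m"
      have "2/9 * F * h' t * (m * F3) = (2/9 * h' t * m) * (F * F3)" by simp
      also have "\<dots> = (2 * c1 + c2) * (F * F3)" unfolding e4 c1_def c2_def ..
      finally have "2/9 * F * h' t * (m * F3) = (2 * c1 + c2) * (F * F3)" .
      thus ?thesis
        unfolding k_def[symmetric] e3 e5 c1_def[symmetric] c2_def[symmetric] distrib_left[of P] distrib_left[of "P / A t"] e1 e2
        by (simp only:) (simp add: algebra_simps)
    qed
    ultimately show ?thesis by (simp only:)
  qed
  have contW: "continuous_on {0..t} W" if "t < 1" for t
    unfolding W_def
    by (intro continuous_intros DERIV_continuous_on[OF dFh] DERIV_continuous_on[OF dPh]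
        DERIV_continuous_on[OF dA] DERIV_continuous_on[OF dF3] DERIV_continuous_on[OF dP3])
      (use that in auto)
  have W0: "W t = 0" if "0 \<le> t" "t < 1" for t
  proof (cases "t = 0")
    case True
    thus ?thesis by (simp add: W_def h_def A_def cubic_P_def)
  next
    case False
    have "W t = W 0"
      by (rule DERIV_isconst2[of 0 t]) (use False that contW dW in auto)
    thus ?thesis by (simp add: W_def h_def A_def cubic_P_def)
  qed
  \<comment> \<open>A vanishing Wronskian makes the quotient of the two sides constant where
    \<open>A\<close> is positive, that is away from 0; at 0 the quotient is 1.\<close>
  define R where "R = (\<lambda>t. cubic_F (h t) / ((1 + 2*t) * cubic_F (t^3)))"
  have pos3: "cubic_F (t^3) > 0" if "0 \<le> t" "t < 1" for t
    using cubic_F_ge_1[of "t^3"] cube[of t] that by auto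
  have dR: "(R has_real_derivative 0) (at t)" if t: "0 < t" "t < 1" for t
  proof -
    have t3: "1 - t^3 > 0" using cube[of t] t by auto
    have Apos: "A t > 0" using t t3 by (simp add: A_def)
    have h'pos: "h' t > 0" using t by (simp add: h'_def)
    have "cubic_P (h t) = h' t * A t * cubic_F' (h t)"
      using hh[of t] t by (simp add: cubic_P_def)
    hence FF: "cubic_F' (h t) * h' t = cubic_P (h t) / A t"
      using Apos by simp
    define D where "D = (1 + 2*t) * cubic_F (t^3)"
    have D: "D \<noteq> 0" using pos3[of t] t by (simp add: D_def)
    define E where "E = 2 * cubic_F (t^3) + (1 + 2*t) * (cubic_F' (t^3) * (3 * t^2))"
    have "(R has_real_derivative (cubic_F' (h t) * h' t * D - cubic_F (h t) * E) / (D * D)) (at t)"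
      unfolding R_def
      apply (rule derivative_eq_intros dFh dF3 refl | (use t D in \<open>force simp: D_def\<close>))+
      by (simp add: D_def E_def algebra_simps)
    moreover have "A t * (cubic_F' (h t) * h' t * D - cubic_F (h t) * E) = W t"
    proof -
      have "A t * E = 2 * A t * cubic_F (t^3) + 3 * cubic_P (t^3) / (1 + 2*t)"
        using t unfolding E_def A_def cubic_P_def by (simp add: divide_simps) (simp add: algebra_simps eval_nat_numeral)
      moreover have "A t * (cubic_F' (h t) * h' t * D) = cubic_P (h t) * D" using FF Apos by simp
      moreover have "A t * (cubic_F' (h t) * h' t * D - cubic_F (h t) * E) =
          A t * (cubic_F' (h t) * h' t * D) - cubic_F (h t) * (A t * E)"
        by (simp add: right_diff_distrib mult.left_commute)
      ultimately show ?thesis unfolding W_def D_def by (simp only:)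
    qed
    ultimately show ?thesis using W0[of t] t Apos by simp
  qed
  have contR: "continuous_on {0..t} R" if "t < 1" for t
    unfolding R_def using that pos3
    by (intro continuous_intros DERIV_continuous_on[OF dFh] DERIV_continuous_on[OF dF3]) force+
  have "R x = 1"
  proof (cases "x = 0")
    case True
    thus ?thesis by (simp add: R_def h_def)
  next
    case False
    have "R x = R 0"
      by (rule DERIV_isconst2[of 0 x]) (use False x contR dR in auto)
    also have "R 0 = 1" by (simp add: R_def h_def)
    finally show ?thesis .
  qed
  thus ?thesis using pos3[OF x] m[OF x(1)] by (simp add: R_def h_def right_inverse_eq)
qed

text \<open>The cubic analogue of the quotient K' / K of complete elliptic integrals.\<close>

definition cubic_M :: "real \<Rightarrow> real" where
  "cubic_M t = cubic_F (1 - t) / cubic_F t"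

text \<open>The map x -> y = (1 - x) / (1 + 2x) is an involution, so the transformation of F can be
  applied at x for the denominator and at y for the numerator. The factor 3 is (1 + 2x)(1 +
  2y).\<close>

lemma cubic_M_transformation:
  assumes x: "0 < x" "x < 1"
  shows "cubic_M (1 - ((1 - x) / (1 + 2 * x)) ^ 3) = cubic_M (x ^ 3) / 3"
proof -
  define y where "y = (1 - x) / (1 + 2 * x)"
  have y: "0 < y" "y < 1" using x by (auto simp: y_def)
  have xy: "(1 - y) / (1 + 2 * y) = x" "1 + 2 * y = 3 / (1 + 2 * x)" using x by (auto simp: y_def divide_simps)
  have 1: "cubic_F (1 - y^3) = (1 + 2 * x) * cubic_F (x^3)"
    using cubic_F_transformation[of x] x by (simp add: y_def)
  have 2: "cubic_F (1 - x^3) = (1 + 2 * y) * cubic_F (y^3)"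
    using cubic_F_transformation[of y] y unfolding xy(1) by simp
  have y3: "y^3 < 1" "x^3 < 1" using x y by (auto simp: power_less_one_iff)
  have "cubic_F (y^3) \<noteq> 0" "cubic_F (x^3) \<noteq> 0" using cubic_F_ge_1[of "y^3"] cubic_F_ge_1[of "x^3"] y y3 x by auto
  thus ?thesis unfolding cubic_M_def y_def[symmetric] using x by (simp add: 1 2 xy(2))
qed

section \<open>The logarithmic singularity at 1\<close>

lemma Gamma_third_times_Gamma_two_thirds: "Gamma (1/3) * Gamma (2/3 :: real) = 2 * pi / sqrt 3"
proof -
  have "Gamma (complex_of_real (1/3)) * Gamma (1 - complex_of_real (1/3)) =
      of_real pi / sin (of_real pi * complex_of_real (1/3))"
    by (rule Gamma_reflection_complex)
  also have "1 - complex_of_real (1/3) = complex_of_real (2/3)" by (simp add: field_simps flip: of_real_diff)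
  also have "of_real pi * complex_of_real (1/3) = complex_of_real (pi/3)" by simp
  finally have "complex_of_real (Gamma (1/3) * Gamma (2/3)) = complex_of_real (pi / sin (pi/3))"
    by (simp only: Gamma_complex_of_real sin_of_real flip: of_real_mult of_real_divide)
  hence "Gamma (1/3) * Gamma (2/3) = pi / sin (pi/3)"
    by (simp only: of_real_eq_iff)
  thus ?thesis by (simp add: sin_60)
qed

text \<open>Because 1/3 + 2/3 = 1, the product of the two Gamma series is n times n!^2 divided by
  the two Pochhammer symbols. Its limit is Gamma(1/3) Gamma(2/3) = 2 pi / sqrt 3, and the constant
  is the reciprocal.\<close>

lemma cubic_coeff_asymptotics:
  "(\<lambda>n. (real n + 1) * cubic_coeff (Suc n)) \<longlonglongrightarrow> sqrt 3 / (2 * pi)"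
proof -
  define GG where "GG = (\<lambda>n. Gamma_series (1/3) n * Gamma_series (2/3::real) n)"
  have lim: "GG \<longlonglongrightarrow> 2 * pi / sqrt 3"
    unfolding GG_def Gamma_third_times_Gamma_two_thirds[symmetric]
    by (intro tendsto_mult Gamma_series_LIMSEQ)
  have "(\<lambda>n. (real n / (real n + 1)) / GG n) \<longlonglongrightarrow> 1 / (2 * pi / sqrt 3)"
    by (intro tendsto_divide lim) (real_asymp, simp)
  moreover have "eventually (\<lambda>n. (real n / (real n + 1)) / GG n = (real n + 1) * cubic_coeff (Suc n)) sequentially"
    using eventually_gt_at_top[of 0]
  proof eventually_elim
    case (elim n)
    define p1 p2 where "p1 = pochhammer (1/3::real) (Suc n)" and "p2 = pochhammer (2/3::real) (Suc n)"
    have p: "p1 > 0" "p2 > 0" by (auto simp: p1_def p2_def pochhammer_pos)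
    have "exp (1/3 * ln (real n)) * exp (2/3 * ln (real n)) = real n"
      using elim by (simp flip: exp_add)
    hence "GG n = (fact n)^2 * real n / (p1 * p2)"
      by (simp add: GG_def Gamma_series_def p1_def[symmetric] p2_def[symmetric] power2_eq_square)
    moreover have "cubic_coeff (Suc n) = p1 * p2 / ((real n + 1) * fact n)^2"
      by (simp add: fps_hypergeo_nth p1_def p2_def power2_eq_square pochhammer_fact[symmetric] algebra_simps)
    moreover have "(real n / (real n + 1)) / (q\<^sup>2 * real n / (p1 * p2)) =
        (real n + 1) * (p1 * p2 / ((real n + 1) * q)\<^sup>2)" if "q > 0" for q
      using p elim that by (simp add: divide_simps power2_eq_square)
    moreover have "fact n > (0::real)" by simp
    ultimately show ?case by (simp only:)
  qed
  ultimately show ?thesis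
    by (auto elim: Lim_transform_eventually)
qed

text \<open>An Abelian argument: the Taylor coefficients d_n of F' increase to K, so comparison with
  the geometric series bounds (1 - x) F' above by K, and the tail from index N bounds it below by
  d_N x^N.\<close>

lemma cubic_F'_asymptotics:
  "((\<lambda>x. (1 - x) * cubic_F' x) \<longlongrightarrow> sqrt 3 / (2 * pi)) (at_left 1)"
proof -
  define d where "d = (\<lambda>n. (real n + 1) * cubic_coeff (Suc n))"
  define K where "K = sqrt 3 / (2 * pi)"
  have d_lim: "d \<longlonglongrightarrow> K" using cubic_coeff_asymptotics by (simp add: d_def K_def)
  \<comment> \<open>The recursion factor (n + 1)^2 + (n + 1) + 2/9 exceeds (n + 1)(n + 2) by
    2/9.\<close>
  have "d n \<le> d (Suc n)" for n
  proof -
    have "(real n + 2) * d n \<le> (real n + 2)^2 * cubic_coeff (Suc (Suc n))"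
      using cubic_coeff_Suc[of "Suc n"] cubic_coeff_pos[of "Suc n"]
      by (simp add: d_def power2_eq_square algebra_simps)
    also have "\<dots> = (real n + 2) * d (Suc n)" by (simp add: d_def power2_eq_square algebra_simps)
    finally show ?thesis by simp
  qed
  hence inc: "incseq d" by (rule incseq_SucI)
  have le: "d n \<le> K" for n by (rule incseq_le[OF inc d_lim])
  have nn: "d n \<ge> 0" for n using cubic_coeff_pos[of "Suc n"] by (simp add: d_def)
  have sums: "(\<lambda>n. d n * x ^ n) sums cubic_F' x" if "0 < x" "x < 1" for x
    using cubic_F'_sums[of x] that by (simp add: d_def)
  have upper: "(1 - x) * cubic_F' x \<le> K" if "0 < x" "x < 1" for x
  proof -
    have "(\<lambda>n. K * x ^ n) sums (K * (1 / (1 - x)))"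
      using that by (intro sums_mult geometric_sums) auto
    from sums_le[OF _ sums[OF that] this] have "cubic_F' x \<le> K * (1 / (1 - x))"
      using le that by (auto intro: mult_right_mono)
    thus ?thesis using that by (simp add: field_simps)
  qed
  have lower: "d N * x ^ N \<le> (1 - x) * cubic_F' x" if "0 < x" "x < 1" for x N
  proof -
    have "(\<lambda>n. d N * x ^ N * x ^ n) sums (d N * x ^ N * (1 / (1 - x)))"
      using that by (intro sums_mult geometric_sums) auto
    moreover have "(\<lambda>n. d (n + N) * x ^ (n + N)) sums (cubic_F' x - (\<Sum>n<N. d n * x ^ n))"
      using sums[OF that] by (rule sums_split_initial_segment)
    moreover have "d N * x ^ N * x ^ n \<le> d (n + N) * x ^ (n + N)" for n
      using incseqD[OF inc, of N "n + N"] that by (simp add: power_add mult.assoc mult.left_commute mult_mono)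
    ultimately have "d N * x ^ N * (1 / (1 - x)) \<le> cubic_F' x - (\<Sum>n<N. d n * x ^ n)"
      by (rule sums_le[rotated])
    moreover have "(\<Sum>n<N. d n * x ^ n) \<ge> 0" using nn that by (intro sum_nonneg) auto
    ultimately have "d N * x ^ N * (1 / (1 - x)) \<le> cubic_F' x" by linarith
    thus ?thesis using that by (simp add: field_simps)
  qed
  have ev01: "eventually (\<lambda>x::real. x \<in> {0<..<1}) (at_left 1)"
    by (rule eventually_at_left_real) simp
  show ?thesis unfolding K_def[symmetric]
  proof (rule order_tendstoI)
    fix a assume "a < K"
    then obtain N where N: "d N > a"
      using order_tendstoD(1)[OF d_lim] by (meson eventually_happens sequentially_bot)
    have "((\<lambda>x. d N * x ^ N) \<longlongrightarrow> d N * 1 ^ N) (at_left 1)" by (intro tendsto_intros)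
    hence "eventually (\<lambda>x. d N * x ^ N > a) (at_left 1)" using N by (intro order_tendstoD) auto
    with ev01 show "eventually (\<lambda>x. a < (1 - x) * cubic_F' x) (at_left 1)"
    proof eventually_elim
      case (elim x)
      thus ?case using lower[of x N] by auto
    qed
  next
    fix a assume "a > K"
    with ev01 show "eventually (\<lambda>x. (1 - x) * cubic_F' x < a) (at_left 1)"
      using upper by (auto elim!: eventually_mono intro: le_less_trans)
  qed
qed

text \<open>L'Hopital's rule against -ln (1 - x), whose derivative 1 / (1 - x) has the same order as
  F' at 1.\<close>

lemma cubic_F_asymptotics:
  "((\<lambda>t. cubic_F (1 - t) / (- ln t)) \<longlongrightarrow> sqrt 3 / (2 * pi)) (at_right 0)"
proof -
  have ev01: "eventually (\<lambda>x::real. x \<in> {0<..<1}) (at_left 1)"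
    by (rule eventually_at_left_real) simp
  have "((\<lambda>x. cubic_F x / (- ln (1 - x))) \<longlongrightarrow> sqrt 3 / (2 * pi)) (at_left 1)"
  proof (rule lhopital_left_at_top[where f' = cubic_F' and g' = "\<lambda>x. 1 / (1 - x)"])
    show "LIM x at_left 1. - ln (1 - x) :> (at_top :: real filter)" by real_asymp
    show "eventually (\<lambda>x. 1 / (1 - x) \<noteq> (0::real)) (at_left 1)"
      using ev01 by eventually_elim auto
    show "eventually (\<lambda>x. (cubic_F has_real_derivative cubic_F' x) (at x)) (at_left 1)"
      using ev01 by eventually_elim (auto intro: cubic_F_has_derivative)
    show "eventually (\<lambda>x. ((\<lambda>x. - ln (1 - x)) has_real_derivative 1 / (1 - x)) (at x)) (at_left 1)"
      using ev01 by eventually_elim (auto intro!: derivative_eq_intros)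
    show "((\<lambda>x. cubic_F' x / (1 / (1 - x))) \<longlongrightarrow> sqrt 3 / (2 * pi)) (at_left 1)"
      using cubic_F'_asymptotics by (simp add: mult.commute)
  qed
  moreover have "LIM t at_right (0::real). 1 - t :> at_left 1" by real_asymp
  ultimately have "((\<lambda>t. cubic_F (1 - t) / (- ln (1 - (1 - t)))) \<longlongrightarrow> sqrt 3 / (2 * pi)) (at_right 0)"
    by (rule filterlim_compose)
  thus ?thesis by simp
qed

lemma cubic_M_asymptotics:
  "((\<lambda>t. cubic_M t / (- ln t)) \<longlongrightarrow> sqrt 3 / (2 * pi)) (at_right 0)"
proof -
  have "(cubic_F \<longlongrightarrow> cubic_F 0) (at_right 0)"
    using DERIV_continuous[OF cubic_F_has_derivative[of 0]] by (auto simp: continuous_within)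
  from tendsto_divide[OF cubic_F_asymptotics this]
  show ?thesis by (simp add: cubic_M_def mult.commute)
qed

section \<open>Euler integrals\<close>

lemma neg_binomial_sums:
  fixes x :: real assumes "\<bar>x\<bar> < 1"
  shows "(\<lambda>n. pochhammer a n / fact n * x ^ n) sums (1 - x) powr (- a)"
proof -
  have "(\<lambda>n. (- a gchoose n) * (- x) ^ n) sums (1 + (- x)) powr (- a)"
    by (rule gen_binomial_real) (use assms in auto)
  moreover have "(- a gchoose n) * (- x) ^ n = pochhammer a n / fact n * x ^ n" for n
  proof -
    have "(- 1) ^ n * (- x) ^ n = x ^ n" by (simp flip: power_mult_distrib)
    moreover have "(- a gchoose n) * (- x) ^ n = pochhammer a n / fact n * ((- 1) ^ n * (- x) ^ n)"
      unfolding gbinomial_pochhammer by (simp only: minus_minus times_divide_eq_left times_divide_eq_right mult_ac)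
    ultimately show ?thesis by (simp only:)
  qed
  ultimately show ?thesis by simp
qed

text \<open>Expand (1 - u t)^(-2/3) and integrate term by term. All terms are nonnegative, so
  monotone convergence applies; the n-th beta integral is B(1/3, 2/3) (1/3)_n / n!, again because
  1/3 + 2/3 = 1.\<close>

lemma cubic_F_euler_integral:
  assumes u: "0 \<le> u" "u < 1"
  shows "((\<lambda>t. t powr (-2/3) * (1 - t) powr (-1/3) * (1 - u * t) powr (-2/3))
    has_integral Beta (1/3) (2/3) * cubic_F u) {0..1}"
proof -
  define a where "a = (\<lambda>n. pochhammer (2/3::real) n / fact n)"
  have a: "a n > 0" for n by (simp add: a_def pochhammer_pos)
  define w where "w = (\<lambda>t::real. t powr (-2/3) * (1 - t) powr (-1/3))"
  have beta: "((\<lambda>t. t ^ n * w t) has_integral Beta (1/3 + real n) (2/3)) {0..1}" for n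
  proof -
    have "((\<lambda>t. t powr (1/3 + real n - 1) * (1 - t) powr (2/3 - 1)) has_integral Beta (1/3 + real n) (2/3)) {0..1}"
      by (rule has_integral_Beta_real) auto
    thus ?thesis
    proof (rule has_integral_eq[rotated])
      fix t :: real assume t: "t \<in> {0..1}"
      have "1/3 + real n - 1 = real n + -2/3" by simp
      hence "t powr (1/3 + real n - 1) = t powr real n * t powr (-2/3)" by (simp only: powr_add)
      \<comment> \<open>At t = 0 both sides are 0 thanks to the factor
        \<open>0 powr (-2/3) = 0\<close>; this repairs the mismatch between
        \<open>0 powr 0 = 0\<close> and \<open>0 ^ 0 = 1\<close>.\<close>
      also have "\<dots> = t ^ n * t powr (-2/3)"
        using t by (cases "t = 0") (auto simp: powr_realpow)
      finally show "t powr (1/3 + real n - 1) * (1 - t) powr (2/3 - 1) = t ^ n * w t"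
        by (simp add: w_def)
    qed
  qed
  have beta_eq: "Beta (1/3 + real n) (2/3) = Beta (1/3) (2/3) * (pochhammer (1/3) n / fact n)" for n
  proof -
    have "pochhammer (1/3::real) n = Gamma (1/3 + real n) / Gamma (1/3)"
      by (rule pochhammer_Gamma) auto
    moreover have "Gamma (1/3::real) > 0" by (rule Gamma_real_pos) simp
    moreover have "p = g / c \<Longrightarrow> c > 0 \<Longrightarrow> g = c * p" for p g c :: real by simp
    ultimately have "Gamma (1/3 + real n) = Gamma (1/3) * pochhammer (1/3) n" by blast
    moreover have "Gamma (1/3 + real n + 2/3) = (fact n :: real)"
      using Gamma_fact[of n, where 'a = real] by (simp add: add.commute add.left_commute)
    ultimately show ?thesis by (simp add: Beta_def)
  qed
  have "((\<lambda>t. w t * (1 - u * t) powr (-2/3)) has_integral Beta (1/3) (2/3) * cubic_F u) {0..1}"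
  proof (rule has_integral_monotone_convergence_increasing)
    fix k :: nat
    show "((\<lambda>t. \<Sum>n<k. a n * u ^ n * (t ^ n * w t)) has_integral
        (\<Sum>n<k. a n * u ^ n * Beta (1/3 + real n) (2/3))) {0..1}"
      by (intro has_integral_sum has_integral_mult_right beta) auto
    fix t :: real assume t: "t \<in> {0..1}"
    show "(\<Sum>n<k. a n * u ^ n * (t ^ n * w t)) \<le> (\<Sum>n<Suc k. a n * u ^ n * (t ^ n * w t))"
      using a[of k] t u by (simp add: w_def)
  next
    fix t :: real assume t: "t \<in> {0..1}"
    have "u * t < 1" using u t mult_left_le[of t u] by auto
    hence "(\<lambda>n. a n * (u * t) ^ n) sums (1 - u * t) powr (- (2/3))"
      unfolding a_def using t u by (intro neg_binomial_sums) auto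
    from sums_mult[OF this, of "w t"]
    show "(\<lambda>k. \<Sum>n<k. a n * u ^ n * (t ^ n * w t)) \<longlonglongrightarrow> w t * (1 - u * t) powr (-2/3)"
      by (simp add: sums_def power_mult_distrib algebra_simps)
  next
    have "(\<lambda>n. cubic_coeff n * u ^ n) sums cubic_F u" by (rule cubic_F_sums) (use u in auto)
    from sums_mult[OF this, of "Beta (1/3) (2/3)"]
    have "(\<lambda>n. Beta (1/3) (2/3) * (cubic_coeff n * u ^ n)) sums (Beta (1/3) (2/3) * cubic_F u)" .
    also have "(\<lambda>n. Beta (1/3) (2/3) * (cubic_coeff n * u ^ n)) = (\<lambda>n. a n * u ^ n * Beta (1/3 + real n) (2/3))"
      by (intro ext) (simp add: beta_eq a_def fps_hypergeo_nth pochhammer_fact[symmetric])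
    finally show "(\<lambda>k. \<Sum>n<k. a n * u ^ n * Beta (1/3 + real n) (2/3)) \<longlonglongrightarrow> Beta (1/3) (2/3) * cubic_F u"
      by (simp add: sums_def)
  qed
  thus ?thesis by (simp add: w_def)
qed

text \<open>The antiderivative is -3 s^(1/3) H(s) with s = 1 - w: since (1 + 3n) (1/3)_n = (4/3)_n,
  the series H solves H + 3 s H' = (1 - s)^(-2/3). At the singular endpoint w = 1 the antiderivative
  is still continuous.\<close>

lemma incomplete_beta_third:
  assumes v: "0 < v" "v < 1"
  shows "((\<lambda>w. w powr (-2/3) * (1 - w) powr (-2/3)) has_integral
    3 * v powr (1/3) * hyp2F1 (1/3) (2/3) (4/3) v) {1 - v..1}"
proof -
  define f where "f = fps_hypergeo [1/3, 2/3] [4/3] (1::real)"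
  define H where "H = eval_fps f"
  define H' where "H' = eval_fps (fps_deriv f)"
  have rf: "fps_conv_radius f = 1" unfolding f_def by (rule fps_conv_radius_hypergeo_21) auto
  have less: "ereal (norm y) < R" if "\<bar>y\<bar> < 1" "R \<ge> 1" for y :: real and R
    using that by (auto intro: order.strict_trans2[of _ "ereal 1"] simp: one_ereal_def)
  have rf': "fps_conv_radius (fps_deriv f) \<ge> 1" using fps_conv_radius_deriv[of f] rf by simp
  have dH: "(H has_real_derivative H' s) (at s within A)" if "\<bar>s\<bar> < 1" for s A
    unfolding H_def H'_def by (rule has_field_derivative_eval_fps, rule less) (use that rf in auto)
  have key: "H s + 3 * s * H' s = (1 - s) powr (-2/3)" if s: "0 < s" "s < 1" for s
  proof -
    have 1: "(\<lambda>n. fps_nth f n * s ^ n) sums H s"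
      unfolding H_def by (rule sums_eval_fps, rule less) (use s rf in auto)
    have "(\<lambda>n. fps_nth (fps_deriv f) n * s ^ n) sums H' s"
      unfolding H'_def by (rule sums_eval_fps, rule less) (use s rf' in auto)
    from sums_mult[OF this, of s] have "(\<lambda>n. real (Suc n) * fps_nth f (Suc n) * s ^ Suc n) sums (s * H' s)"
      by (simp add: algebra_simps)
    hence 2: "(\<lambda>n. real n * fps_nth f n * s ^ n) sums (s * H' s)"
      by (subst (asm) sums_Suc_iff) simp
    have "(\<lambda>n. fps_nth f n * s ^ n + 3 * (real n * fps_nth f n * s ^ n)) sums (H s + 3 * (s * H' s))"
      by (intro sums_add sums_mult 1 2)
    moreover have "fps_nth f n * s ^ n + 3 * (real n * fps_nth f n * s ^ n) = pochhammer (2/3) n / fact n * s ^ n" for n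
    proof -
      have "pochhammer (1/3::real) (Suc n) = 1/3 * pochhammer (4/3) n"
        by (subst pochhammer_rec) simp
      hence "(1 + 3 * real n) * pochhammer (1/3::real) n = pochhammer (4/3) n"
        by (subst (asm) pochhammer_rec') (simp add: algebra_simps)
      moreover have "pochhammer (4/3::real) n > 0" by (simp add: pochhammer_pos)
      moreover have "(1 + 3 * real n) * fps_nth f n =
          ((1 + 3 * real n) * pochhammer (1/3) n) * pochhammer (2/3) n / (pochhammer (4/3) n * fact n)"
        by (simp add: f_def fps_hypergeo_nth)
      ultimately have "(1 + 3 * real n) * fps_nth f n = pochhammer (2/3) n / fact n"
        by simp
      hence "((1 + 3 * real n) * fps_nth f n) * s ^ n = pochhammer (2/3) n / fact n * s ^ n" by (rule arg_cong)
      thus ?thesis by (simp add: distrib_right)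
    qed
    ultimately have "(\<lambda>n. pochhammer (2/3) n / fact n * s ^ n) sums (H s + 3 * (s * H' s))" by simp
    moreover have "(\<lambda>n. pochhammer (2/3) n / fact n * s ^ n) sums (1 - s) powr (- (2/3))"
      by (rule neg_binomial_sums) (use s in auto)
    ultimately show ?thesis by (simp add: sums_unique2 mult.assoc)
  qed
  define G where "G = (\<lambda>w. - (3 * (1 - w) powr (1/3) * H (1 - w)))"
  have "((\<lambda>w. w powr (-2/3) * (1 - w) powr (-2/3)) has_integral G 1 - G (1 - v)) {1 - v..1}"
  proof (rule fundamental_theorem_of_calculus_interior)
    have "continuous_on {1 - v..1} (\<lambda>w. H (1 - w))"
      by (rule continuous_on_compose2[of "{0..v}" H])
        (use v in \<open>auto intro!: continuous_intros DERIV_continuous_on[OF dH]\<close>)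
    thus "continuous_on {1 - v..1} G" unfolding G_def
      by (auto intro!: continuous_intros continuous_on_powr')
    fix w assume w: "w \<in> {1 - v<..<1}"
    define s where "s = 1 - w"
    have s: "0 < s" "s < 1" using w v by (auto simp: s_def)
    have d1: "((\<lambda>w. (1 - w) powr (1/3)) has_real_derivative - (1/3 * s powr (-2/3))) (at w)"
      using w by (auto intro!: derivative_eq_intros simp: s_def)
    have d2: "((\<lambda>w. H (1 - w)) has_real_derivative H' s * (- 1)) (at w)"
    proof (rule DERIV_chain2[where f = H and g = "\<lambda>w. 1 - w"])
      show "(H has_real_derivative H' s) (at (1 - w))" using dH[of s] s by (simp add: s_def)
    qed (auto intro!: derivative_eq_intros)
    have "(G has_real_derivative - (3 * (- (1/3 * s powr (-2/3))) * H s + 3 * s powr (1/3) * (H' s * (- 1)))) (at w)"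
      unfolding G_def by (rule derivative_eq_intros d1 d2 refl)+ (simp add: s_def algebra_simps)
    moreover have "- (3 * (- (1/3 * s powr (-2/3))) * H s + 3 * s powr (1/3) * (H' s * (- 1))) =
        w powr (-2/3) * (1 - w) powr (-2/3)"
    proof -
      have "s powr (1/3) = s powr (-2/3) * s" using s powr_add[of s "-2/3" 1] by simp
      hence "- (3 * (- (1/3 * s powr (-2/3))) * H s + 3 * s powr (1/3) * (H' s * (- 1))) =
          s powr (-2/3) * (H s + 3 * s * H' s)" by (simp add: algebra_simps)
      also have "\<dots> = s powr (-2/3) * (1 - s) powr (-2/3)" by (simp add: key s)
      finally show ?thesis by (simp add: s_def mult.commute)
    qed
    ultimately show "(G has_vector_derivative w powr (-2/3) * (1 - w) powr (-2/3)) (at w)"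
      by (simp add: has_real_derivative_iff_has_vector_derivative)
  qed (use v in auto)
  moreover have "G 1 - G (1 - v) = 3 * v powr (1/3) * hyp2F1 (1/3) (2/3) (4/3) v"
    by (simp add: G_def hyp2F1_def H_def f_def)
  ultimately show ?thesis by simp
qed

section \<open>Eta quotients\<close>

definition q_poch :: "complex \<Rightarrow> nat \<Rightarrow> complex" where
  "q_poch q n = (\<Prod>k<n. 1 - q ^ Suc k)"

definition euler_phi :: "complex \<Rightarrow> complex" where
  "euler_phi q = (\<Prod>n. 1 - q ^ Suc n)"

lemma q_poch_0 [simp]: "q_poch q 0 = 1" and q_poch_Suc: "q_poch q (Suc n) = q_poch q n * (1 - q ^ Suc n)"
  by (simp_all add: q_poch_def)

lemma one_minus_power_nonzero: "norm (q::complex) < 1 \<Longrightarrow> 1 - q ^ Suc n \<noteq> 0"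
proof
  assume q: "norm q < 1" and "1 - q ^ Suc n = 0"
  hence "norm q ^ Suc n = 1" by (metis eq_iff_diff_eq_0 norm_one norm_power)
  thus False using power_less_one_iff[of "norm q" "Suc n"] q by simp
qed

lemma q_poch_nonzero: "norm q < 1 \<Longrightarrow> q_poch q n \<noteq> 0"
  using one_minus_power_nonzero[of q] by (simp add: q_poch_def del: power_Suc)

lemma convergent_euler_phi:
  assumes "norm q < 1" shows "convergent_prod (\<lambda>n. 1 - q ^ Suc n :: complex)"
proof -
  have "summable (\<lambda>i. norm q * norm q ^ i)"
    using assms by (intro summable_mult summable_geometric) auto
  hence "summable (\<lambda>i. norm ((1 - q ^ Suc i) - 1))" by (simp add: norm_mult norm_power)
  thus ?thesis by (intro abs_convergent_prod_imp_convergent_prod summable_imp_abs_convergent_prod)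
qed

lemma q_poch_tendsto:
  assumes "norm q < 1" shows "q_poch q \<longlonglongrightarrow> euler_phi q"
proof -
  have "(\<lambda>n. q_poch q (Suc n)) \<longlonglongrightarrow> euler_phi q"
    using convergent_prod_LIMSEQ[OF convergent_euler_phi[OF assms]]
    by (simp add: q_poch_def euler_phi_def lessThan_Suc_atMost)
  thus ?thesis by (rule LIMSEQ_imp_Suc)
qed

lemma euler_phi_nonzero: "norm q < 1 \<Longrightarrow> euler_phi q \<noteq> 0"
  unfolding euler_phi_def
  by (intro prodinf_nonzero convergent_euler_phi one_minus_power_nonzero)

text \<open>The extension by 0 to negative arguments makes the step rule below hold without exception.\<close>

definition q_poch_inv :: "complex \<Rightarrow> int \<Rightarrow> complex" where
  "q_poch_inv q m = (if m < 0 then 0 else 1 / q_poch q (nat m))"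

lemma q_poch_inv_step:
  assumes "norm q < 1"
  shows "q_poch_inv q (m - 1) = (1 - q powi m) * q_poch_inv q m"
proof -
  consider "m < 0" | "m = 0" | n where "m = int (Suc n)"
    by (metis Suc_pred' int_ops(1) linorder_neqE_linordered_idom pos_int_cases)
  thus ?thesis
  proof cases
    case 3
    have m1: "m - 1 = int n" using 3 by simp
    have m2: "q powi m = q ^ Suc n" unfolding 3 by (rule power_int_of_nat)
    show ?thesis unfolding m1 m2
      using one_minus_power_nonzero[OF assms, of n] q_poch_nonzero[OF assms, of n]
      by (simp add: q_poch_inv_def q_poch_Suc 3 del: power_Suc of_nat_Suc)
  qed (auto simp: q_poch_inv_def)
qed

section \<open>Jacobi's series for the cube of the Euler product\<close>

definition jacobi_c :: "complex \<Rightarrow> nat \<Rightarrow> int \<Rightarrow> complex" where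
  "jacobi_c q n j = q_poch q (2 * n + 1) * q_poch_inv q (int n + 1 + j) * q_poch_inv q (int n - j)"

text \<open>\<open>jacobi_c q n j\<close> is the Gaussian binomial coefficient with top 2n + 1 and
  bottom n - j, and the recursion is two q-Pascal steps at once. The step rule expresses all
  reciprocals through \<open>x\<close> and \<open>y\<close>, after which a polynomial identity in
  \<open>X\<close> and \<open>Y\<close> is left.\<close>

lemma jacobi_c_rec:
  assumes q: "norm q < 1" "q \<noteq> 0"
  shows "jacobi_c q (Suc n) j = (1 + q ^ (2 * n + 2)) * jacobi_c q n j
    + q powi (int n + 1 - j) * jacobi_c q n (j - 1) + q powi (int n + 2 + j) * jacobi_c q n (j + 1)"
proof -
  define X Y where "X = q powi (int n - j)" and "Y = q powi (int n + 1 + j)"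
  define x y where "x = q_poch_inv q (int n + 1 - j)" and "y = q_poch_inv q (int n + 2 + j)"
  have U: "q powi (int n + 1 - j) = q * X"
    using power_int_add_1'[of q "int n - j"] q by (simp add: X_def algebra_simps)
  have V: "q powi (int n + 2 + j) = q * Y"
    using power_int_add_1'[of q "int n + 1 + j"] q by (simp add: Y_def algebra_simps)
  have XY: "q ^ (2 * n + 2) = q * X * Y"
  proof -
    have "q powi 1 * q powi (int n - j) * q powi (int n + 1 + j) = q powi (1 + (int n - j) + (int n + 1 + j))"
      using q(2) by (simp only: power_int_add simp_thms)
    also have "1 + (int n - j) + (int n + 1 + j) = int (2 * n + 2)" by simp
    finally show ?thesis by (simp only: X_def Y_def power_int_of_nat power_int_1_right)
  qed
  have e1: "q_poch_inv q (int n - j) = (1 - q * X) * x"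
    using q_poch_inv_step[OF q(1), of "int n + 1 - j"] U by (simp add: x_def)
  have e2: "q_poch_inv q (int n + 1 + j) = (1 - q * Y) * y"
    using q_poch_inv_step[OF q(1), of "int n + 2 + j"] V by (simp add: y_def algebra_simps)
  have e3: "q_poch_inv q (int n + j) = (1 - Y) * ((1 - q * Y) * y)"
    using q_poch_inv_step[OF q(1), of "int n + 1 + j"] e2 by (simp add: Y_def)
  have e4: "q_poch_inv q (int n - j - 1) = (1 - X) * ((1 - q * X) * x)"
    using q_poch_inv_step[OF q(1), of "int n - j"] e1 by (simp add: X_def)
  have P: "q_poch q (2 * Suc n + 1) = q_poch q (2 * n + 1) * (1 - q * X * Y) * (1 - q * (q * X * Y))"
  proof -
    have "q ^ Suc (2 * n + 1) = q * X * Y" using XY by simp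
    hence "q_poch q (Suc (Suc (2 * n + 1))) = q_poch q (2 * n + 1) * (1 - q * X * Y) * (1 - q * (q * X * Y))"
      by (simp only: q_poch_Suc power_Suc[of q "Suc (2 * n + 1)"])
    thus ?thesis by simp
  qed
  have c0: "jacobi_c q n j = q_poch q (2 * n + 1) * ((1 - q * Y) * y) * ((1 - q * X) * x)"
    unfolding jacobi_c_def e1 e2 ..
  have c1: "jacobi_c q n (j - 1) = q_poch q (2 * n + 1) * ((1 - Y) * ((1 - q * Y) * y)) * x"
  proof -
    have "int n + 1 + (j - 1) = int n + j" "int n - (j - 1) = int n + 1 - j" by simp_all
    thus ?thesis by (simp only: jacobi_c_def x_def e3)
  qed
  have c2: "jacobi_c q n (j + 1) = q_poch q (2 * n + 1) * y * ((1 - X) * ((1 - q * X) * x))"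
  proof -
    have "int n + 1 + (j + 1) = int n + 2 + j" "int n - (j + 1) = int n - j - 1" by simp_all
    thus ?thesis by (simp only: jacobi_c_def y_def e4)
  qed
  have c3: "jacobi_c q (Suc n) j = q_poch q (2 * n + 1) * (1 - q * X * Y) * (1 - q * (q * X * Y)) * y * x"
    unfolding jacobi_c_def P by (simp add: x_def y_def algebra_simps)
  have "(1 - q * X * Y) * (1 - q * (q * X * Y)) = (1 + q * X * Y) * ((1 - q * X) * (1 - q * Y)) +
      q * X * ((1 - Y) * (1 - q * Y)) + q * Y * ((1 - X) * (1 - q * X))"
    by (simp add: algebra_simps)
  moreover have "p5 * p6 = p7 * (p1 * p2) + q * X * (p4 * p2) + q * Y * (p3 * p1) \<Longrightarrow>
      Q * p5 * p6 * y * x = p7 * (Q * (p2 * y) * (p1 * x)) + q * X * (Q * (p4 * (p2 * y)) * x) + q * Y * (Q * y * (p3 * (p1 * x)))"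
    for p1 p2 p3 p4 p5 p6 p7 Q :: complex
  proof -
    assume "p5 * p6 = p7 * (p1 * p2) + q * X * (p4 * p2) + q * Y * (p3 * p1)"
    hence "Q * y * x * (p5 * p6) = Q * y * x * (p7 * (p1 * p2) + q * X * (p4 * p2) + q * Y * (p3 * p1))"
      by (rule arg_cong)
    thus ?thesis by (simp add: algebra_simps)
  qed
  ultimately show ?thesis unfolding c0 c1 c2 c3 U V XY by blast
qed

definition triang :: "nat \<Rightarrow> nat" where "triang n = n * (n + 1) div 2"

lemma triang_0 [simp]: "triang 0 = 0" and triang_Suc: "triang (Suc n) = triang n + Suc n"
  by (simp_all add: triang_def)

lemma triang_double: "2 * triang n = n * (n + 1)"
  by (simp add: triang_def)

text \<open>A coefficient of the finite triple product, which runs over all integers j. The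
  reflection j -> -1 - j preserves \<open>jacobi_c\<close> and the triangular exponent and flips the
  sign, so the product vanishes at z = 1; its derivative there pairs j with -1 - j and attaches the
  weight 2j + 1 to each natural j.\<close>

definition jacobi_a :: "complex \<Rightarrow> nat \<Rightarrow> nat \<Rightarrow> complex" where
  "jacobi_a q n j = (-1) ^ j * q ^ triang j * jacobi_c q n (int j)"

lemma jacobi_a_eq_0: "j > n \<Longrightarrow> jacobi_a q n j = 0"
  by (simp add: jacobi_a_def jacobi_c_def q_poch_inv_def)

lemma jacobi_a_rec_0:
  assumes q: "norm q < 1" "q \<noteq> 0"
  shows "jacobi_a q (Suc n) 0 = (1 + q ^ (2 * n + 2)) * jacobi_a q n 0 + q ^ Suc n * (jacobi_a q n 0 - jacobi_a q n 1)"
proof -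
  have 1: "q powi (int n + 1 - 0) = q ^ Suc n"
    using power_int_of_nat[of q "Suc n"] by (simp add: add.commute)
  have 2: "q powi (int n + 2 + 0) = q ^ Suc (Suc n)"
    using power_int_of_nat[of q "Suc (Suc n)"] by (simp add: add.commute)
  \<comment> \<open>The index -1 is the reflection of 0, so the recursion folds back onto natural
    indices.\<close>
  have 3: "jacobi_c q n (0 - 1) = jacobi_c q n 0" by (simp add: jacobi_c_def add.commute mult_ac)
  show ?thesis
    using jacobi_c_rec[OF q, of n 0] unfolding 1 2 3
    by (simp add: jacobi_a_def triang_Suc algebra_simps)
qed

lemma jacobi_a_rec_Suc:
  assumes q: "norm q < 1" "q \<noteq> 0"
  shows "jacobi_a q (Suc n) (Suc j) = (1 + q ^ (2 * n + 2)) * jacobi_a q n (Suc j)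
    - q ^ Suc n * (jacobi_a q n j + jacobi_a q n (Suc (Suc j)))"
proof -
  have 1: "q ^ Suc j * q powi (int n + 1 - int (Suc j)) = q ^ Suc n"
  proof -
    have "q powi int (Suc j) * q powi (int n + 1 - int (Suc j)) = q powi (int (Suc j) + (int n + 1 - int (Suc j)))"
      using q(2) by (simp only: power_int_add simp_thms)
    also have "int (Suc j) + (int n + 1 - int (Suc j)) = int (Suc n)" by simp
    finally show ?thesis by (simp only: power_int_of_nat)
  qed
  have 2: "q powi (int n + 2 + int (Suc j)) = q ^ Suc n * q ^ Suc (Suc j)"
    using power_int_of_nat[of q "Suc n + Suc (Suc j)"] by (simp add: power_add[symmetric] algebra_simps)
  have 3: "int (Suc j) - 1 = int j" "int (Suc j) + 1 = int (Suc (Suc j))" by auto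
  have "jacobi_a q (Suc n) (Suc j) = (1 + q ^ (2 * n + 2)) * jacobi_a q n (Suc j)
     - (-1)^j * q ^ triang j * (q ^ Suc j * q powi (int n + 1 - int (Suc j))) * jacobi_c q n (int j)
     - (-1)^j * q ^ triang (Suc j) * (q ^ Suc n * q ^ Suc (Suc j)) * jacobi_c q n (int (Suc (Suc j)))"
    unfolding jacobi_a_def jacobi_c_rec[OF q, of n "int (Suc j)"] 2 3 triang_Suc[of j] power_add
    by (simp only: power_Suc[of "-1"]) (simp add: algebra_simps del: of_nat_Suc power_Suc)
  thus ?thesis unfolding 1 jacobi_a_def triang_Suc[of "Suc j"] power_add
    by (simp only: power_Suc[of "-1"]) (simp add: algebra_simps del: of_nat_Suc power_Suc)
qed

text \<open>In the induction step the neighbours of j contribute with weights 2j + 3 and 2j - 1,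
  which add up to 2 (2j + 1). The boundary terms cancel, and the sum is multiplied by 1 - 2 q^(n+1)
  + q^(2n+2), the square of the new factor.\<close>

lemma jacobi_finite:
  assumes q: "norm q < 1" "q \<noteq> 0"
  shows "(\<Sum>j\<le>n. jacobi_a q n j * of_nat (2 * j + 1)) = q_poch q n ^ 2"
proof (induction n)
  case 0
  have "1 - q \<noteq> 0" using one_minus_power_nonzero[OF q(1), of 0] by simp
  thus ?case by (simp add: jacobi_a_def jacobi_c_def q_poch_inv_def q_poch_Suc)
next
  case (Suc n)
  define a where "a = jacobi_a q n"
  define N where "N = Suc (Suc n)"
  have tail: "(\<Sum>j<M. a j * f j) = (\<Sum>j\<le>n. a j * f j)" if "M > n" for M and f :: "nat \<Rightarrow> complex"
    using that by (intro sum.mono_neutral_right) (auto simp: a_def jacobi_a_eq_0)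
  have "(\<Sum>j\<le>Suc n. jacobi_a q (Suc n) j * of_nat (2 * j + 1)) =
      (\<Sum>j<Suc N. jacobi_a q (Suc n) j * of_nat (2 * j + 1))"
    by (intro sum.mono_neutral_left) (auto simp: N_def jacobi_a_eq_0)
  also have "\<dots> = jacobi_a q (Suc n) 0 + (\<Sum>j<N. jacobi_a q (Suc n) (Suc j) * of_nat (2 * Suc j + 1))"
    by (subst sum.lessThan_Suc_shift) simp
  also have "\<dots> = (1 + q ^ (2 * n + 2)) * (a 0 + (\<Sum>j<N. a (Suc j) * of_nat (2 * Suc j + 1)))
      + q ^ Suc n * (a 0 - a 1) - q ^ Suc n * ((\<Sum>j<N. a j * of_nat (2 * j + 3)) + (\<Sum>j<N. a (Suc (Suc j)) * of_nat (2 * j + 3)))"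
    unfolding jacobi_a_rec_0[OF q] jacobi_a_rec_Suc[OF q] a_def[symmetric]
    by (simp add: algebra_simps sum.distrib sum_distrib_left sum_subtractf)
  also have "a 0 + (\<Sum>j<N. a (Suc j) * of_nat (2 * Suc j + 1)) = (\<Sum>j<Suc N. a j * of_nat (2 * j + 1))"
    by (subst sum.lessThan_Suc_shift) simp
  also have "(\<Sum>j<N. a (Suc (Suc j)) * of_nat (2 * j + 3)) =
     (\<Sum>j<Suc (Suc N). a j * (of_nat (2 * j + 1) - 2)) + a 0 - a 1"
    by (simp only: sum.lessThan_Suc_shift[of _ "Suc N"] sum.lessThan_Suc_shift[of _ N]) (simp add: algebra_simps)
  also have "(\<Sum>j<Suc N. a j * of_nat (2 * j + 1)) = (\<Sum>j\<le>n. a j * of_nat (2 * j + 1))"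
    by (rule tail) (simp add: N_def)
  also have "(\<Sum>j<N. a j * of_nat (2 * j + 3)) = (\<Sum>j\<le>n. a j * of_nat (2 * j + 3))"
    by (rule tail) (simp add: N_def)
  also have "(\<Sum>j<Suc (Suc N). a j * (of_nat (2 * j + 1) - 2)) = (\<Sum>j\<le>n. a j * (of_nat (2 * j + 1) - 2))"
    by (rule tail) (simp add: N_def)
  also have "(\<Sum>j\<le>n. a j * of_nat (2 * j + 3)) = (\<Sum>j\<le>n. a j * of_nat (2 * j + 1)) + (\<Sum>j\<le>n. a j) * 2"
  proof -
    have "of_nat (2 * j + 3) = of_nat (2 * j + 1) + (2 :: complex)" for j by simp
    thus ?thesis by (simp only: distrib_left sum.distrib sum_distrib_right)
  qed
  also have "(\<Sum>j\<le>n. a j * (of_nat (2 * j + 1) - 2)) = (\<Sum>j\<le>n. a j * of_nat (2 * j + 1)) - (\<Sum>j\<le>n. a j) * 2"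
    by (simp only: right_diff_distrib sum_subtractf sum_distrib_right)
  also have "(\<Sum>j\<le>n. a j * of_nat (2 * j + 1)) = q_poch q n ^ 2"
    using Suc.IH by (simp add: a_def)
  also have "(1 + q ^ (2 * n + 2)) * q_poch q n ^ 2 + q ^ Suc n * (a 0 - a 1) - q ^ Suc n *
      (q_poch q n ^ 2 + (\<Sum>j\<le>n. a j) * 2 + (q_poch q n ^ 2 - (\<Sum>j\<le>n. a j) * 2 + a 0 - a 1)) =
      (1 - 2 * q ^ Suc n + (q ^ Suc n)\<^sup>2) * q_poch q n ^ 2"
    by (simp add: algebra_simps power_mult[symmetric] flip: power_Suc power_add)
  also have "\<dots> = q_poch q (Suc n) ^ 2"
    by (simp add: q_poch_Suc power2_eq_square algebra_simps del: power_Suc)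
  finally show ?case .
qed

lemma triang_ge: "n \<le> triang n"
  by (induction n) (auto simp: triang_Suc)

lemma summable_jacobi:
  fixes x :: real assumes "0 \<le> x" "x < 1"
  shows "summable (\<lambda>j. real (2 * j + 1) * x ^ triang j)"
proof (rule summable_comparison_test)
  have "summable (\<lambda>j. real (Suc j) * x ^ j)"
    using geometric_deriv_sums[of x] assms by (auto simp: sums_iff)
  thus "summable (\<lambda>j. 2 * (real (Suc j) * x ^ j))" by (rule summable_mult)
  have "norm (real (2 * j + 1) * x ^ triang j) \<le> 2 * (real (Suc j) * x ^ j)" for j
  proof -
    have "x ^ triang j \<le> x ^ j" using assms triang_ge[of j] by (intro power_decreasing) auto
    hence "real (2 * j + 1) * x ^ triang j \<le> real (2 * Suc j) * x ^ j"
      using assms by (intro mult_mono) auto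
    thus ?thesis using assms by (simp add: algebra_simps)
  qed
  thus "\<exists>N. \<forall>n\<ge>N. norm (real (2 * n + 1) * x ^ triang n) \<le> 2 * (real (Suc n) * x ^ n)" by blast
qed

text \<open>After division by \<open>q_poch q (2 * n + 1)\<close> the terms of the finite identity
  are dominated by a convergent series, because the reciprocals of the partial products are bounded.
  Tannery's theorem then yields phi^2 / phi on one side and the series divided by phi^2 on the
  other. The case q = 0 is separate since the recursion contains integer powers of q that may be
  negative.\<close>

lemma jacobi_cubed_sums:
  assumes q: "norm q < 1"
  shows "(\<lambda>j. (-1) ^ j * of_nat (2 * j + 1) * q ^ triang j) sums (euler_phi q ^ 3)"
proof (cases "q = 0")
  case True
  have "(\<lambda>j. (-1) ^ j * of_nat (2 * j + 1) * q ^ triang j) = (\<lambda>j. if j = 0 then 1 else 0)"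
  proof
    fix j show "(-1) ^ j * of_nat (2 * j + 1) * q ^ triang j = (if j = 0 then 1 else (0::complex))"
      using triang_ge[of j] True by auto
  qed
  moreover have "euler_phi q = 1" using True by (simp add: euler_phi_def)
  ultimately show ?thesis using sums_If_finite_set[of "{0::nat}" "\<lambda>_. 1::complex"] by simp
next
  case False
  have lim: "q_poch q \<longlonglongrightarrow> euler_phi q" by (rule q_poch_tendsto[OF q])
  have nz: "euler_phi q \<noteq> 0" by (rule euler_phi_nonzero[OF q])
  have limi: "(\<lambda>n. 1 / q_poch q n) \<longlonglongrightarrow> 1 / euler_phi q"
    by (intro tendsto_intros lim nz)
  obtain R where R: "\<And>n. norm (1 / q_poch q n) \<le> R"
    using convergent_imp_bounded[OF limi] by (auto simp: bounded_iff)
  have R0: "R \<ge> 0" using R[of 0] by simp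
  have R': "norm (q_poch_inv q m) \<le> R" for m
    using R[of "nat m"] R0 by (auto simp: q_poch_inv_def)
  define s where "s = (\<lambda>j. (-1) ^ j * of_nat (2 * j + 1) * q ^ triang j)"
  define b where "b = (\<lambda>j n. s j * q_poch_inv q (int n + 1 + int j) * q_poch_inv q (int n - int j))"
  define M where "M = (\<lambda>j. real (2 * j + 1) * norm q ^ triang j * (R * R))"
  have sumM: "summable M" unfolding M_def by (intro summable_mult2 summable_jacobi) (use q in auto)
  have bM: "norm (b j n) \<le> M j" for j n
    unfolding b_def M_def s_def norm_mult norm_power
    using R'[of "int n + 1 + int j"] R'[of "int n - int j"] R0
    unfolding norm_of_nat by (simp add: mult.assoc) (intro mult_left_mono mult_mono, auto)
  have bsum: "(\<Sum>j. b j n) = q_poch q n ^ 2 / q_poch q (2 * n + 1)" for n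
  proof -
    have "(\<Sum>j. b j n) = (\<Sum>j\<le>n. b j n)"
      by (rule suminf_finite) (auto simp: b_def q_poch_inv_def)
    also have "\<dots> = (\<Sum>j\<le>n. jacobi_a q n j * of_nat (2 * j + 1)) / q_poch q (2 * n + 1)"
      using q_poch_nonzero[OF q, of "2 * n + 1"]
      by (auto simp: sum_divide_distrib b_def s_def jacobi_a_def jacobi_c_def intro!: sum.cong)
    finally show ?thesis by (simp only: jacobi_finite[OF q False])
  qed
  have "(\<lambda>n. b j n) \<longlonglongrightarrow> s j * (1 / euler_phi q) * (1 / euler_phi q)" for j
  proof -
    have "(\<lambda>n. q_poch_inv q (int n + 1 + int j)) = (\<lambda>n. 1 / q_poch q (n + (j + 1)))"
      by (auto simp: q_poch_inv_def nat_add_distrib add_ac)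
    hence 1: "(\<lambda>n. q_poch_inv q (int n + 1 + int j)) \<longlonglongrightarrow> 1 / euler_phi q"
      using LIMSEQ_ignore_initial_segment[OF limi, of "j + 1"] by simp
    have "(\<lambda>n. q_poch_inv q (int (n + j) - int j)) = (\<lambda>n. 1 / q_poch q n)"
      by (auto simp: q_poch_inv_def)
    hence 2: "(\<lambda>n. q_poch_inv q (int n - int j)) \<longlonglongrightarrow> 1 / euler_phi q"
      using LIMSEQ_offset[of "\<lambda>n. q_poch_inv q (int n - int j)" j] limi by simp
    show ?thesis unfolding b_def by (intro tendsto_intros 1 2)
  qed
  moreover have "eventually (\<lambda>(k, n). norm (b k n) \<le> M k) (at_top \<times>\<^sub>F sequentially)"
    using bM by (intro always_eventually) auto
  ultimately have T: "summable (\<lambda>j. norm (s j * (1 / euler_phi q) * (1 / euler_phi q)))"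
    "(\<lambda>n. \<Sum>j. b j n) \<longlonglongrightarrow> (\<Sum>j. s j * (1 / euler_phi q) * (1 / euler_phi q))"
    using tannerys_theorem[of b "\<lambda>j. s j * (1 / euler_phi q) * (1 / euler_phi q)" sequentially M, OF _ _ sumM]
    by (auto simp del: times_divide_eq_right mult_1_right)
  have "(\<lambda>n. \<Sum>j. b j n) \<longlonglongrightarrow> euler_phi q ^ 2 / euler_phi q"
  proof -
    have "strict_mono (\<lambda>n::nat. 2 * n + 1)" by (auto simp: strict_mono_def)
    from LIMSEQ_subseq_LIMSEQ[OF lim this]
    have "(\<lambda>n. q_poch q (2 * n + 1)) \<longlonglongrightarrow> euler_phi q" by (simp add: o_def)
    thus ?thesis unfolding bsum by (intro tendsto_intros lim nz)
  qed
  from LIMSEQ_unique[OF T(2) this]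
  have eq: "(\<Sum>j. s j * (1 / euler_phi q) * (1 / euler_phi q)) = euler_phi q" using nz by (simp add: power2_eq_square)
  have "(\<lambda>j. s j * (1 / euler_phi q) * (1 / euler_phi q)) sums euler_phi q"
    using summable_sums[OF summable_norm_cancel[OF T(1)]] eq by simp
  from sums_mult[OF this, of "euler_phi q * euler_phi q"] nz
  have "s sums (euler_phi q ^ 3)" by (simp add: power3_eq_cube mult.assoc)
  thus ?thesis by (simp only: s_def)
qed

section \<open>Dissection modulo 3 and the cubic identity for Euler products\<close>

lemma triang_3m1: "triang (3 * m + 1) = 9 * triang m + 1"
  using triang_double[of "3 * m + 1"] triang_double[of m] by (simp add: algebra_simps)

lemma triang_dvd_3: "j mod 3 \<noteq> 1 \<Longrightarrow> 3 dvd triang j"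
proof -
  assume "j mod 3 \<noteq> 1"
  hence "j mod 3 = 0 \<or> j mod 3 = 2" by linarith
  hence "3 dvd j \<or> 3 dvd (j + 1)" by presburger
  hence "3 dvd 2 * triang j" unfolding triang_double by (metis dvd_mult dvd_mult2)
  thus ?thesis by (simp add: coprime_dvd_mult_right_iff)
qed

text \<open>The indices j = 3m + 1 have triangular exponent 9 T(m) + 1 and weight 2j + 1 = 3 (2m +
  1), so their part of Jacobi's series is again that series, at q^9 and with the factor -3q.
  Removing it leaves exponents divisible by 3.\<close>

lemma euler_phi_dissection:
  assumes q: "norm q < 1"
  shows "(\<lambda>j. if j mod 3 = 1 then 0 else (-1) ^ j * of_nat (2 * j + 1) * q ^ triang j)
    sums (euler_phi q ^ 3 + 3 * q * euler_phi (q ^ 9) ^ 3)"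
proof -
  define s where "s = (\<lambda>j. (-1) ^ j * of_nat (2 * j + 1) * q ^ triang j)"
  define t where "t = (\<lambda>j. if j mod 3 = 1 then s j else 0)"
  have q9: "norm (q ^ 9) < 1" using q by (simp add: norm_power power_less_one_iff)
  have "(\<lambda>m. (- 3 * q) * ((-1) ^ m * of_nat (2 * m + 1) * (q ^ 9) ^ triang m)) sums ((- 3 * q) * euler_phi (q ^ 9) ^ 3)"
    by (intro sums_mult jacobi_cubed_sums q9)
  also have "(\<lambda>m. (- 3 * q) * ((-1) ^ m * of_nat (2 * m + 1) * (q ^ 9) ^ triang m)) = (\<lambda>m. t (3 * m + 1))"
  proof
    fix m
    have "(-1::complex) ^ (3 * m + 1) = - ((-1) ^ m)" by (simp add: power_mult)
    moreover have "(of_nat (2 * (3 * m + 1) + 1) :: complex) = 3 * of_nat (2 * m + 1)" by simp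
    moreover have "q ^ triang (3 * m + 1) = q * (q ^ 9) ^ triang m"
      unfolding triang_3m1 power_add power_mult by simp
    moreover have "(3 * m + 1) mod 3 = 1" by presburger
    ultimately show "(- 3 * q) * ((-1) ^ m * of_nat (2 * m + 1) * (q ^ 9) ^ triang m) = t (3 * m + 1)"
      unfolding t_def s_def by (simp only: if_True) (simp add: algebra_simps)
  qed
  finally have "t sums ((- 3 * q) * euler_phi (q ^ 9) ^ 3)"
  proof (subst (asm) sums_mono_reindex)
    show "strict_mono (\<lambda>m::nat. 3 * m + 1)" by (auto simp: strict_mono_def)
    fix n assume n: "n \<notin> range (\<lambda>m::nat. 3 * m + 1)"
    have "n mod 3 \<noteq> 1"
    proof
      assume "n mod 3 = 1"
      hence "n = 3 * (n div 3) + 1" using div_mult_mod_eq[of n 3] by simp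
      thus False using n by blast
    qed
    thus "t n = 0" by (simp add: t_def)
  qed
  from sums_diff[OF jacobi_cubed_sums[OF q] this]
  have "(\<lambda>j. s j - t j) sums (euler_phi q ^ 3 + 3 * q * euler_phi (q ^ 9) ^ 3)"
    by (simp add: s_def)
  also have "(\<lambda>j. s j - t j) = (\<lambda>j. if j mod 3 = 1 then 0 else (-1) ^ j * of_nat (2 * j + 1) * q ^ triang j)"
    by (auto simp: t_def s_def)
  finally show ?thesis .
qed

text \<open>The dissected series is a power series in q^3 and therefore does not notice a cube root
  of unity; neither does q^9.\<close>

lemma euler_phi_dissection_root:
  assumes q: "norm q < 1" and z: "z ^ 3 = 1"
  shows "euler_phi (z * q) ^ 3 + 3 * (z * q) * euler_phi (q ^ 9) ^ 3 =
    euler_phi q ^ 3 + 3 * q * euler_phi (q ^ 9) ^ 3"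
proof -
  have "norm z ^ 3 = 1" using z by (metis norm_one norm_power)
  hence nz: "norm z = 1" using power_eq_imp_eq_base[of "norm z" 3 1] by simp
  have zq: "norm (z * q) < 1" using q by (simp add: norm_mult nz)
  have z9: "(z * q) ^ 9 = q ^ 9"
  proof -
    have "z ^ 9 = (z ^ 3) ^ 3" by (simp flip: power_mult)
    thus ?thesis using z by (simp add: power_mult_distrib)
  qed
  have "(z * q) ^ triang j = q ^ triang j" if "j mod 3 \<noteq> 1" for j
  proof -
    obtain k where "triang j = 3 * k" using triang_dvd_3[OF \<open>j mod 3 \<noteq> 1\<close>] by auto
    thus ?thesis using z by (simp add: power_mult_distrib power_mult)
  qed
  hence eq: "(\<lambda>j. if j mod 3 = 1 then 0 else (-1) ^ j * of_nat (2 * j + 1) * (z * q) ^ triang j) =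
      (\<lambda>j. if j mod 3 = 1 then 0 else (-1) ^ j * of_nat (2 * j + 1) * q ^ triang j)" by auto
  show ?thesis
    by (rule sums_unique2[OF euler_phi_dissection[OF zq, unfolded z9 eq] euler_phi_dissection[OF q]])
qed

text \<open>Three factors at a time: for exponents prime to 3 the cube roots of unity are permuted
  and (1 - x)(1 - z x)(1 - z^2 x) = 1 - x^3. For exponents divisible by 3 the three factors
  coincide, which the cube on the right and \<open>q_poch (q ^ 9)\<close> on the left account
  for.\<close>

lemma q_poch_cube_roots:
  assumes z: "z ^ 3 = 1" "z \<noteq> 1"
  shows "q_poch q (3 * N) * q_poch (z * q) (3 * N) * q_poch (z^2 * q) (3 * N) * q_poch (q ^ 9) N =
    q_poch (q ^ 3) (3 * N) * q_poch (q ^ 3) N ^ 3"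
proof (induction N)
  case 0
  show ?case by simp
next
  case (Suc N)
  have z0: "1 + z + z^2 = 0"
  proof -
    have "(1 - z) * (1 + z + z^2) = 1 - z ^ 3" by (simp add: algebra_simps power2_eq_square power3_eq_cube)
    thus ?thesis using z by simp
  qed
  have z3: "z * z * z = 1" using z(1) by (simp add: power3_eq_cube)
  have trip: "(1 - x) * (1 - z * x) * (1 - z^2 * x) = 1 - x ^ 3" for x
  proof -
    have "(1 - x) * (1 - z * x) * (1 - z^2 * x) =
        1 - (1 + z + z^2) * x + z * (1 + z + z^2) * x^2 - z * z * z * x ^ 3"
      by (simp add: algebra_simps power2_eq_square power3_eq_cube)
    thus ?thesis by (simp add: z0 z3)
  qed
  define m where "m = 3 * N"
  have zm: "z ^ m = 1" using z(1) by (simp add: m_def power_mult)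
  have e1: "(z * q) ^ Suc m = z * q ^ Suc m" "(z^2 * q) ^ Suc m = z^2 * q ^ Suc m"
    using zm by (simp_all add: power_mult_distrib power2_eq_square)
  have e2: "(z * q) ^ Suc (Suc m) = z^2 * q ^ Suc (Suc m)" "(z^2 * q) ^ Suc (Suc m) = z * q ^ Suc (Suc m)"
    using zm z3 by (simp_all add: power_mult_distrib power2_eq_square mult_ac)
  have e3: "(z * q) ^ Suc (Suc (Suc m)) = q ^ Suc (Suc (Suc m))" "(z^2 * q) ^ Suc (Suc (Suc m)) = q ^ Suc (Suc (Suc m))"
    using zm z3 by (simp_all add: power_mult_distrib power2_eq_square mult_ac)
  have e4: "q ^ Suc (Suc (Suc m)) = (q ^ 3) ^ Suc N"
  proof -
    have "Suc (Suc (Suc m)) = 3 * Suc N" by (simp add: m_def)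
    thus ?thesis by (simp only: power_mult)
  qed
  have e5: "(q ^ 9) ^ Suc N = (q ^ Suc (Suc (Suc m))) ^ 3" unfolding e4 power_mult[symmetric] by (rule arg_cong[where f = "power q"]) simp
  have e6: "(q ^ 3) ^ k = (q ^ k) ^ 3" for k by (simp flip: power_mult add: mult.commute)
  have S: "3 * Suc N = Suc (Suc (Suc m))" by (simp add: m_def)
  define x y w where "x = q ^ Suc m" and "y = q ^ Suc (Suc m)" and "w = q ^ Suc (Suc (Suc m))"
  note t1 = trip[of x]
  have t2: "(1 - y) * (1 - z^2 * y) * (1 - z * y) = 1 - y ^ 3" using trip[of y] by (simp add: mult_ac)
  have "q_poch q (3 * Suc N) * q_poch (z * q) (3 * Suc N) * q_poch (z^2 * q) (3 * Suc N) * q_poch (q ^ 9) (Suc N)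
     = (q_poch q m * q_poch (z * q) m * q_poch (z^2 * q) m * q_poch (q ^ 9) N) *
       ((1 - x) * (1 - z * x) * (1 - z^2 * x)) * ((1 - y) * (1 - z^2 * y) * (1 - z * y)) * ((1 - w) * (1 - w) * (1 - w)) * (1 - w ^ 3)"
    unfolding S q_poch_Suc e1 e2 e3 e5 x_def[symmetric] y_def[symmetric] w_def[symmetric] by (simp only: mult_ac)
  also have "\<dots> = (q_poch (q ^ 3) m * q_poch (q ^ 3) N ^ 3) * (1 - x ^ 3) * (1 - y ^ 3) * ((1 - w) * (1 - w) * (1 - w)) * (1 - w ^ 3)"
    unfolding t1 t2 using Suc.IH by (simp add: m_def)
  also have "\<dots> = q_poch (q ^ 3) (3 * Suc N) * q_poch (q ^ 3) (Suc N) ^ 3"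
    unfolding S q_poch_Suc e4[symmetric] e6[of "Suc m"] e6[of "Suc (Suc m)"] e6[of "Suc (Suc (Suc m))"]
      x_def[symmetric] y_def[symmetric] w_def[symmetric]
    by (simp only: power3_eq_cube mult_ac)
  finally show ?case .
qed

lemma euler_phi_cube_roots:
  assumes q: "norm q < 1" and z: "z ^ 3 = 1" "z \<noteq> 1"
  shows "euler_phi q * euler_phi (z * q) * euler_phi (z^2 * q) * euler_phi (q ^ 9) = euler_phi (q ^ 3) ^ 4"
proof -
  have "norm z ^ 3 = 1" using z by (metis norm_one norm_power)
  hence nz: "norm z = 1" using power_eq_imp_eq_base[of "norm z" 3 1] by simp
  have norms: "norm (z * q) < 1" "norm (z^2 * q) < 1" "norm (q ^ 3) < 1" "norm (q ^ 9) < 1"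
    using q by (simp_all add: norm_mult norm_power nz power_less_one_iff)
  have lim3: "(\<lambda>N. q_poch x (3 * N)) \<longlonglongrightarrow> euler_phi x" if "norm x < 1" for x
    using LIMSEQ_subseq_LIMSEQ[OF q_poch_tendsto[OF that], of "\<lambda>N. 3 * N"]
    by (simp add: strict_mono_def o_def)
  have "(\<lambda>N. q_poch q (3 * N) * q_poch (z * q) (3 * N) * q_poch (z^2 * q) (3 * N) * q_poch (q ^ 9) N)
      \<longlonglongrightarrow> euler_phi q * euler_phi (z * q) * euler_phi (z^2 * q) * euler_phi (q ^ 9)"
    by (intro tendsto_intros lim3 q_poch_tendsto q norms)
  moreover have "(\<lambda>N. q_poch (q ^ 3) (3 * N) * q_poch (q ^ 3) N ^ 3) \<longlonglongrightarrow> euler_phi (q ^ 3) * euler_phi (q ^ 3) ^ 3"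
    by (intro tendsto_intros lim3 q_poch_tendsto q norms)
  ultimately show ?thesis unfolding q_poch_cube_roots[OF z]
    by (simp add: LIMSEQ_unique eval_nat_numeral)
qed

text \<open>By the dissection, the cubes of the Euler products at q, z q and z^2 q are P - t, P - z
  t and P - z^2 t with t = 3 q C, so they multiply to P^3 - t^3. Comparison with the cube of the
  product formula over the roots of unity gives the twelfth power.\<close>

lemma euler_phi_cubic_identity:
  assumes q: "norm q < 1"
  shows "euler_phi (q ^ 3) ^ 12 = euler_phi (q ^ 9) ^ 3 * (euler_phi q ^ 9 +
    9 * q * euler_phi q ^ 6 * euler_phi (q ^ 9) ^ 3 + 27 * q ^ 2 * euler_phi q ^ 3 * euler_phi (q ^ 9) ^ 6)"
proof -
  define z where "z = cis (2 * pi / 3)"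
  have "z ^ 3 = cis (real 3 * (2 * pi / 3))" unfolding z_def by (rule Complex.DeMoivre)
  hence z: "z ^ 3 = 1" by simp
  have z1: "z \<noteq> 1"
  proof
    assume "z = 1"
    hence "Re z = 1" by simp
    thus False by (simp add: z_def cos_120)
  qed
  have zz: "1 + z + z^2 = 0"
  proof -
    have "(1 - z) * (1 + z + z^2) = 1 - z ^ 3" by (simp add: algebra_simps power2_eq_square power3_eq_cube)
    thus ?thesis using z z1 by simp
  qed
  define A B C where "A = euler_phi q ^ 3" and "B = euler_phi (q ^ 3)" and "C = euler_phi (q ^ 9) ^ 3"
  define A1 A2 where "A1 = euler_phi (z * q) ^ 3" and "A2 = euler_phi (z^2 * q) ^ 3"
  define P where "P = A + 3 * q * C"
  have e1: "A1 = P - 3 * z * q * C"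
    using euler_phi_dissection_root[OF q z] by (simp add: A1_def P_def A_def C_def algebra_simps)
  have "(z^2) ^ 3 = 1" using z by (metis power_mult mult.commute power_one)
  from euler_phi_dissection_root[OF q this] have e2: "A2 = P - 3 * z^2 * q * C"
    by (simp add: A2_def P_def A_def C_def algebra_simps)
  have "(euler_phi q * euler_phi (z * q) * euler_phi (z^2 * q) * euler_phi (q ^ 9)) ^ 3 = (B ^ 4) ^ 3"
    using euler_phi_cube_roots[OF q z z1] by (simp add: B_def)
  hence "A * A1 * A2 * C = B ^ 12"
    by (simp add: A_def A1_def A2_def C_def power_mult_distrib flip: power_mult)
  moreover have "A * A1 * A2 = P ^ 3 - 27 * q ^ 3 * C ^ 3"
  proof -
    have A: "A = P - 3 * q * C" by (simp add: P_def)
    define t where "t = 3 * q * C"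
    have "A * A1 * A2 = (P - t) * (P - z * t) * (P - z^2 * t)"
      unfolding A e1 e2 t_def by (simp only: mult_ac)
    also have "\<dots> = P ^ 3 - (1 + z + z^2) * t * P^2 + z * (1 + z + z^2) * t^2 * P - z ^ 3 * t ^ 3"
      by (simp add: algebra_simps power2_eq_square power3_eq_cube)
    also have "\<dots> = P ^ 3 - t ^ 3" using zz z by simp
    finally show ?thesis by (simp add: t_def power_mult_distrib)
  qed
  moreover have "P ^ 3 - 27 * q ^ 3 * C ^ 3 = A ^ 3 + 9 * q * A ^ 2 * C + 27 * q ^ 2 * A * C ^ 2"
    by (simp add: P_def algebra_simps power2_eq_square power3_eq_cube)
  ultimately have "B ^ 12 = C * (A ^ 3 + 9 * q * A ^ 2 * C + 27 * q ^ 2 * A * C ^ 2)"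
    by (simp add: mult.commute)
  thus ?thesis by (simp add: A_def B_def C_def flip: power_mult)
qed

section \<open>The eta function on the imaginary axis\<close>

lemma euler_phi_holomorphic: "euler_phi holomorphic_on ball 0 1"
proof (rule holomorphic_uniform_sequence[where f = "\<lambda>N q. \<Prod>n<N. 1 - q ^ Suc n"])
  show "open (ball (0::complex) 1)" by simp
  show "(\<lambda>q. \<Prod>n<N. 1 - q ^ Suc n) holomorphic_on ball 0 1" for N
    by (intro holomorphic_intros)
  fix x :: complex assume x: "x \<in> ball 0 1"
  \<comment> \<open>Half the distance to the unit circle: on the closed disc the moduli are at most
    1 - d < 1, which gives a geometric majorant.\<close>
  define d where "d = (1 - norm x) / 2"
  have d: "d > 0" using x by (simp add: d_def)
  have nrm: "norm y \<le> 1 - d" if "y \<in> cball x d" for y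
  proof -
    have "norm y \<le> norm x + dist x y" using norm_triangle_sub[of y x] by (simp add: dist_norm norm_minus_commute)
    also have "\<dots> \<le> norm x + d" using that by simp
    also have "\<dots> = 1 - d" by (simp add: d_def field_simps)
    finally show ?thesis .
  qed
  have d1: "d \<le> 1"
  proof -
    have "2 * d + norm x = 1" by (simp add: d_def field_simps)
    thus ?thesis using norm_ge_zero[of x] by linarith
  qed
  have sub: "cball x d \<subseteq> ball 0 1" using nrm d by force
  have "uniformly_convergent_on (cball x d) (\<lambda>N q. \<Prod>n<N. 1 - q ^ Suc n)"
  proof (rule uniformly_convergent_on_prod')
    show "continuous_on (cball x d) (\<lambda>q. 1 - q ^ Suc n)" for n by (intro continuous_intros)
    show "uniformly_convergent_on (cball x d) (\<lambda>N q. \<Sum>n<N. norm (1 - q ^ Suc n - 1))"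
    proof (rule Weierstrass_m_test')
      show "norm (norm (1 - q ^ Suc n - 1)) \<le> (1 - d) ^ Suc n" if "q \<in> cball x d" for n q
        using nrm[OF that] by (simp add: norm_power del: power_Suc) (intro power_mono, auto)
      show "summable (\<lambda>n. (1 - d) ^ Suc n)"
        using d d1 by (simp add: summable_mult summable_geometric)
    qed
  qed simp
  then obtain l where l: "uniform_limit (cball x d) (\<lambda>N q. \<Prod>n<N. 1 - q ^ Suc n) l sequentially"
    by (auto simp: uniformly_convergent_on_def)
  have "l y = euler_phi y" if "y \<in> cball x d" for y
  proof (rule LIMSEQ_unique)
    show "(\<lambda>N. \<Prod>n<N. 1 - y ^ Suc n) \<longlonglongrightarrow> l y" by (rule tendsto_uniform_limitI[OF l that])
    show "(\<lambda>N. \<Prod>n<N. 1 - y ^ Suc n) \<longlonglongrightarrow> euler_phi y"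
      using q_poch_tendsto[of y] sub that by (auto simp: q_poch_def[abs_def])
  qed
  hence "uniform_limit (cball x d) (\<lambda>N q. \<Prod>n<N. 1 - q ^ Suc n) euler_phi sequentially"
    using l by (simp add: uniform_limit_iff del: power_Suc)
  thus "\<exists>d. 0 < d \<and> cball x d \<subseteq> ball 0 1 \<and>
      uniform_limit (cball x d) (\<lambda>N q. \<Prod>n<N. 1 - q ^ Suc n) euler_phi sequentially"
    using d sub by blast
qed

lemma euler_phi_of_real:
  assumes q: "0 \<le> q" "q < 1"
  shows "Re (euler_phi (of_real q)) > 0" "euler_phi (of_real q) = of_real (Re (euler_phi (of_real q)))"
proof -
  define p where "p = (\<lambda>n. \<Prod>k<n. 1 - q ^ Suc k)"
  have eq: "q_poch (of_real q) n = of_real (p n)" for n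
    by (simp add: q_poch_def p_def)
  have "q ^ Suc k \<le> 1" for k using q by (intro power_le_one) auto
  hence p: "p n \<ge> 0" for n unfolding p_def by (intro prod_nonneg) auto
  have lim: "(\<lambda>n. complex_of_real (p n)) \<longlonglongrightarrow> euler_phi (of_real q)"
    using q_poch_tendsto[of "of_real q"] q by (simp add: eq[abs_def])
  from tendsto_Re[OF lim] have Re: "Re (euler_phi (of_real q)) \<ge> 0"
    using p by (intro LIMSEQ_le_const) auto
  from tendsto_Im[OF lim] have Im: "Im (euler_phi (of_real q)) = 0"
    by (simp add: LIMSEQ_const_iff)
  show 2: "euler_phi (of_real q) = of_real (Re (euler_phi (of_real q)))"
    using Im by (simp add: complex_eq_iff)
  have "euler_phi (of_real q) \<noteq> 0" using q by (intro euler_phi_nonzero) auto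
  with Re 2 show "Re (euler_phi (of_real q)) > 0"
    by (metis less_eq_real_def of_real_0)
qed

text \<open>For tau = i r / sqrt 3 these two are q^(1/24) and q. With the root as basic quantity,
  identities between eta values are polynomial identities.\<close>

definition nome_root :: "real \<Rightarrow> real" where "nome_root r = exp (- 2 * pi * r / (24 * sqrt 3))"
definition nome :: "real \<Rightarrow> real" where "nome r = exp (- 2 * pi * r / sqrt 3)"

lemma nome_root_power: "nome_root r ^ 24 = nome r"
  by (simp add: nome_root_def nome_def flip: exp_of_nat_mult)

lemma nome_mult: "nome (real n * r) = nome r ^ n" and nome_root_mult: "nome_root (real n * r) = nome_root r ^ n"
  by (simp_all add: nome_root_def nome_def field_simps flip: exp_of_nat_mult)

lemma nome_bounds: "nome r > 0" "r > 0 \<Longrightarrow> nome r < 1" "nome_root r > 0"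
  by (auto simp: nome_def nome_root_def)

definition phi_re :: "real \<Rightarrow> real" where "phi_re q = Re (euler_phi (of_real q))"

definition eta_re :: "real \<Rightarrow> real" where "eta_re r = nome_root r * phi_re (nome r)"

lemma phi_re_nome: "r > 0 \<Longrightarrow> phi_re (nome r) > 0" "r > 0 \<Longrightarrow> euler_phi (of_real (nome r)) = of_real (phi_re (nome r))"
  unfolding phi_re_def using euler_phi_of_real[of "nome r"] nome_bounds[of r] by auto

lemma eta_re_pos: "r > 0 \<Longrightarrow> eta_re r > 0"
  unfolding eta_re_def using nome_bounds phi_re_nome(1)[of r] by simp

lemma dedekind_eta_eq_euler_phi:
  "dedekind_eta \<tau> = exp (2 * of_real pi * \<i> * \<tau> / 24) * euler_phi (exp (2 * of_real pi * \<i> * \<tau>))"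
  by (simp add: dedekind_eta_def euler_phi_def)

lemma dedekind_eta_imaginary:
  assumes "r > 0"
  shows "dedekind_eta (\<i> * complex_of_real r / complex_of_real (sqrt 3)) = of_real (eta_re r)"
proof -
  have 1: "2 * of_real pi * \<i> * (\<i> * complex_of_real r / complex_of_real (sqrt 3)) = of_real (- 2 * pi * r / sqrt 3)"
    by (simp add: mult_ac)
  show ?thesis
    unfolding dedekind_eta_eq_euler_phi 1
    using phi_re_nome(2)[OF assms]
    by (simp add: eta_re_def nome_def nome_root_def exp_of_real[symmetric] del: exp_of_real)
qed

text \<open>The extra factors q and q^2 in the identity for Euler products are absorbed by the eta
  prefactors: each term carries \<open>p ^ 36\<close> times the matching power of
  \<open>q = p ^ 24\<close>.\<close>

lemma eta_re_identity:
  assumes "r > 0"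
  shows "eta_re (3 * r) ^ 12 = eta_re (9 * r) ^ 3 * (eta_re r ^ 9 + 9 * eta_re r ^ 6 * eta_re (9 * r) ^ 3
    + 27 * eta_re r ^ 3 * eta_re (9 * r) ^ 6)"
proof -
  define p where "p = nome_root r"
  define q where "q = nome r"
  define a b c where "a = phi_re q" and "b = phi_re (q ^ 3)" and "c = phi_re (q ^ 9)"
  have q: "0 < q" "q < 1" using nome_bounds assms by (auto simp: q_def)
  have qp: "q = p ^ 24" by (simp add: q_def p_def nome_root_power)
  have n: "nome (3 * r) = q ^ 3" "nome (9 * r) = q ^ 9" "nome_root (3 * r) = p ^ 3" "nome_root (9 * r) = p ^ 9"
    using nome_mult[of 3 r] nome_mult[of 9 r] nome_root_mult[of 3 r] nome_root_mult[of 9 r] by (simp_all add: q_def p_def)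
  have e: "eta_re r = p * a" "eta_re (3 * r) = p ^ 3 * b" "eta_re (9 * r) = p ^ 9 * c"
    unfolding eta_re_def n by (simp_all add: a_def b_def c_def p_def q_def)
  have "euler_phi (of_real q) = of_real a" "euler_phi (of_real q ^ 3) = of_real b" "euler_phi (of_real q ^ 9) = of_real c"
    using phi_re_nome(2)[of r] phi_re_nome(2)[of "3 * r"] phi_re_nome(2)[of "9 * r"] assms
    by (simp_all add: n a_def b_def c_def flip: q_def)
  with euler_phi_cubic_identity[of "of_real q"] q
  have "complex_of_real (b ^ 12) = complex_of_real (c ^ 3 * (a ^ 9 + 9 * q * a ^ 6 * c ^ 3 + 27 * q ^ 2 * a ^ 3 * c ^ 6))"
    by simp
  hence id: "b ^ 12 = c ^ 3 * (a ^ 9 + 9 * q * a ^ 6 * c ^ 3 + 27 * q ^ 2 * a ^ 3 * c ^ 6)"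
    by (simp only: of_real_eq_iff)
  have "(p ^ 3 * b) ^ 12 = p ^ 36 * b ^ 12" by (simp add: power_mult_distrib flip: power_mult)
  also have "\<dots> = (p ^ 9 * c) ^ 3 * ((p * a) ^ 9 + 9 * (p * a) ^ 6 * (p ^ 9 * c) ^ 3 + 27 * (p * a) ^ 3 * (p ^ 9 * c) ^ 6)"
    unfolding id qp by (simp add: power_mult_distrib algebra_simps flip: power_mult power_add)
  finally show ?thesis unfolding e .
qed

section \<open>Tripling and the inversion of the period ratio\<close>

definition cubic_T :: "real \<Rightarrow> real" where
  "cubic_T r = 27 * eta_re (3 * r) ^ 12 / (eta_re r ^ 12 + 27 * eta_re (3 * r) ^ 12)"

lemma cubic_T_bounds: assumes "r > 0" shows "0 < cubic_T r" "cubic_T r < 1"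
proof -
  have "eta_re r ^ 12 > 0" "eta_re (3 * r) ^ 12 > 0" using eta_re_pos[of r] eta_re_pos[of "3 * r"] assms by auto
  thus "0 < cubic_T r" "cubic_T r < 1" by (auto simp: cubic_T_def divide_simps add_pos_pos)
qed

text \<open>The eta identity completes both denominators to cubes: B + 27 C^4 = C (A + 3C)^3 and A^4
  + 27 B = A (A + 9C)^3. The resulting cube root x = 3C / (A + 3C) is the quotient c / a of cubic
  theta functions at q^3.\<close>

lemma cubic_T_triple:
  assumes r: "r > 0"
  obtains x where "0 < x" "x < 1" "cubic_T (3 * r) = x ^ 3" "cubic_T r = 1 - ((1 - x) / (1 + 2 * x)) ^ 3"
proof -
  define A B C where "A = eta_re r ^ 3" and "B = eta_re (3 * r) ^ 12" and "C = eta_re (9 * r) ^ 3"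
  have A: "A > 0" and C: "C > 0" using eta_re_pos[of r] eta_re_pos[of "9 * r"] r by (auto simp: A_def C_def)
  have B: "B = C * (A ^ 3 + 9 * A ^ 2 * C + 27 * A * C ^ 2)"
    unfolding A_def B_def C_def using eta_re_identity[OF r] by (simp flip: power_mult)
  have T3: "cubic_T (3 * r) = 27 * C ^ 4 / (B + 27 * C ^ 4)"
    by (simp add: cubic_T_def B_def C_def flip: power_mult)
  have T1: "cubic_T r = 27 * B / (A ^ 4 + 27 * B)"
    by (simp add: cubic_T_def B_def A_def flip: power_mult)
  define x where "x = 3 * C / (A + 3 * C)"
  have AC: "A + 3 * C > 0" "A + 9 * C > 0" using A C by auto
  have x: "0 < x" "x < 1" using A C by (auto simp: x_def divide_simps)
  have y: "(1 - x) / (1 + 2 * x) = A / (A + 9 * C)"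
    using AC x by (simp add: x_def divide_simps)
  have "B + 27 * C ^ 4 = C * (A + 3 * C) ^ 3" unfolding B by (simp add: algebra_simps eval_nat_numeral)
  hence 3: "cubic_T (3 * r) = x ^ 3" unfolding T3 using AC C by (simp add: x_def power_divide eval_nat_numeral)
  have "A ^ 4 + 27 * B = A * (A + 9 * C) ^ 3" unfolding B by (simp add: algebra_simps eval_nat_numeral)
  hence "cubic_T r = (A * (A + 9 * C) ^ 3 - A ^ 4) / (A * (A + 9 * C) ^ 3)" unfolding T1 by (simp add: algebra_simps)
  also have "\<dots> = 1 - A ^ 4 / (A * (A + 9 * C) ^ 3)" using A AC by (simp add: diff_divide_distrib)
  also have "A ^ 4 / (A * (A + 9 * C) ^ 3) = (A / (A + 9 * C)) ^ 3" using A by (simp add: power_divide eval_nat_numeral)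
  finally have "cubic_T r = 1 - ((1 - x) / (1 + 2 * x)) ^ 3" unfolding y .
  with x 3 show thesis by (intro that)
qed

lemma cubic_M_T_triple: "r > 0 \<Longrightarrow> cubic_M (cubic_T (3 * r)) = 3 * cubic_M (cubic_T r)"
  using cubic_T_triple[of r] cubic_M_transformation by (metis nonzero_mult_div_cancel_left times_divide_eq_right zero_neq_numeral)

text \<open>The powers of q in the eta quotient combine to q^(36/24 - 12/24) = q. So T = w / (1 + w)
  with w asymptotic to 27 q, and ln T differs from ln q = - 2 pi r / sqrt 3 by a bounded error,
  collected in \<open>g\<close>.\<close>

lemma cubic_T_asymptotics:
  "((\<lambda>r. - ln (cubic_T r) / r) \<longlongrightarrow> 2 * pi / sqrt 3) at_top"
  "filterlim cubic_T (at_right 0) at_top"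
proof -
  have nome0: "(nome \<longlongrightarrow> 0) at_top" unfolding nome_def by real_asymp
  have "isCont euler_phi 0"
    using euler_phi_holomorphic by (auto simp: holomorphic_on_imp_continuous_on continuous_on_eq_continuous_at
        dest!: holomorphic_on_imp_continuous_on)
  moreover have "euler_phi 0 = 1" by (simp add: euler_phi_def)
  ultimately have "(euler_phi \<longlongrightarrow> 1) (nhds 0)" by (simp add: tendsto_nhds_iff isCont_def)
  hence phi: "((\<lambda>x. phi_re (f x)) \<longlongrightarrow> 1) at_top" if "(f \<longlongrightarrow> 0) at_top" for f :: "real \<Rightarrow> real"
  proof -
    have "((\<lambda>x. complex_of_real (f x)) \<longlongrightarrow> of_real 0) at_top" using that by (intro tendsto_of_real)
    from filterlim_compose[OF \<open>(euler_phi \<longlongrightarrow> 1) (nhds 0)\<close>] this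
    have "((\<lambda>x. euler_phi (of_real (f x))) \<longlongrightarrow> 1) at_top" by simp
    from tendsto_Re[OF this] show ?thesis by (simp add: phi_re_def)
  qed
  define \<rho> where "\<rho> = (\<lambda>r. phi_re (nome r ^ 3) / phi_re (nome r))"
  have rho: "(\<rho> \<longlongrightarrow> 1) at_top"
    unfolding \<rho>_def using tendsto_divide[OF phi phi, of "\<lambda>r. nome r ^ 3" nome] tendsto_power[OF nome0, of 3] nome0 by simp
  define w where "w = (\<lambda>r. 27 * nome r * \<rho> r ^ 12)"
  have w0: "(w \<longlongrightarrow> 0) at_top"
    unfolding w_def using tendsto_mult[OF tendsto_mult[OF tendsto_const[of 27] nome0] tendsto_power[OF rho, of 12]] by simp
  have ev: "eventually (\<lambda>r. \<rho> r > 0 \<and> w r > 0 \<and> cubic_T r = w r / (1 + w r)) at_top"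
    using eventually_gt_at_top[of 0]
  proof eventually_elim
    case (elim r)
    define a b where "a = phi_re (nome r)" and "b = phi_re (nome r ^ 3)"
    have n3: "nome (3 * r) = nome r ^ 3" "nome_root (3 * r) = nome_root r ^ 3"
      using nome_mult[of 3 r] nome_root_mult[of 3 r] by simp_all
    have a: "a > 0" and b: "b > 0" using phi_re_nome(1)[of r] phi_re_nome(1)[of "3 * r"] elim by (auto simp: a_def b_def n3)
    have p: "nome_root r > 0" by (rule nome_bounds)
    have 1: "eta_re r ^ 12 = nome_root r ^ 12 * a ^ 12" by (simp add: eta_re_def a_def power_mult_distrib)
    have "nome_root r ^ 36 = nome_root r ^ 12 * nome r" by (simp flip: nome_root_power power_add)
    hence 2: "eta_re (3 * r) ^ 12 = nome_root r ^ 12 * nome r * b ^ 12"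
      by (simp add: eta_re_def b_def power_mult_distrib n3 flip: power_mult)
    have wr: "w r = 27 * nome r * b ^ 12 / a ^ 12" by (simp add: w_def \<rho>_def a_def b_def power_divide)
    have w: "w r > 0" unfolding wr using a b nome_bounds(1)[of r] by simp
    have wa: "27 * nome r * b ^ 12 = w r * a ^ 12" using a by (simp add: wr)
    have "cubic_T r = nome_root r ^ 12 * (27 * nome r * b ^ 12) / (nome_root r ^ 12 * a ^ 12 + nome_root r ^ 12 * (27 * nome r * b ^ 12))"
      unfolding cubic_T_def 1 2 by (simp add: mult_ac)
    also have "\<dots> = (nome_root r ^ 12 * a ^ 12) * w r / ((nome_root r ^ 12 * a ^ 12) * (1 + w r))"
      unfolding wa by (simp add: algebra_simps)
    also have "\<dots> = w r / (1 + w r)" using a p by simp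
    finally show ?case using a b w by (simp add: \<rho>_def a_def b_def)
  qed
  show "filterlim cubic_T (at_right 0) at_top"
    unfolding filterlim_at
  proof
    show "eventually (\<lambda>r. cubic_T r \<in> {0<..} \<and> cubic_T r \<noteq> 0) at_top"
      using eventually_gt_at_top[of 0] by eventually_elim (use cubic_T_bounds in force)
    have "((\<lambda>r. w r / (1 + w r)) \<longlongrightarrow> 0 / (1 + 0)) at_top" by (intro tendsto_intros w0) auto
    moreover have "eventually (\<lambda>r. w r / (1 + w r) = cubic_T r) at_top" using ev by eventually_elim auto
    ultimately show "(cubic_T \<longlongrightarrow> 0) at_top" by (auto elim: Lim_transform_eventually)
  qed
  define g where "g = (\<lambda>r. ln (1 + w r) - ln 27 - 12 * ln (\<rho> r))"
  have "(g \<longlongrightarrow> ln (1 + 0) - ln 27 - 12 * ln 1) at_top" unfolding g_def by (intro tendsto_intros w0 rho) auto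
  hence "((\<lambda>r. 2 * pi / sqrt 3 + g r / r) \<longlongrightarrow> 2 * pi / sqrt 3 + 0) at_top"
    by (intro tendsto_add tendsto_const tendsto_divide_0) (auto intro: filterlim_at_top_imp_at_infinity filterlim_ident)
  moreover have "eventually (\<lambda>r. 2 * pi / sqrt 3 + g r / r = - ln (cubic_T r) / r) at_top"
    using ev eventually_gt_at_top[of 0]
  proof eventually_elim
    case (elim r)
    have "ln (cubic_T r) = ln (w r) - ln (1 + w r)" using elim by (simp add: ln_div)
    also have "ln (w r) = ln 27 + ln (nome r) + 12 * ln (\<rho> r)"
      unfolding w_def using elim nome_bounds(1)[of r] by (simp add: ln_mult ln_realpow)
    also have "ln (nome r) = - 2 * pi * r / sqrt 3" by (simp add: nome_def)
    finally have "- ln (cubic_T r) = 2 * pi / sqrt 3 * r + g r" by (simp add: g_def)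
    thus ?case using elim by (simp add: add_divide_distrib)
  qed
  ultimately show "((\<lambda>r. - ln (cubic_T r) / r) \<longlongrightarrow> 2 * pi / sqrt 3) at_top"
    by (auto elim: Lim_transform_eventually)
qed

lemma cubic_M_T:
  assumes r: "r > 0"
  shows "cubic_M (cubic_T r) = r"
proof -
  have pow: "cubic_M (cubic_T (3 ^ n * r)) = 3 ^ n * cubic_M (cubic_T r)" for n
  proof (induction n)
    case (Suc n)
    thus ?case using cubic_M_T_triple[of "3 ^ n * r"] r by (simp add: mult.assoc)
  qed simp
  have top: "filterlim (\<lambda>n. 3 ^ n * r) at_top sequentially" using r by real_asymp
  have 1: "(\<lambda>n. - ln (cubic_T (3 ^ n * r)) / (3 ^ n * r)) \<longlonglongrightarrow> 2 * pi / sqrt 3"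
    by (rule filterlim_compose[OF cubic_T_asymptotics(1) top])
  have 2: "(\<lambda>n. cubic_M (cubic_T (3 ^ n * r)) / (- ln (cubic_T (3 ^ n * r)))) \<longlonglongrightarrow> sqrt 3 / (2 * pi)"
    by (rule filterlim_compose[OF cubic_M_asymptotics filterlim_compose[OF cubic_T_asymptotics(2) top]])
  \<comment> \<open>The two asymptotic constants are reciprocal. The logarithms and the powers of 3
    cancel, so this convergent sequence is in fact constant, equal to M(T(r)).\<close>
  have "(\<lambda>n. cubic_M (cubic_T (3 ^ n * r)) / (- ln (cubic_T (3 ^ n * r))) * (- ln (cubic_T (3 ^ n * r)) / (3 ^ n * r)) * r)
      \<longlonglongrightarrow> sqrt 3 / (2 * pi) * (2 * pi / sqrt 3) * r"
    by (intro tendsto_mult 1 2 tendsto_const)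
  moreover have "cubic_M (cubic_T (3 ^ n * r)) / (- ln (cubic_T (3 ^ n * r))) * (- ln (cubic_T (3 ^ n * r)) / (3 ^ n * r)) * r
      = cubic_M (cubic_T r)" for n
  proof -
    have "ln (cubic_T (3 ^ n * r)) < 0" using cubic_T_bounds[of "3 ^ n * r"] r by simp
    thus ?thesis using r by (simp add: pow)
  qed
  ultimately show ?thesis by (simp add: LIMSEQ_const_iff)
qed

section \<open>Real analyticity\<close>

lemma real_analytic_on_holomorphic:
  assumes "open S" "g holomorphic_on S" "open A" "of_real ` A \<subseteq> S"
    and f: "\<And>y. y \<in> A \<Longrightarrow> f y = Re (g (of_real y))"
  shows "real_analytic_on f A"
  unfolding real_analytic_on_def
proof
  fix x assume x: "x \<in> A"
  obtain e1 where e1: "e1 > 0" "ball x e1 \<subseteq> A" using \<open>open A\<close> x openE by blast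
  have "of_real x \<in> S" using x assms(4) by auto
  then obtain e2 where e2: "e2 > 0" "ball (of_real x) e2 \<subseteq> S" using \<open>open S\<close> openE by blast
  define a where "a = (\<lambda>n. Re ((deriv ^^ n) g (of_real x) / fact n))"
  have "(\<lambda>n. a n * (y - x) ^ n) sums f y" if y: "\<bar>y - x\<bar> < min e1 e2" for y
  proof -
    have yA: "y \<in> A" using y e1 by (auto simp: subset_iff dist_real_def)
    have "complex_of_real y \<in> ball (of_real x) e2"
      using y by (simp add: dist_norm abs_minus_commute flip: of_real_diff)
    from holomorphic_power_series[OF holomorphic_on_subset[OF assms(2) e2(2)] this]
    have "(\<lambda>n. Re ((deriv ^^ n) g (of_real x) / fact n * (of_real y - of_real x) ^ n)) sums Re (g (of_real y))"
      by (rule sums_Re)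
    moreover have "Re (c * (complex_of_real y - of_real x) ^ n) = Re c * (y - x) ^ n" for c n
      by (simp flip: of_real_diff of_real_power)
    ultimately show ?thesis by (simp only: a_def f[OF yA])
  qed
  thus "\<exists>e>0. \<exists>a. \<forall>y. \<bar>y - x\<bar> < e \<longrightarrow> (\<lambda>n. a n * (y - x) ^ n) sums f y"
    using e1 e2 by (intro exI[of _ "min e1 e2"] conjI exI[of _ a]) auto
qed

text \<open>The eta quotient extends holomorphically to Re z > 0, where Im tau > 0. Its denominator
  is positive on the real axis, so the extension is taken on the open set \<open>S\<close> where the
  denominator does not vanish. The constants \<open>a\<close> and \<open>b\<close> let one statement
  serve both u and v.\<close>

lemma cubic_T_analytic:
  assumes f: "\<And>r. r > 0 \<Longrightarrow> f r = a + b * cubic_T r"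
  shows "real_analytic_on f {0<..}"
proof -
  define E where "E = (\<lambda>z::complex. dedekind_eta (\<i> * z / of_real (sqrt 3)))"
  have E_real: "E (of_real r) = of_real (eta_re r)" if "r > 0" for r
    using dedekind_eta_imaginary[OF that] by (simp add: E_def)
  have hol: "E holomorphic_on {z. Re z > 0}"
    unfolding E_def dedekind_eta_eq_euler_phi
    by (intro holomorphic_intros holomorphic_on_compose_gen[OF _ euler_phi_holomorphic, unfolded o_def]) auto
  have hol3: "(\<lambda>z. E (3 * z)) holomorphic_on {z. Re z > 0}"
    by (rule holomorphic_on_compose_gen[OF _ hol, of "\<lambda>z. 3 * z", unfolded o_def]) (auto intro!: holomorphic_intros)
  define D where "D = (\<lambda>z. E z ^ 12 + 27 * E (3 * z) ^ 12)"
  define S where "S = {z. Re z > 0} \<inter> D -` (- {0})"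
  have holD: "D holomorphic_on {z. Re z > 0}" unfolding D_def by (intro holomorphic_intros hol hol3)
  have "open S" unfolding S_def
    by (intro continuous_open_preimage holomorphic_on_imp_continuous_on holD open_halfspace_Re_gt) auto
  show ?thesis
  proof (rule real_analytic_on_holomorphic[OF \<open>open S\<close>])
    show "(\<lambda>z. of_real a + of_real b * (27 * E (3 * z) ^ 12 / D z)) holomorphic_on S"
      by (intro holomorphic_intros holomorphic_on_subset[OF hol3] holomorphic_on_subset[OF holD]) (auto simp: S_def)
    have Dr: "D (of_real r) = of_real (eta_re r ^ 12 + 27 * eta_re (3 * r) ^ 12)" if "r > 0" for r
      using E_real[OF that] E_real[of "3 * r"] that by (simp add: D_def)
    have "eta_re r ^ 12 + 27 * eta_re (3 * r) ^ 12 > 0" if "r > 0" for r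
      using eta_re_pos[of r] eta_re_pos[of "3 * r"] that by (simp add: add_pos_pos)
    thus "of_real ` {0<..} \<subseteq> S" using Dr by (auto simp: S_def simp del: of_real_add of_real_power) (metis less_irrefl)
    fix r :: real assume "r \<in> {0<..}"
    hence r: "r > 0" by simp
    have "of_real a + of_real b * (27 * E (3 * of_real r) ^ 12 / D (of_real r)) = complex_of_real (a + b * cubic_T r)"
      unfolding Dr[OF r] using E_real[of "3 * r"] r by (simp add: cubic_T_def)
    thus "f r = Re (of_real a + of_real b * (27 * E (3 * of_real r) ^ 12 / D (of_real r)))"
      using f[OF r] by simp
  qed auto
qed

section \<open>Charts by the closed half-plane\<close>

lemma biholomorphic_onI:
  assumes "open S" "f holomorphic_on S" "bij_betw f S T"
  shows "biholomorphic_on f S T"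
proof -
  have inj: "inj_on f S" and im: "f ` S = T" using assms(3) by (auto simp: bij_betw_def)
  obtain g where g: "g holomorphic_on (f ` S)" "\<And>z. z \<in> S \<Longrightarrow> g (f z) = z"
    using holomorphic_has_inverse[OF assms(2,1) inj] by metis
  have "inv_into S f holomorphic_on T"
    using g(1) unfolding im
    by (rule holomorphic_transform) (use g(2) im inj in auto)
  thus ?thesis using assms by (auto simp: biholomorphic_on_def)
qed

lemma biholomorphic_on_compose:
  assumes "biholomorphic_on f S T" "biholomorphic_on g T U" "open S"
  shows "biholomorphic_on (\<lambda>z. g (f z)) S U"
proof (rule biholomorphic_onI[OF \<open>open S\<close>])
  have "bij_betw f S T" "bij_betw g T U" using assms by (auto simp: biholomorphic_on_def)
  thus "bij_betw (\<lambda>z. g (f z)) S U" using bij_betw_trans[of f S T g U] by (simp add: o_def)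
  show "(\<lambda>z. g (f z)) holomorphic_on S"
    using assms by (intro holomorphic_on_compose_gen[of f S g T, unfolded o_def])
      (auto simp: biholomorphic_on_def bij_betw_def)
qed

lemma biholomorphic_on_inverse:
  assumes "biholomorphic_on f S T" "open T"
  shows "biholomorphic_on (inv_into S f) T S"
  using assms by (intro biholomorphic_onI) (auto simp: biholomorphic_on_def bij_betw_inv_into)

lemma biholomorphic_on_cong:
  assumes "biholomorphic_on f S T" "open S" "\<And>z. z \<in> S \<Longrightarrow> f z = g z"
  shows "biholomorphic_on g S T"
proof (rule biholomorphic_onI[OF \<open>open S\<close>])
  show "g holomorphic_on S"
    using assms by (auto simp: biholomorphic_on_def intro: holomorphic_transform)
  show "bij_betw g S T"
    using assms bij_betw_cong[of S f g T] by (auto simp: biholomorphic_on_def)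
qed

section \<open>Topology of the closed half-plane inside the sphere\<close>

abbreviation closed_upper :: "complex set" where "closed_upper \<equiv> {z. Im z \<ge> 0}"

lemma closed_closed_upper: "closed closed_upper" and open_upper: "open upper_half_plane"
  and convex_upper: "convex upper_half_plane"
  by (simp_all add: closed_halfspace_Im_ge open_halfspace_Im_gt convex_halfspace_Im_gt)

lemma topspace_closed_half_plane: "topspace closed_half_plane = insert None (Some ` closed_upper)"
  by (auto simp: closed_half_plane_def)

lemma compact_space_closed_half_plane: "compact_space closed_half_plane"
proof -
  have "closedin riemann_sphere (insert None (Some ` closed_upper))"
  proof -
    have "openin riemann_sphere (Some ` (- closed_upper))"
      using closed_closed_upper by (simp add: open_Compl del: Compl_eq)
    moreover have "topspace riemann_sphere - insert None (Some ` closed_upper) = Some ` (- closed_upper)"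
      by auto
    ultimately show ?thesis by (auto simp: closedin_def)
  qed
  hence "compactin riemann_sphere (insert None (Some ` closed_upper))"
    by (rule closedin_compact_space[OF compact_space_Alexandroff_compactification])
  thus ?thesis
    unfolding closed_half_plane_def by (rule compact_space_subtopology)
qed

lemma open_finite_part_riemann_sphere:
  assumes "openin riemann_sphere T"
  shows "open {z. Some z \<in> T}"
  using assms unfolding openin_Alexandroff_compactification
proof (elim disjE exE conjE)
  fix U assume "openin euclidean U" "T = Some ` U"
  moreover from this have "{z. Some z \<in> T} = U" by auto
  ultimately show ?thesis by simp
next
  fix K :: "complex set" assume "closedin euclidean K" "T = insert None (Some ` (topspace euclidean - K))"
  moreover from this have "{z. Some z \<in> T} = - K" by auto
  ultimately show ?thesis by (simp add: open_Compl)
qed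

lemma nhd_infinity_riemann_sphere:
  assumes "openin riemann_sphere T" "None \<in> T"
  obtains B where "\<And>z. norm z > B \<Longrightarrow> Some z \<in> T"
  using assms unfolding openin_Alexandroff_compactification
proof (elim disjE exE conjE)
  fix K :: "complex set" assume K: "compactin euclidean K" "T = insert None (Some ` (topspace euclidean - K))"
  obtain B where "\<And>z. z \<in> K \<Longrightarrow> norm z \<le> B"
    using compact_imp_bounded[of K] K(1) by (auto simp: bounded_iff)
  with K(2) show thesis by (intro that[of B]) force
qed auto

lemma continuous_map_closed_half_plane:
  fixes F :: "complex \<Rightarrow> complex"
  assumes cont: "continuous_on closed_upper F"
    and lim: "\<And>e. e > 0 \<Longrightarrow> \<exists>B. \<forall>z. Im z \<ge> 0 \<and> norm z > B \<longrightarrow> dist (F z) L < e"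
  shows "continuous_map closed_half_plane euclidean (case_option L F)"
  unfolding continuous_map_def
proof (intro conjI allI impI)
  show "case_option L F \<in> topspace closed_half_plane \<rightarrow> topspace euclidean" by simp
  fix U :: "complex set" assume "openin euclidean U"
  hence U: "open U" by simp
  obtain W where W: "open W" "F -` U \<inter> closed_upper = W \<inter> closed_upper"
    using continuous_on_open_invariant[of closed_upper F] cont U by (metis Int_commute)
  have WU: "z \<in> W \<longleftrightarrow> F z \<in> U" if "Im z \<ge> 0" for z using W(2) that by auto
  show "openin closed_half_plane {x \<in> topspace closed_half_plane. case_option L F x \<in> U}"
  proof (cases "L \<in> U")
    case False
    hence "{x \<in> topspace closed_half_plane. case_option L F x \<in> U} = Some ` W \<inter> insert None (Some ` closed_upper)"
      using WU by (auto simp: topspace_closed_half_plane)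
    thus ?thesis unfolding closed_half_plane_def openin_subtopology using W(1)
      by (metis openin_Alexandroff_compactification_image_Some open_openin)
  next
    case True
    then obtain e where e: "e > 0" "ball L e \<subseteq> U" using U openE by blast
    obtain B where B: "\<And>z. Im z \<ge> 0 \<Longrightarrow> norm z > B \<Longrightarrow> dist (F z) L < e" using lim[OF e(1)] by blast
    have BU: "F z \<in> U" if "Im z \<ge> 0" "norm z > B" for z
      using B[OF that] e(2) by (auto simp: dist_commute)
    \<comment> \<open>A point of the closed half-plane outside \<open>K\<close> lies in
      \<open>W\<close> or has norm above \<open>B\<close>; in either case \<open>F\<close> maps it
      into \<open>U\<close>. So the complement of \<open>K\<close> is the required neighbourhood of
      infinity.\<close>
    define K where "K = cball 0 B - W"
    have K: "compact K" unfolding K_def using W(1) by (intro compact_diff) auto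
    define T where "T = insert None (Some ` (topspace euclidean - K))"
    have "openin riemann_sphere T"
      unfolding openin_Alexandroff_compactification T_def using K compact_imp_closed by auto
    moreover have "{x \<in> topspace closed_half_plane. case_option L F x \<in> U} = T \<inter> insert None (Some ` closed_upper)"
      using WU True BU by (auto simp: topspace_closed_half_plane T_def K_def not_le)
    ultimately show ?thesis unfolding closed_half_plane_def openin_subtopology by blast
  qed
qed

section \<open>Half-plane charts: uniqueness and a criterion for existence\<close>

definition half_plane_chart :: "(complex option \<Rightarrow> complex) \<Rightarrow> complex set \<Rightarrow> bool" where
  "half_plane_chart f P \<longleftrightarrow> homeomorphic_map closed_half_plane (top_of_set P) f \<and>
     biholomorphic_on (\<lambda>z. f (Some z)) upper_half_plane (interior P)"

text \<open>Properness makes \<open>K\<close> a polynomial and injectivity makes its derivative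
  zero-free. By the fundamental theorem of algebra the derivative is then constant, and an affine
  map fixing 0 and 1 is the identity.\<close>

lemma entire_injective_proper_eq_id:
  assumes hol: "K holomorphic_on UNIV" and inj: "inj K"
    and proper: "\<And>R. \<exists>B. \<forall>z. norm z > B \<longrightarrow> norm (K z) > R"
    and "K 0 = 0" "K 1 = 1"
  shows "K z = z"
proof -
  have cont: "continuous_on UNIV K" using hol by (rule holomorphic_on_imp_continuous_on)
  have "compact {z. K z \<in> S}" if S: "compact S" for S
  proof -
    obtain R where R: "\<And>w. w \<in> S \<Longrightarrow> norm w \<le> R" using compact_imp_bounded[OF S] by (auto simp: bounded_iff)
    obtain B where B: "\<And>z. norm z > B \<Longrightarrow> norm (K z) > R" using proper by blast
    have "norm z \<le> B" if "K z \<in> S" for z using B[of z] R[OF that] by force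
    hence "bounded {z. K z \<in> S}" by (auto simp: bounded_iff)
    moreover have "closed {z. K z \<in> S}"
      using continuous_closed_vimage[of S K] cont S compact_imp_closed
      by (auto simp: continuous_on_eq_continuous_at vimage_def)
    ultimately show ?thesis by (simp add: compact_eq_bounded_closed)
  qed
  then obtain c n where Kc: "K = (\<lambda>z. \<Sum>i\<le>n. c i * z^i)"
    using proper_map_polyfun_eq[OF hol] by blast
  define p where "p = (\<Sum>i\<le>n. monom (c i) i)"
  have Kp: "K z = poly p z" for z by (simp add: Kc p_def poly_sum poly_monom)
  have dK: "(K has_field_derivative poly (pderiv p) z) (at z)" for z
    using poly_DERIV[of p z] by (simp add: Kp[abs_def])
  have nz: "poly (pderiv p) z \<noteq> 0" for z
    using holomorphic_injective_imp_regular[OF hol open_UNIV inj, of z] DERIV_imp_deriv[OF dK, of z] by simp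
  have "constant (poly (pderiv p))"
    using Fundamental_Theorem_Algebra.fundamental_theorem_of_algebra[of "pderiv p"] nz by auto
  hence d: "poly (pderiv p) z = poly (pderiv p) 0" for z unfolding constant_def by blast
  define d where "d = poly (pderiv p) 0"
  have "((\<lambda>z. K z - d * z) has_field_derivative 0) (at z within UNIV)" for z
    using DERIV_diff[OF dK[of z] DERIV_cmult_Id[of d]] d[of z] by (simp add: d_def)
  then obtain k where k: "\<And>z. K z - d * z = k"
    using has_field_derivative_zero_constant[OF convex_UNIV, of "\<lambda>z. K z - d * z"] by blast
  have "k = 0" using k[of 0] \<open>K 0 = 0\<close> by simp
  moreover have "d = 1" using k[of 1] \<open>K 1 = 1\<close> \<open>k = 0\<close> by simp
  ultimately show ?thesis using k[of z] by simp
qed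

text \<open>Everything is done for the transition map \<open>g2 \<circ> f1\<close> of the closed
  half-plane, where the shape of \<open>P\<close> has disappeared. The three common values say that
  it fixes 0, 1 and infinity.\<close>

lemma half_plane_chart_unique:
  assumes f1: "half_plane_chart f1 P" and f2: "half_plane_chart f2 P"
    and eq: "f1 None = f2 None" "f1 (Some 0) = f2 (Some 0)" "f1 (Some 1) = f2 (Some 1)"
    and x: "x \<in> topspace closed_half_plane"
  shows "f1 x = f2 x"
proof -
  let ?X = closed_half_plane
  obtain g2 where g2: "homeomorphic_maps ?X (top_of_set P) f2 g2"
    using f2 unfolding half_plane_chart_def homeomorphic_map_maps by blast
  have g2f2: "g2 (f2 x) = x" if "x \<in> topspace ?X" for x using g2 that by (auto simp: homeomorphic_maps_def)
  have f2g2: "f2 (g2 y) = y" if "y \<in> P" for y using g2 that by (auto simp: homeomorphic_maps_def)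
  have h1: "homeomorphic_map ?X (top_of_set P) f1" using f1 by (simp add: half_plane_chart_def)
  define \<psi> where "\<psi> = g2 \<circ> f1"
  have "homeomorphic_map (top_of_set P) ?X g2" using g2 by (simp add: homeomorphic_maps_map)
  hence psi: "homeomorphic_map ?X ?X \<psi>" unfolding \<psi>_def using h1 by (rule homeomorphic_map_compose[rotated])
  have f1P: "f1 x \<in> P" if "x \<in> topspace ?X" for x
    using homeomorphic_imp_surjective_map[OF h1] that by auto
  have f2psi: "f2 (\<psi> x) = f1 x" if "x \<in> topspace ?X" for x
    using f2g2 f1P[OF that] by (simp add: \<psi>_def)
  have psi_inj: "inj_on \<psi> (topspace ?X)" using psi by (rule homeomorphic_imp_injective_map)
  have psi_top: "\<psi> x \<in> topspace ?X" if "x \<in> topspace ?X" for x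
    using homeomorphic_imp_surjective_map[OF psi] that by auto
  have psi_cont: "continuous_map ?X ?X \<psi>" using psi by (rule homeomorphic_imp_continuous_map)
  have top: "None \<in> topspace ?X" "\<And>z. Some z \<in> topspace ?X \<longleftrightarrow> Im z \<ge> 0"
    by (auto simp: topspace_closed_half_plane)
  have psi_fix: "\<psi> None = None" "\<psi> (Some 0) = Some 0" "\<psi> (Some 1) = Some 1"
    using eq g2f2 top by (auto simp: \<psi>_def)
  define k where "k = (\<lambda>z. the (\<psi> (Some z)))"
  have k: "\<psi> (Some z) = Some (k z)" "Im (k z) \<ge> 0" if "Im z \<ge> 0" for z
  proof -
    have "\<psi> (Some z) \<noteq> \<psi> None" using inj_onD[OF psi_inj, of "Some z" None] top that by auto
    thus *: "\<psi> (Some z) = Some (k z)" using psi_fix(1) by (auto simp: k_def)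
    show "Im (k z) \<ge> 0" using psi_top[of "Some z"] that unfolding * top by simp
  qed
  have k_inj: "k z = k w \<Longrightarrow> z = w" if "Im z \<ge> 0" "Im w \<ge> 0" for z w
    using inj_onD[OF psi_inj, of "Some z" "Some w"] k(1)[OF that(1)] k(1)[OF that(2)] that top by simp
  have k_cont: "continuous_on closed_upper k"
    unfolding continuous_on_open_invariant
  proof (intro allI impI)
    fix U :: "complex set" assume U: "open U"
    have "openin ?X (Some ` U \<inter> insert None (Some ` closed_upper))"
      unfolding closed_half_plane_def openin_subtopology using U
      by (metis openin_Alexandroff_compactification_image_Some open_openin)
    hence "openin ?X {x \<in> topspace ?X. \<psi> x \<in> Some ` U \<inter> insert None (Some ` closed_upper)}"
      by (rule openin_continuous_map_preimage[OF psi_cont])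
    then obtain T where T: "openin riemann_sphere T"
      "{x \<in> topspace ?X. \<psi> x \<in> Some ` U \<inter> insert None (Some ` closed_upper)} = T \<inter> insert None (Some ` closed_upper)"
      unfolding closed_half_plane_def openin_subtopology by auto
    have "z \<in> {z. Some z \<in> T} \<longleftrightarrow> k z \<in> U" if "Im z \<ge> 0" for z
    proof -
      have "Some z \<in> T \<longleftrightarrow> Some z \<in> T \<inter> insert None (Some ` closed_upper)" using that by auto
      also have "\<dots> \<longleftrightarrow> \<psi> (Some z) \<in> Some ` U \<inter> insert None (Some ` closed_upper)"
        unfolding T(2)[symmetric] using that top by auto
      also have "\<dots> \<longleftrightarrow> k z \<in> U" using k[OF that] by auto
      finally show ?thesis by simp
    qed
    thus "\<exists>A. open A \<and> A \<inter> closed_upper = k -` U \<inter> closed_upper"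
      using open_finite_part_riemann_sphere[OF T(1)] by (intro exI[of _ "{z. Some z \<in> T}"]) auto
  qed
  \<comment> \<open>Continuity at the fixed point infinity, translated into growth: this is the
    source of properness.\<close>
  have k_inf: "\<exists>B. \<forall>z. Im z \<ge> 0 \<and> norm z > B \<longrightarrow> norm (k z) > R" for R
  proof -
    define V where "V = insert None (Some ` (topspace euclidean - cball (0::complex) R))"
    have "openin riemann_sphere V"
      unfolding openin_Alexandroff_compactification V_def
      by (intro disjI2 exI[of _ "cball 0 R"]) auto
    hence "openin ?X (V \<inter> insert None (Some ` closed_upper))"
      unfolding closed_half_plane_def openin_subtopology by blast
    hence "openin ?X {x \<in> topspace ?X. \<psi> x \<in> V \<inter> insert None (Some ` closed_upper)}"
      by (rule openin_continuous_map_preimage[OF psi_cont])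
    then obtain T where T: "openin riemann_sphere T"
      "{x \<in> topspace ?X. \<psi> x \<in> V \<inter> insert None (Some ` closed_upper)} = T \<inter> insert None (Some ` closed_upper)"
      unfolding closed_half_plane_def openin_subtopology by auto
    have "None \<in> {x \<in> topspace ?X. \<psi> x \<in> V \<inter> insert None (Some ` closed_upper)}"
      using psi_fix(1) top by (simp add: V_def)
    hence "None \<in> T" using T(2) by blast
    then obtain B where B: "\<And>z. norm z > B \<Longrightarrow> Some z \<in> T"
      using nhd_infinity_riemann_sphere[OF T(1)] by blast
    have "norm (k z) > R" if "Im z \<ge> 0" "norm z > B" for z
    proof -
      have "Some z \<in> T \<inter> insert None (Some ` closed_upper)" using B that by auto
      hence "\<psi> (Some z) \<in> V" using T(2) by blast
      thus ?thesis using k(1)[OF that(1)] by (auto simp: V_def)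
    qed
    thus ?thesis by blast
  qed
  let ?F1 = "\<lambda>z. f1 (Some z)" and ?F2 = "\<lambda>z. f2 (Some z)"
  have b1: "biholomorphic_on ?F1 upper_half_plane (interior P)" and b2: "biholomorphic_on ?F2 upper_half_plane (interior P)"
    using f1 f2 by (auto simp: half_plane_chart_def)
  have im1: "?F1 ` upper_half_plane = interior P" and im2: "?F2 ` upper_half_plane = interior P"
    using b1 b2 by (auto simp: biholomorphic_on_def bij_betw_def)
  have k_eq: "k z = inv_into upper_half_plane ?F2 (?F1 z)" "Im (k z) > 0" if "Im z > 0" for z
  proof -
    have "?F1 z \<in> ?F2 ` upper_half_plane" using im1 im2 that by auto
    then obtain w where w: "Im w > 0" "?F2 w = ?F1 z" by auto
    have "\<psi> (Some z) = Some w" using g2f2[of "Some w"] w top by (simp add: \<psi>_def)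
    hence kw: "k z = w" by (simp add: k_def)
    have "inj_on ?F2 upper_half_plane" using b2 by (auto simp: biholomorphic_on_def bij_betw_def)
    from inv_into_f_f[OF this, of w] w kw show "k z = inv_into upper_half_plane ?F2 (?F1 z)" by simp
    show "Im (k z) > 0" using w kw by simp
  qed
  \<comment> \<open>Were \<open>k z\<close> in the open half-plane, the common value would lie in
    the interior of \<open>P\<close> and be attained by \<open>f1\<close> at a point of the open
    half-plane too, against injectivity of \<open>f1\<close>. This is the boundary condition for
    Schwarz reflection.\<close>
  have k_real: "Im (k z) = 0" if "Im z = 0" for z
  proof (rule ccontr)
    assume "Im (k z) \<noteq> 0"
    hence "Im (k z) > 0" using k(2)[of z] that by simp
    hence "?F2 (k z) \<in> interior P" using im2 by auto
    moreover have "?F2 (k z) = ?F1 z" using f2psi[of "Some z"] k(1)[of z] that top by simp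
    ultimately obtain w where w: "Im w > 0" "?F1 w = ?F1 z" using im1 by (metis (mono_tags, lifting) imageE mem_Collect_eq)
    have "inj_on f1 (topspace ?X)" using h1 by (rule homeomorphic_imp_injective_map)
    from inj_onD[OF this, of "Some w" "Some z"] have "w = z" using w that top by simp
    thus False using w that by simp
  qed
  have k_hol: "k holomorphic_on upper_half_plane"
  proof -
    have "(\<lambda>z. inv_into upper_half_plane ?F2 (?F1 z)) holomorphic_on upper_half_plane"
      using b1 b2 im1 by (intro holomorphic_on_compose_gen[of ?F1 _ "inv_into upper_half_plane ?F2" "interior P", unfolded o_def])
        (auto simp: biholomorphic_on_def)
    thus ?thesis by (rule holomorphic_transform) (use k_eq in auto)
  qed
  define K where "K = (\<lambda>z. if 0 \<le> Im z then k z else cnj (k (cnj z)))"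
  have K_hol: "K holomorphic_on UNIV"
    unfolding K_def
  proof (rule Schwarz_reflection)
    show "k z \<in> \<real>" if "z \<in> \<real>" for z
      using k_real[of z] that by (simp add: complex_is_Real_iff)
  qed (use k_hol k_cont in auto)
  have K_im: "Im (K z) \<ge> 0 \<longleftrightarrow> Im z \<ge> 0" for z
    using k(2)[of z] k_eq(2)[of "cnj z"] by (auto simp: K_def)
  have "inj K"
  proof (rule injI)
    fix z w assume eq: "K z = K w"
    hence "Im z \<ge> 0 \<longleftrightarrow> Im w \<ge> 0" using K_im by metis
    thus "z = w" using eq k_inj[of z w] k_inj[of "cnj z" "cnj w"] by (cases "Im z \<ge> 0") (auto simp: K_def)
  qed
  moreover have "\<exists>B. \<forall>z. norm z > B \<longrightarrow> norm (K z) > R" for R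
  proof -
    obtain B where "\<forall>z. Im z \<ge> 0 \<and> norm z > B \<longrightarrow> norm (k z) > R" using k_inf by blast
    hence "\<forall>z. norm z > B \<longrightarrow> norm (K z) > R" by (auto simp: K_def)
    thus ?thesis by blast
  qed
  moreover have "K 0 = 0" "K 1 = 1" using psi_fix by (auto simp: K_def k_def)
  ultimately have Kid: "K z = z" for z using entire_injective_proper_eq_id[OF K_hol] by blast
  show ?thesis
  proof (cases x)
    case None thus ?thesis using eq by simp
  next
    case (Some z)
    hence z: "Im z \<ge> 0" using x top by simp
    hence "k z = z" using Kid[of z] by (simp add: K_def)
    hence "\<psi> x = x" using k(1)[OF z] Some by simp
    thus ?thesis using f2psi[OF x] by simp
  qed
qed

text \<open>\<open>nz\<close> keeps two preimages of a value from merging in the open half-plane,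
  and \<open>loc\<close> keeps them from merging at \<open>x0\<close>. The inverse is continuous for
  a general reason: a continuous bijection from a compact space onto a Hausdorff space is a
  homeomorphism.\<close>

lemma half_plane_chartI:
  fixes F :: "complex \<Rightarrow> complex"
  assumes cont: "continuous_on closed_upper F"
    and hol: "F holomorphic_on upper_half_plane"
    and nz: "\<And>z. Im z > 0 \<Longrightarrow> deriv F z \<noteq> 0"
    and lim: "\<And>e. e > 0 \<Longrightarrow> \<exists>B. \<forall>z. Im z \<ge> 0 \<and> norm z > B \<longrightarrow> dist (F z) L < e"
    and P: "compact P" "convex P" "interior P \<noteq> {}"
    and bdry: "bij_betw F {z. Im z = 0} (frontier P - {L})" "L \<in> frontier P"
    and loc: "Im x0 = 0" "e0 > 0" "inj_on F (ball x0 e0 \<inter> closed_upper)"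
  shows "half_plane_chart (case_option L F) P"
proof -
  let ?H = upper_half_plane
  define f where "f = case_option L F"
  have cmap: "continuous_map closed_half_plane euclidean f"
    unfolding f_def by (rule continuous_map_closed_half_plane[OF cont lim])
  have real_im: "F ` {z. Im z = 0} = frontier P - {L}" and real_inj: "inj_on F {z. Im z = 0}"
    using bdry by (auto simp: bij_betw_def)
  have fin: "F z \<in> frontier P" "F z \<noteq> L" if "Im z = 0" for z using real_im that by auto
  have closedP: "closed P" using P(1) by (rule compact_imp_closed)
  have frP: "frontier P \<subseteq> P" using closedP by (simp add: frontier_subset_closed)
  have Pdecomp: "P = interior P \<union> frontier P" "interior P \<inter> frontier P = {}"
    using closedP interior_subset[of P] by (auto simp: frontier_def)
  define K where "K = f ` topspace closed_half_plane"
  have Keq: "K = F ` ?H \<union> frontier P"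
  proof -
    have "closed_upper = ?H \<union> {z. Im z = 0}" by auto
    hence "K = insert L (F ` ?H \<union> F ` {z. Im z = 0})"
      by (simp add: K_def f_def topspace_closed_half_plane image_Un image_image)
    thus ?thesis unfolding real_im using bdry(2) by auto
  qed
  have "compactin euclidean K" unfolding K_def
    by (rule image_compactin[OF _ cmap]) (use compact_space_closed_half_plane in \<open>simp add: compact_space_def\<close>)
  hence compK: "compact K" by simp
  hence closedK: "closed K" by (rule compact_imp_closed)
  have nc: "\<not> F constant_on X" if X: "open X" "X \<subseteq> ?H" "X \<noteq> {}" for X
  proof
    assume "F constant_on X"
    then obtain c where c: "\<And>z. z \<in> X \<Longrightarrow> F z = c" by (auto simp: constant_on_def)
    obtain z where z: "z \<in> X" using X by auto
    have "deriv F z = deriv (\<lambda>_. c) z"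
      by (rule deriv_cong_ev) (use c z X(1) in \<open>auto simp: eventually_nhds\<close>)
    thus False using nz[of z] z X by auto
  qed
  have openF: "open (F ` X)" if "open X" "X \<subseteq> ?H" for X
    by (rule open_mapping_thm2[OF hol open_upper that nc])
  \<comment> \<open>Outside \<open>P\<close> the image of the open half-plane coincides with the
    compact set \<open>K\<close>, as the rest of \<open>K\<close> is the frontier. So it is open and
    closed in the connected set \<open>- P\<close>; if nonempty it would be all of it, which is
    unbounded.\<close>
  have sub: "F ` ?H \<subseteq> P"
  proof (rule ccontr)
    assume ne: "\<not> F ` ?H \<subseteq> P"
    have conn: "connected (- P)"
      by (rule connected_complement_bounded_convex)
        (use P in \<open>auto simp: compact_imp_bounded\<close>)
    have eq: "F ` ?H \<inter> - P = K \<inter> - P" using Keq frP by auto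
    have "openin (top_of_set (- P)) (F ` ?H \<inter> - P)"
      using openF[OF open_upper] by (metis inf_commute openin_open_Int order_refl)
    moreover have "closedin (top_of_set (- P)) (F ` ?H \<inter> - P)"
      unfolding eq using closedK by (metis inf_commute closedin_closed_Int)
    ultimately have "F ` ?H \<inter> - P = {} \<or> F ` ?H \<inter> - P = - P"
      using conn unfolding connected_clopen by blast
    hence "- P \<subseteq> K" using ne Keq by auto
    hence "bounded (- P)" using compK compact_imp_bounded bounded_subset by blast
    hence "bounded (P \<union> - P)" using compact_imp_bounded[OF P(1)] by (simp only: bounded_Un simp_thms)
    thus False using not_bounded_UNIV[where 'a = complex] by (simp add: Compl_partition)
  qed
  have sub_int: "F ` ?H \<subseteq> interior P"
    using sub openF[OF open_upper] by (intro interior_maximal) auto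
  have conn_int: "connected (interior P)" using P(2) by (intro convex_connected convex_interior)
  have im: "F ` ?H = interior P"
  proof -
    have eq: "F ` ?H = interior P \<inter> K" using Keq sub_int Pdecomp by auto
    have "openin (top_of_set (interior P)) (F ` ?H)"
      using openF[OF open_upper] sub_int by (auto intro: openin_subset_trans simp: openin_open_eq open_interior)
    moreover have "closedin (top_of_set (interior P)) (F ` ?H)"
      unfolding eq using closedK by (rule closedin_closed_Int)
    moreover have "F ` ?H \<noteq> {}" by (auto intro: exI[of _ "\<i>"])
    ultimately show ?thesis using conn_int unfolding connected_clopen by blast
  qed
  have imI: "F z \<in> interior P" if "Im z > 0" for z using im that by blast
  \<comment> \<open>Far out, \<open>F\<close> is close to \<open>L\<close>, so preimages of values
    converging to \<open>w \<noteq> L\<close> eventually stay in a compact half-disc.\<close>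
  have subseq: "\<exists>z r. strict_mono (r :: nat \<Rightarrow> nat) \<and> Im z \<ge> 0 \<and> (Z \<circ> r) \<longlonglongrightarrow> z \<and> F z = w"
    if Z: "\<And>n. Im (Z n) \<ge> 0" "(\<lambda>n. F (Z n)) \<longlonglongrightarrow> w" "w \<noteq> L" for Z w
  proof -
    define e where "e = dist w L / 2"
    have e: "e > 0" using Z(3) by (simp add: e_def)
    obtain B where B: "\<And>z. Im z \<ge> 0 \<Longrightarrow> norm z > B \<Longrightarrow> dist (F z) L < e" using lim[OF e] by blast
    obtain N where N: "\<And>n. n \<ge> N \<Longrightarrow> dist (F (Z n)) w < e"
      using Z(2) e unfolding lim_sequentially by blast
    have bd: "Z n \<in> closed_upper \<inter> cball 0 B" if "n \<ge> N" for n
    proof (rule ccontr)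
      assume "Z n \<notin> closed_upper \<inter> cball 0 B"
      hence "dist (F (Z n)) L < e" using B[of "Z n"] Z(1)[of n] by auto
      hence "dist w L < e + e" using N[OF that] dist_triangle[of w L "F (Z n)"] by (simp add: dist_commute)
      thus False by (simp add: e_def)
    qed
    have "compact (closed_upper \<inter> cball 0 B)" using closed_closed_upper by (intro closed_Int_compact) auto
    then obtain z r where r: "z \<in> closed_upper \<inter> cball 0 B" "strict_mono (r :: nat \<Rightarrow> nat)" "((\<lambda>n. Z (n + N)) \<circ> r) \<longlonglongrightarrow> z"
      unfolding compact_def using bd by (metis le_add2)
    define r' where "r' = (\<lambda>n. r n + N)"
    have r': "strict_mono r'" "(Z \<circ> r') \<longlonglongrightarrow> z"
      using r by (auto simp: r'_def strict_mono_def o_def)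
    have "((\<lambda>n. F (Z n)) \<circ> r') \<longlonglongrightarrow> w" by (rule LIMSEQ_subseq_LIMSEQ[OF Z(2) r'(1)])
    moreover have "(\<lambda>n. F ((Z \<circ> r') n)) \<longlonglongrightarrow> F z"
      by (rule continuous_on_tendsto_compose[OF cont r'(2)]) (use r(1) Z(1) in auto)
    ultimately have "F z = w" by (simp add: o_def LIMSEQ_unique)
    thus ?thesis using r r' by blast
  qed
  have pairs: "\<exists>z1 z2 r. Im z1 \<ge> 0 \<and> Im z2 \<ge> 0 \<and> F z1 = w \<and> F z2 = w \<and>
      strict_mono (r :: nat \<Rightarrow> nat) \<and> (Z1 \<circ> r) \<longlonglongrightarrow> z1 \<and> (Z2 \<circ> r) \<longlonglongrightarrow> z2"
    if Z: "\<And>n. Im (Z1 n) \<ge> 0" "\<And>n. Im (Z2 n) \<ge> 0" "\<And>n. F (Z1 n) = F (Z2 n)" "(\<lambda>n. F (Z1 n)) \<longlonglongrightarrow> w" "w \<noteq> L" for Z1 Z2 w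
  proof -
    obtain z1 r1 where 1: "strict_mono (r1 :: nat \<Rightarrow> nat)" "Im z1 \<ge> 0" "(Z1 \<circ> r1) \<longlonglongrightarrow> z1" "F z1 = w"
      using subseq[of Z1 w] Z by blast
    have "(\<lambda>n. F ((Z2 \<circ> r1) n)) \<longlonglongrightarrow> w"
      using LIMSEQ_subseq_LIMSEQ[OF Z(4) 1(1)] Z(3) by (simp add: o_def)
    then obtain z2 r2 where 2: "strict_mono (r2 :: nat \<Rightarrow> nat)" "Im z2 \<ge> 0" "((Z2 \<circ> r1) \<circ> r2) \<longlonglongrightarrow> z2" "F z2 = w"
      using subseq[of "Z2 \<circ> r1" w] Z by auto
    have "strict_mono (r1 \<circ> r2)" using 1 2 by (simp add: strict_mono_o)
    moreover have "(Z1 \<circ> (r1 \<circ> r2)) \<longlonglongrightarrow> z1" using LIMSEQ_subseq_LIMSEQ[OF 1(3) 2(1)] by (simp add: o_assoc)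
    moreover have "(Z2 \<circ> (r1 \<circ> r2)) \<longlonglongrightarrow> z2" using 2(3) by (simp add: o_assoc)
    ultimately show ?thesis using 1 2 by blast
  qed
  have clash: False
    if "(Z1 \<circ> r) \<longlonglongrightarrow> z" "(Z2 \<circ> r) \<longlonglongrightarrow> z" "e > 0" "inj_on F (ball z e \<inter> closed_upper)"
      "\<And>n. Im (Z1 n) \<ge> 0" "\<And>n. Im (Z2 n) \<ge> 0" "\<And>n. F (Z1 n) = F (Z2 n)" "\<And>n. Z1 n \<noteq> Z2 n"
    for Z1 Z2 :: "nat \<Rightarrow> complex" and r :: "nat \<Rightarrow> nat" and z e
  proof -
    have "eventually (\<lambda>n. (Z1 \<circ> r) n \<in> ball z e \<and> (Z2 \<circ> r) n \<in> ball z e) sequentially"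
      using that(3) by (intro eventually_conj topological_tendstoD[OF that(1)] topological_tendstoD[OF that(2)]) auto
    then obtain n where "(Z1 \<circ> r) n \<in> ball z e \<and> (Z2 \<circ> r) n \<in> ball z e"
      by (rule eventually_happens'[OF sequentially_bot, THEN exE])
    hence "Z1 (r n) = Z2 (r n)"
      using inj_onD[OF that(4) that(7)[of "r n"]] that(5)[of "r n"] that(6)[of "r n"] by simp
    thus False using that(8) by simp
  qed
  \<comment> \<open>The values taken at least twice. \<open>D\<close> is open, since disjoint
    neighbourhoods of two preimages have open images.\<close>
  define D where "D = {w \<in> interior P. \<exists>z1 z2. Im z1 > 0 \<and> Im z2 > 0 \<and> z1 \<noteq> z2 \<and> F z1 = w \<and> F z2 = w}"
  have D_sub: "D \<subseteq> interior P" unfolding D_def by blast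
  have openD: "open D"
  proof (subst open_subopen, rule ballI)
    fix w assume "w \<in> D"
    then obtain z1 z2 where z: "Im z1 > 0" "Im z2 > 0" "z1 \<noteq> z2" "F z1 = w" "F z2 = w"
      unfolding D_def by blast
    obtain U V where UV: "open U" "open V" "z1 \<in> U" "z2 \<in> V" "U \<inter> V = {}" using hausdorff[OF z(3)] by blast
    define T where "T = F ` (U \<inter> ?H) \<inter> F ` (V \<inter> ?H)"
    have "open T" unfolding T_def using UV open_upper by (intro open_Int openF) auto
    moreover have "w \<in> T" unfolding T_def
      using UV z image_eqI[of w F z1 "U \<inter> ?H"] image_eqI[of w F z2 "V \<inter> ?H"] by simp
    moreover have "T \<subseteq> D"
    proof
      fix y assume "y \<in> T"
      hence "y \<in> F ` (U \<inter> ?H)" "y \<in> F ` (V \<inter> ?H)" by (auto simp: T_def)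
      then obtain a b where "y = F a" "a \<in> U \<inter> ?H" "y = F b" "b \<in> V \<inter> ?H" by (elim imageE)
      hence ab: "a \<in> U" "b \<in> V" "Im a > 0" "Im b > 0" "F a = y" "F b = y" by simp_all
      have "a \<noteq> b" using ab UV(5) by blast
      moreover have "y \<in> interior P" using im ab by blast
      ultimately show "y \<in> D" using ab unfolding D_def by blast
    qed
    ultimately show "\<exists>T. open T \<and> w \<in> T \<and> T \<subseteq> D" by blast
  qed
  have limD: "\<exists>z1 z2. Im z1 \<ge> 0 \<and> Im z2 \<ge> 0 \<and> F z1 = w \<and> F z2 = w \<and>
      (z1 = z2 \<longrightarrow> \<not> (\<exists>e>0. inj_on F (ball z1 e \<inter> closed_upper)))"
    if w: "w \<in> closure D" "w \<noteq> L" for w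
  proof -
    obtain W where W: "\<And>n. W n \<in> D" "W \<longlonglongrightarrow> w" using w(1) unfolding closure_sequential by blast
    have "\<forall>n. \<exists>z1 z2. Im z1 > 0 \<and> Im z2 > 0 \<and> z1 \<noteq> z2 \<and> F z1 = W n \<and> F z2 = W n"
      using W(1) unfolding D_def by blast
    then obtain Z1 Z2 where Z: "\<And>n. Im (Z1 n) > 0" "\<And>n. Im (Z2 n) > 0" "\<And>n. Z1 n \<noteq> Z2 n" "\<And>n. F (Z1 n) = W n" "\<And>n. F (Z2 n) = W n"
      by metis
    have Z': "Im (Z1 n) \<ge> 0" "Im (Z2 n) \<ge> 0" for n using Z(1,2)[of n] by simp_all
    have "\<exists>z1 z2 r. Im z1 \<ge> 0 \<and> Im z2 \<ge> 0 \<and> F z1 = w \<and> F z2 = w \<and>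
      strict_mono (r :: nat \<Rightarrow> nat) \<and> (Z1 \<circ> r) \<longlonglongrightarrow> z1 \<and> (Z2 \<circ> r) \<longlonglongrightarrow> z2"
      by (rule pairs) (use Z Z' W w in auto)
    then obtain z1 z2 r where z: "Im z1 \<ge> 0" "Im z2 \<ge> 0" "F z1 = w" "F z2 = w"
      "strict_mono (r :: nat \<Rightarrow> nat)" "(Z1 \<circ> r) \<longlonglongrightarrow> z1" "(Z2 \<circ> r) \<longlonglongrightarrow> z2" by blast
    have "\<not> (\<exists>e>0. inj_on F (ball z1 e \<inter> closed_upper))" if "z1 = z2"
    proof
      assume "\<exists>e>0. inj_on F (ball z1 e \<inter> closed_upper)"
      then obtain e where e: "e > 0" "inj_on F (ball z1 e \<inter> closed_upper)" by blast
      show False by (rule clash[OF z(6) z(7)[folded that] e]) (use Z Z' in auto)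
    qed
    thus ?thesis using z by blast
  qed
  \<comment> \<open>The preimages of a limit value in the interior cannot be real, because real
    points go to the frontier; and they stay distinct, because \<open>F\<close> is locally injective
    where its derivative does not vanish.\<close>
  have "closedin (top_of_set (interior P)) D"
  proof -
    have "D = interior P \<inter> closure D"
    proof
      show "D \<subseteq> interior P \<inter> closure D" using closure_subset D_sub by blast
      show "interior P \<inter> closure D \<subseteq> D"
      proof
        fix w assume w: "w \<in> interior P \<inter> closure D"
        hence "w \<noteq> L" using bdry(2) Pdecomp by auto
        then obtain z1 z2 where z: "Im z1 \<ge> 0" "Im z2 \<ge> 0" "F z1 = w" "F z2 = w"
          "z1 = z2 \<longrightarrow> \<not> (\<exists>e>0. inj_on F (ball z1 e \<inter> closed_upper))"
          using limD[of w] w by blast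
        have pos: "Im z1 > 0" "Im z2 > 0"
          using z fin(1)[of z1] fin(1)[of z2] w Pdecomp by (force simp: less_le)+
        have "z1 \<noteq> z2"
        proof
          assume eq: "z1 = z2"
          have "z1 \<in> ?H" using pos by simp
          then obtain e where "e > 0" "ball z1 e \<subseteq> ?H" "inj_on F (ball z1 e)"
            using has_complex_derivative_locally_injective[OF hol _ open_upper nz[OF pos(1)]] by blast
          thus False using z(5) eq by (meson inf_le1 inj_on_subset)
        qed
        thus "w \<in> D" using z pos w unfolding D_def by blast
      qed
    qed
    thus ?thesis using closed_closure closedin_closed_Int by metis
  qed
  moreover have "openin (top_of_set (interior P)) D"
    using openD D_sub by (simp add: openin_open_eq open_interior)
  ultimately have "D = {} \<or> D = interior P" using conn_int unfolding connected_clopen by blast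
  \<comment> \<open>Otherwise \<open>F x0\<close> is a limit of double values. Both limit preimages
    must then be real, hence equal to \<open>x0\<close>, where local injectivity forbids the
    collapse.\<close>
  moreover have "D \<noteq> interior P"
  proof
    assume DP: "D = interior P"
    have "closure (interior P) = closure P" using P by (intro convex_closure_interior)
    hence "F x0 \<in> closure D" "F x0 \<noteq> L" using DP fin[OF loc(1)] frP closedP by auto
    then obtain z1 z2 where z: "Im z1 \<ge> 0" "Im z2 \<ge> 0" "F z1 = F x0" "F z2 = F x0"
        "z1 = z2 \<longrightarrow> \<not> (\<exists>e>0. inj_on F (ball z1 e \<inter> closed_upper))"
      using limD[of "F x0"] by blast
    have "Im y = 0" if "Im y \<ge> 0" "F y = F x0" for y
    proof (rule ccontr)
      assume "Im y \<noteq> 0"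
      hence "F y \<in> interior P" using imI[of y] that by simp
      thus False using that fin[OF loc(1)] Pdecomp by auto
    qed
    hence "z1 = x0" "z2 = x0" using z inj_onD[OF real_inj, of _ x0] loc(1) by auto
    thus False using z(5) loc by blast
  qed
  ultimately have "D = {}" by blast
  hence inj: "inj_on F ?H" using im unfolding D_def inj_on_def by blast
  have bij: "bij_betw F ?H (interior P)" using inj im by (simp add: bij_betw_def)
  have K_P: "K = P" unfolding Keq im using Pdecomp by auto
  have "inj_on f (topspace closed_half_plane)"
  proof (rule inj_onI)
    have sep: "F z \<noteq> L" if "Im z \<ge> 0" for z
      using fin(2)[of z] imI[of z] bdry(2) Pdecomp that by (cases "Im z = 0") auto
    have inj': "z = w" if "Im z \<ge> 0" "Im w \<ge> 0" "F z = F w" for z w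
    proof (cases "Im z = 0")
      case True
      hence "Im w = 0" using that fin(1)[OF True] imI[of w] Pdecomp by (cases "Im w = 0") auto
      thus ?thesis using inj_onD[OF real_inj that(3)] True by simp
    next
      case False
      hence zi: "F z \<in> interior P" using imI[of z] that by simp
      hence "Im w \<noteq> 0" using that fin(1)[of w] Pdecomp by auto
      thus ?thesis using inj_onD[OF inj that(3)] False that by simp
    qed
    fix x y assume "x \<in> topspace closed_half_plane" "y \<in> topspace closed_half_plane" "f x = f y"
    thus "x = y" using sep inj' unfolding topspace_closed_half_plane f_def
      by (auto split: option.splits)
  qed
  moreover have "continuous_map closed_half_plane (top_of_set P) f"
    using cmap K_P by (auto simp: continuous_map_in_subtopology K_def)
  ultimately have "homeomorphic_map closed_half_plane (top_of_set P) f"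
    using K_P by (intro continuous_imp_homeomorphic_map compact_space_closed_half_plane)
      (auto simp: K_def Hausdorff_space_subtopology)
  moreover have "biholomorphic_on (\<lambda>z. f (Some z)) ?H (interior P)"
    using biholomorphic_onI[OF open_upper hol bij] by (simp add: f_def)
  ultimately show ?thesis unfolding half_plane_chart_def f_def by blast
qed

section \<open>Schwarz--Christoffel maps\<close>

text \<open>The logarithm cut along the negative imaginary axis is holomorphic around the closed upper
  half-plane without \<open>0\<close>.\<close>

definition upper_log :: "complex \<Rightarrow> complex" where
  "upper_log z = Ln (- \<i> * z) + \<i> * of_real pi / 2"

lemma upper_log_holomorphic:
  "upper_log holomorphic_on {z. Im z > 0 \<or> Re z \<noteq> 0}"
  unfolding upper_log_def
  by (intro holomorphic_intros) (auto simp: complex_nonpos_Reals_iff)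

lemma Re_upper_log: "z \<noteq> 0 \<Longrightarrow> Re (upper_log z) = ln (norm z)"
  by (simp add: upper_log_def norm_mult)

lemma upper_log_of_real:
  assumes "x \<noteq> 0"
  shows "upper_log (of_real x) = of_real (ln \<bar>x\<bar>) + (if x < 0 then \<i> * of_real pi else 0)"
proof (cases "x > 0")
  case True
  have "Ln (- \<i> * of_real x) = Ln (of_real x * (- \<i>))" by (simp add: mult.commute)
  also have "\<dots> = of_real (ln x) + Ln (- \<i>)" by (subst Ln_times_of_real) (use True in \<open>auto simp: Ln_of_real\<close>)
  finally show ?thesis using True by (simp add: upper_log_def)
next
  case False
  hence neg: "x < 0" using assms by simp
  have "Ln (- \<i> * of_real x) = Ln (of_real (- x) * \<i>)" by (simp add: mult.commute)
  also have "\<dots> = of_real (ln (- x)) + Ln \<i>" by (subst Ln_times_of_real) (use neg in \<open>auto simp: Ln_of_real simp flip: of_real_minus\<close>)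
  finally show ?thesis using neg by (simp add: upper_log_def field_simps)
qed

text \<open>The branch of z^(-2/3) (z - u)^(-b) (z - 1)^(-2/3) given by \<open>upper_log\<close>.
  The exponent b = 1/3 belongs to the parallelogram; with b = 0 the point u is only marked, and the
  polygon is the triangle.\<close>

definition sc_integrand :: "real \<Rightarrow> real \<Rightarrow> complex \<Rightarrow> complex" where
  "sc_integrand b u z = exp (- (2/3) * upper_log z - of_real b * upper_log (z - of_real u) - (2/3) * upper_log (z - 1))"

definition sc_weight :: "real \<Rightarrow> real \<Rightarrow> real \<Rightarrow> real" where
  "sc_weight b u x = \<bar>x\<bar> powr (-2/3) * \<bar>x - u\<bar> powr (- b) * \<bar>x - 1\<bar> powr (-2/3)"

lemma sc_integrand_nonzero [simp]: "sc_integrand b u z \<noteq> 0"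
  by (simp add: sc_integrand_def)

lemma norm_sc_integrand:
  assumes "z \<noteq> 0" "z \<noteq> of_real u" "z \<noteq> 1"
  shows "norm (sc_integrand b u z) = norm z powr (-2/3) * norm (z - of_real u) powr (- b) * norm (z - 1) powr (-2/3)"
  using assms by (simp add: sc_integrand_def Re_upper_log powr_def flip: exp_add)

text \<open>Each logarithm contributes the argument pi exactly to the left of its branch point, so
  the argument of the integrand is constant between consecutive prevertices and every edge is
  straight.\<close>

lemma sc_integrand_of_real:
  assumes "x \<noteq> 0" "x \<noteq> u" "x \<noteq> 1"
  shows "sc_integrand b u (of_real x) = of_real (sc_weight b u x) *
    cis (- pi * ((if x < 0 then 2/3 else 0) + (if x < u then b else 0) + (if x < 1 then 2/3 else 0)))"
proof -
  have L: "upper_log (of_real x - of_real u) = of_real (ln \<bar>x - u\<bar>) + (if x < u then \<i> * of_real pi else 0)"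
    "upper_log (of_real x - 1) = of_real (ln \<bar>x - 1\<bar>) + (if x < 1 then \<i> * of_real pi else 0)"
    using upper_log_of_real[of "x - u"] upper_log_of_real[of "x - 1"] assms by simp_all
  define A where "A = - (2/3) * ln \<bar>x\<bar> - b * ln \<bar>x - u\<bar> - (2/3) * ln \<bar>x - 1\<bar>"
  define t where "t = - pi * ((if x < 0 then 2/3 else 0) + (if x < u then b else 0) + (if x < 1 then 2/3 else 0))"
  have "- (2/3) * upper_log (of_real x) - of_real b * upper_log (of_real x - of_real u) - (2/3) * upper_log (of_real x - 1)
      = of_real A + \<i> * of_real t"
    unfolding L using assms by (simp add: upper_log_of_real A_def t_def algebra_simps)
  hence "sc_integrand b u (of_real x) = exp (of_real A) * exp (\<i> * of_real t)"
    by (simp add: sc_integrand_def exp_add)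
  also have "exp (complex_of_real A) = of_real (exp A)" by (rule exp_of_real)
  also have "exp A = sc_weight b u x"
    using assms by (simp add: A_def sc_weight_def powr_def flip: exp_add)
  finally show ?thesis by (simp add: t_def cis_conv_exp)
qed

lemma sc_weight_pos: "x \<noteq> 0 \<Longrightarrow> x \<noteq> u \<Longrightarrow> x \<noteq> 1 \<Longrightarrow> sc_weight b u x > 0"
  by (simp add: sc_weight_def)

lemma sc_integrand_holomorphic:
  "sc_integrand b u holomorphic_on {z. Im z > 0 \<or> (Re z \<noteq> 0 \<and> Re z \<noteq> u \<and> Re z \<noteq> 1)}"
  unfolding sc_integrand_def
  by (intro holomorphic_intros
      holomorphic_on_compose_gen[OF _ upper_log_holomorphic, of "\<lambda>z. z - c" for c, unfolded o_def]
      holomorphic_on_subset[OF upper_log_holomorphic]) auto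

text \<open>The points are at least 2d apart, so at most one factor has a base below d. Up to height
  1 that factor is bounded by Im z and the other two by powers of d with total exponent at most 4/3;
  from height 1 on, the total exponent, at least 2/3, gives the decay. The exponents are general
  because the coordinate -1/z leads to a second triple.\<close>

lemma product_bound_near_real_line:
  fixes a0 a1 a2 :: real
  assumes z: "Im z > 0" and d: "0 < d" "d \<le> 1"
    and sep: "2 * d \<le> \<bar>a0 - a1\<bar>" "2 * d \<le> \<bar>a0 - a2\<bar>" "2 * d \<le> \<bar>a1 - a2\<bar>"
    and p: "0 \<le> p0" "p0 \<le> 2/3" "0 \<le> p1" "p1 \<le> 2/3" "0 \<le> p2" "p2 \<le> 2/3" "p0 + p1 + p2 \<ge> 2/3"
  shows "norm (z - of_real a0) powr (- p0) * norm (z - of_real a1) powr (- p1) * norm (z - of_real a2) powr (- p2)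
    \<le> d powr (-2) * Im z powr (-2/3)"
proof -
  define y where "y = Im z"
  have y: "y > 0" using z by (simp add: y_def)
  have ge: "norm (z - of_real a) \<ge> y" for a
    using abs_Im_le_cmod[of "z - of_real a"] y by (simp add: y_def)
  have by_y: "norm (z - of_real a) powr (- p) \<le> y powr (- p)" if "p \<ge> 0" for a p
    using that ge[of a] y by (intro powr_mono2') auto
  have by_d: "norm (z - of_real a) powr (- p) \<le> d powr (- p)" if "p \<ge> 0" "norm (z - of_real a) \<ge> d" for a p
    using that d by (intro powr_mono2') auto
  have d1: "d powr (- p) \<ge> 1" if "p \<ge> 0" for p using that d powr_mono2'[of "-p" d 1] by simp
  have d2: "d powr (- s) \<le> d powr (-2)" if "s \<le> 2" for s using that d by (intro powr_mono') auto
  show ?thesis unfolding y_def[symmetric]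
  proof (cases "y \<ge> 1")
    case True
    have "norm (z - of_real a0) powr (- p0) * norm (z - of_real a1) powr (- p1) * norm (z - of_real a2) powr (- p2)
        \<le> y powr (- p0) * y powr (- p1) * y powr (- p2)"
      using p by (intro mult_mono by_y) auto
    also have "\<dots> = y powr (- (p0 + p1 + p2))" by (simp add: powr_add[symmetric] algebra_simps)
    also have "\<dots> \<le> 1 * y powr (-2/3)" using True p by (simp add: powr_mono)
    also have "\<dots> \<le> d powr (-2) * y powr (-2/3)" using d1[of 2] by (intro mult_right_mono) auto
    finally show "norm (z - of_real a0) powr (- p0) * norm (z - of_real a1) powr (- p1) * norm (z - of_real a2) powr (- p2)
      \<le> d powr (-2) * y powr (-2/3)" .
  next
    case False
    have yp: "y powr (- p) \<le> y powr (-2/3)" if "p \<le> 2/3" for p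
      using False y that by (intro powr_mono') auto
    have y1: "1 \<le> y powr (-2/3)" using yp[of 0] y by simp
    have far: "norm (z - of_real a') \<ge> d" if "norm (z - of_real a) < d" "2 * d \<le> \<bar>a - a'\<bar>" for a a'
    proof -
      have "\<bar>a - a'\<bar> = norm ((z - of_real a') - (z - of_real a))" by (simp flip: of_real_diff)
      also have "\<dots> \<le> norm (z - of_real a') + norm (z - of_real a)" by (rule norm_triangle_ineq4)
      finally show ?thesis using that by linarith
    qed
    have comb: "A * B * C \<le> d powr (-2) * y powr (-2/3)"
      if "0 \<le> A" "0 \<le> B" "0 \<le> C" "A \<le> y powr (-2/3)" "B \<le> d powr (- s)" "C \<le> d powr (- t)" "s \<le> 2/3" "t \<le> 2/3" for A B C s t
    proof -
      have "A * B * C \<le> y powr (-2/3) * d powr (- s) * d powr (- t)" using that by (intro mult_mono) auto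
      also have "\<dots> = d powr (- (s + t)) * y powr (-2/3)" by (simp add: powr_add[symmetric] algebra_simps)
      also have "\<dots> \<le> d powr (-2) * y powr (-2/3)" using d2[of "s + t"] that by (intro mult_right_mono) auto
      finally show ?thesis .
    qed
    consider "norm (z - of_real a0) < d" | "norm (z - of_real a1) < d"
      | "norm (z - of_real a0) \<ge> d" "norm (z - of_real a1) \<ge> d" by linarith
    thus "norm (z - of_real a0) powr (- p0) * norm (z - of_real a1) powr (- p1) * norm (z - of_real a2) powr (- p2)
      \<le> d powr (-2) * y powr (-2/3)"
    proof cases
      case 1
      note f = far[OF 1 sep(1)] far[OF 1 sep(2)]
      show ?thesis
        by (rule comb[OF _ _ _ order.trans[OF by_y yp] by_d by_d, OF _ _ _ _ _ _ f(1) _ f(2)]) (use p in auto)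
    next
      case 2
      have f: "norm (z - of_real a0) \<ge> d" "norm (z - of_real a2) \<ge> d"
        using far[OF 2, of a0] far[OF 2, of a2] sep by (auto simp: abs_minus_commute)
      have "norm (z - of_real a1) powr (- p1) * norm (z - of_real a0) powr (- p0) * norm (z - of_real a2) powr (- p2)
        \<le> d powr (-2) * y powr (-2/3)"
        by (rule comb[OF _ _ _ order.trans[OF by_y yp] by_d by_d, OF _ _ _ _ _ _ f(1) _ f(2)]) (use p in auto)
      thus ?thesis by (simp add: mult_ac)
    next
      case 3
      have "norm (z - of_real a2) powr (- p2) * norm (z - of_real a0) powr (- p0) * norm (z - of_real a1) powr (- p1)
        \<le> d powr (-2) * y powr (-2/3)"
        by (rule comb[OF _ _ _ order.trans[OF by_y yp] by_d by_d, OF _ _ _ _ _ _ 3(1) _ 3(2)]) (use p in auto)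
      thus ?thesis by (simp add: mult_ac)
    qed
  qed
qed

text \<open>Joining two points at distance \<open>d\<close> by a path at height \<open>d\<close> shows that \<open>\<phi>\<close> is Hoelder continuous
  with exponent \<open>1/3\<close>.\<close>

lemma half_plane_extension:
  fixes \<phi> :: "complex \<Rightarrow> complex"
  assumes deriv: "\<And>z. Im z > 0 \<Longrightarrow> (\<phi> has_field_derivative \<phi>' z) (at z)"
    and bound: "\<And>z. Im z > 0 \<Longrightarrow> norm (\<phi>' z) \<le> C * Im z powr (-2/3)"
  obtains \<Phi> where "continuous_on closed_upper \<Phi>" "\<And>z. Im z > 0 \<Longrightarrow> \<Phi> z = \<phi> z"
proof -
  have "norm (\<phi>' \<i>) \<le> C" using bound[of \<i>] by simp
  hence C: "C \<ge> 0" using norm_ge_zero order.trans by blast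
  \<comment> \<open>On the way up the derivative is at most C (Im z + t)^(-2/3) <= C t^(-2/3), whose
    integral 3 C d^(1/3) is independent of the height of the starting point.\<close>
  have vert: "norm (\<phi> (z + \<i> * of_real d) - \<phi> z) \<le> 3 * C * d powr (1/3)" if "Im z > 0" "d > 0" for z d
  proof -
    have dv: "((\<lambda>t. \<phi> (z + \<i> * of_real t)) has_vector_derivative \<i> * \<phi>' (z + \<i> * of_real t)) (at t)" if "t \<ge> 0" for t
    proof -
      have "((\<lambda>w. \<phi> (z + \<i> * w)) has_field_derivative \<phi>' (z + \<i> * of_real t) * \<i>) (at (of_real t))"
        by (rule DERIV_chain2[OF deriv]) (use \<open>Im z > 0\<close> that in \<open>auto intro!: derivative_eq_intros\<close>)
      from has_vector_derivative_real_field[OF this] show ?thesis by (simp add: mult.commute)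
    qed
    have "norm (\<phi> (z + \<i> * of_real d) - \<phi> (z + \<i> * of_real 0)) \<le> 3 * C * d powr (1/3) - 3 * C * 0 powr (1/3)"
    proof (rule differentiable_bound_general[OF \<open>d > 0\<close>])
      show "continuous_on {0..d} (\<lambda>t. \<phi> (z + \<i> * of_real t))"
        by (intro continuous_at_imp_continuous_on ballI has_vector_derivative_continuous[OF dv]) auto
      show "continuous_on {0..d} (\<lambda>t. 3 * C * t powr (1/3))"
        by (intro continuous_intros continuous_on_powr') auto
      fix t assume t: "0 < t" "t < d"
      show "((\<lambda>t. \<phi> (z + \<i> * of_real t)) has_vector_derivative \<i> * \<phi>' (z + \<i> * of_real t)) (at t)"
        using dv t by simp
      have "((\<lambda>t. 3 * C * t powr (1/3)) has_real_derivative C * t powr (-2/3)) (at t)"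
        using t by (auto intro!: derivative_eq_intros)
      thus "((\<lambda>t. 3 * C * t powr (1/3)) has_vector_derivative C * t powr (-2/3)) (at t)"
        by (simp add: has_real_derivative_iff_has_vector_derivative)
      have "norm (\<phi>' (z + \<i> * of_real t)) \<le> C * (Im z + t) powr (-2/3)"
        using bound[of "z + \<i> * of_real t"] that t by simp
      also have "\<dots> \<le> C * t powr (-2/3)" using C that t by (intro mult_left_mono powr_mono2') auto
      finally show "norm (\<i> * \<phi>' (z + \<i> * of_real t)) \<le> C * t powr (-2/3)" by (simp add: norm_mult)
    qed
    thus ?thesis by simp
  qed
  \<comment> \<open>The constant is 7 = 3 + 1 + 3: up from one point, across at height at least d,
    and down to the other.\<close>
  have holder: "norm (\<phi> z - \<phi> w) \<le> 7 * C * norm (z - w) powr (1/3)" if zw: "Im z > 0" "Im w > 0" for z w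
  proof (cases "z = w")
    case False
    define d where "d = norm (z - w)"
    have d: "d > 0" using False by (simp add: d_def)
    define z' w' where "z' = z + \<i> * of_real d" and "w' = w + \<i> * of_real d"
    have "norm (\<phi> z' - \<phi> w') \<le> (C * d powr (-2/3)) * norm (z' - w')"
    proof (rule field_differentiable_bound)
      show "convex {x. Im x \<ge> d}" by (rule convex_halfspace_Im_ge)
      show "(\<phi> has_field_derivative \<phi>' x) (at x within {x. Im x \<ge> d})" if "x \<in> {x. Im x \<ge> d}" for x
        by (rule has_field_derivative_at_within[OF deriv]) (use that d in auto)
      show "norm (\<phi>' x) \<le> C * d powr (-2/3)" if "x \<in> {x. Im x \<ge> d}" for x
      proof -
        have "norm (\<phi>' x) \<le> C * Im x powr (-2/3)" using bound[of x] that d by auto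
        also have "\<dots> \<le> C * d powr (-2/3)" using C that d by (intro mult_left_mono powr_mono2') auto
        finally show ?thesis .
      qed
    qed (use zw in \<open>auto simp: z'_def w'_def\<close>)
    also have "\<dots> = C * (d powr (-2/3) * d powr 1)" using d by (simp add: z'_def w'_def d_def)
    also have "d powr (-2/3) * d powr 1 = d powr (1/3)" by (simp only: powr_add[symmetric]) simp
    finally have 1: "norm (\<phi> z' - \<phi> w') \<le> C * d powr (1/3)" .
    have 2: "norm (\<phi> z' - \<phi> z) \<le> 3 * C * d powr (1/3)" "norm (\<phi> w' - \<phi> w) \<le> 3 * C * d powr (1/3)"
      unfolding z'_def w'_def using vert zw d by auto
    have "\<phi> z - \<phi> w = (\<phi> z' - \<phi> w') - (\<phi> z' - \<phi> z) + (\<phi> w' - \<phi> w)" by simp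
    also have "norm \<dots> \<le> norm (\<phi> z' - \<phi> w') + norm (\<phi> z' - \<phi> z) + norm (\<phi> w' - \<phi> w)"
      by (meson norm_triangle_ineq norm_triangle_ineq4 add_right_mono order.trans)
    also have "\<dots> \<le> 7 * C * d powr (1/3)" using 1 2 by linarith
    finally show ?thesis by (simp add: d_def)
  qed simp
  have "uniformly_continuous_on upper_half_plane \<phi>"
    unfolding uniformly_continuous_on_def
  proof (intro allI impI)
    fix e :: real assume e: "e > 0"
    define k where "k = e / (7 * C + 1)"
    have k: "k > 0" using e C by (simp add: k_def)
    show "\<exists>d>0. \<forall>x\<in>upper_half_plane. \<forall>x'\<in>upper_half_plane. dist x' x < d \<longrightarrow> dist (\<phi> x') (\<phi> x) < e"
    proof (intro exI[of _ "k powr 3"] conjI ballI impI)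
      show "k powr 3 > 0" using k by simp
      fix x x' assume x: "x \<in> upper_half_plane" "x' \<in> upper_half_plane" "dist x' x < k powr 3"
      have "norm (x' - x) powr (1/3) \<le> (k powr 3) powr (1/3)"
        using x(3) by (intro powr_mono2) (auto simp: dist_norm)
      also have "\<dots> = k" using k by (simp only: powr_powr) simp
      finally have "7 * C * norm (x' - x) powr (1/3) \<le> 7 * C * k" using C by (intro mult_left_mono) auto
      also have "\<dots> < (7 * C + 1) * k" using k by (simp add: algebra_simps)
      also have "\<dots> = e" using C by (simp add: k_def add_nonneg_pos)
      finally show "dist (\<phi> x') (\<phi> x) < e" using holder[of x' x] x by (simp add: dist_norm)
    qed
  qed
  then obtain \<Phi> where "uniformly_continuous_on (closure upper_half_plane) \<Phi>" "\<And>z. z \<in> upper_half_plane \<Longrightarrow> \<phi> z = \<Phi> z"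
    by (rule uniformly_continuous_on_extension_on_closure) metis
  thus thesis
    using closure_halfspace_gt[of "\<i>" 0] uniformly_continuous_imp_continuous
    by (intro that[of \<Phi>]) (auto simp: inner_complex_def)
qed

section \<open>Primitives of the Schwarz-Christoffel integrand\<close>

lemma eq_at_closed_upper:
  fixes f g :: "complex \<Rightarrow> complex"
  assumes "continuous (at z within closed_upper) f" "continuous (at z within closed_upper) g"
    and "Im z \<ge> 0" "e > 0" and eq: "\<And>w. w \<in> ball z e \<Longrightarrow> Im w > 0 \<Longrightarrow> f w = g w"
  shows "f z = g z"
proof -
  define Z where "Z = (\<lambda>n. z + \<i> * of_real (inverse (real (Suc n))))"
  have "Z \<longlonglongrightarrow> z + \<i> * of_real 0"
    unfolding Z_def by (intro tendsto_intros LIMSEQ_inverse_real_of_nat)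
  hence Z: "Z \<longlonglongrightarrow> z" by simp
  have Zin: "Im (Z n) > 0" for n using assms(3) by (simp add: Z_def add_nonneg_pos)
  have Zcu: "\<forall>n. Z n \<in> closed_upper" using Zin less_imp_le by auto
  have "(f \<circ> Z) \<longlonglongrightarrow> f z" "(g \<circ> Z) \<longlonglongrightarrow> g z"
    using assms(1,2) Zcu Z unfolding continuous_within_sequentially by blast+
  moreover have "eventually (\<lambda>n. (f \<circ> Z) n = (g \<circ> Z) n) sequentially"
  proof -
    have "eventually (\<lambda>n. Z n \<in> ball z e) sequentially"
      using \<open>e > 0\<close> by (intro topological_tendstoD[OF Z]) auto
    thus ?thesis by eventually_elim (use eq Zin in auto)
  qed
  ultimately show ?thesis
    using Lim_transform_eventually LIMSEQ_unique by blast
qed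

text \<open>The unscaled primitive vanishing at 0, with limit \<open>L\<close> at infinity. The last
  clause continues it across the real line away from the prevertices; from it come the derivative
  along each edge and injectivity near a boundary point.\<close>

definition sc_map :: "real \<Rightarrow> real \<Rightarrow> (complex \<Rightarrow> complex) \<Rightarrow> complex \<Rightarrow> bool" where
  "sc_map b u F L \<longleftrightarrow> continuous_on closed_upper F \<and> F 0 = 0 \<and>
    (\<forall>z. Im z > 0 \<longrightarrow> (F has_field_derivative sc_integrand b u z) (at z)) \<and>
    (\<forall>e>0. \<exists>B. \<forall>z. Im z \<ge> 0 \<and> norm z > B \<longrightarrow> dist (F z) L < e) \<and>
    (\<forall>x. x \<notin> {0, u, 1} \<longrightarrow> (\<exists>G e. e > 0 \<and>
      (\<forall>z\<in>ball (complex_of_real x) e. (G has_field_derivative sc_integrand b u z) (at z)) \<and>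
      (\<forall>z\<in>ball (complex_of_real x) e. Im z \<ge> 0 \<longrightarrow> F z = G z)))"

text \<open>Convergence at infinity is continuity at \<open>0\<close> of the map in the coordinate \<open>-1/z\<close>, whose derivative
  satisfies the same kind of bound.\<close>

lemma sc_map_exists:
  assumes u: "0 < u" "u < 1" and b: "0 \<le> b" "b \<le> 2/3"
  obtains F L where "sc_map b u F L"
proof -
  let ?h = "sc_integrand b u"
  have hol: "?h holomorphic_on upper_half_plane"
    by (rule holomorphic_on_subset[OF sc_integrand_holomorphic]) auto
  obtain F0 where "\<And>z. z \<in> upper_half_plane \<Longrightarrow> (F0 has_field_derivative ?h z) (at z within upper_half_plane)"
    using holomorphic_convex_primitive'[OF convex_upper open_upper hol] by blast
  hence F0: "(F0 has_field_derivative ?h z) (at z)" if "Im z > 0" for z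
    using that at_within_open[OF _ open_upper, of z] by force
  have ne: "z \<noteq> 0" "z \<noteq> of_real u" "z \<noteq> 1" if "Im z > 0" for z using that by auto
  define d where "d = min u (1 - u) / 2"
  have bound: "norm (?h z) \<le> d powr (-2) * Im z powr (-2/3)" if z: "Im z > 0" for z
    unfolding norm_sc_integrand[OF ne[OF z]]
    using product_bound_near_real_line[OF z, of d 0 u 1 "2/3" b "2/3"] u b by (auto simp: d_def min_def)
  obtain F1 where F1: "continuous_on closed_upper F1" "\<And>z. Im z > 0 \<Longrightarrow> F1 z = F0 z"
    using half_plane_extension[OF F0 bound] by blast
  \<comment> \<open>In the coordinate -1/z the singular points infinity, u and 1 become 0, -1/u and
    -1, and \<open>d'\<close> is half their smallest gap. The exponent at 0 will be 2 - (2/3 + b +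
    2/3) = 2/3 - b, the 2 coming from the derivative of -1/z.\<close>
  define d' where "d' = min 1 ((1 - u) / u) / 2"
  have d': "0 < d'" "d' \<le> 1" using u by (auto simp: d'_def)
  have inv_up: "Im (- 1 / z) > 0" if "Im z > 0" for z
    using that by (simp add: Im_divide zero_less_divide_iff add_nonneg_pos)
  have dinv: "((\<lambda>z. F0 (- 1 / z)) has_field_derivative ?h (- 1 / z) * (1 / z\<^sup>2)) (at z)" if z: "Im z > 0" for z
  proof (rule DERIV_chain2[where f = F0 and g = "\<lambda>z. - 1 / z"])
    show "(F0 has_field_derivative ?h (- 1 / z)) (at (- 1 / z))" by (rule F0[OF inv_up[OF z]])
    show "((\<lambda>z. - 1 / z) has_field_derivative 1 / z\<^sup>2) (at z)"
      using ne[OF z] by (auto intro!: derivative_eq_intros simp: power2_eq_square)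
  qed
  have bound': "norm (?h (- 1 / z) * (1 / z\<^sup>2)) \<le> u powr (- b) * d' powr (-2) * Im z powr (-2/3)" if z: "Im z > 0" for z
  proof -
    define n where "n = norm z"
    have n: "n > 0" using ne[OF z] by (simp add: n_def)
    have e1: "norm (- 1 / z) = 1 / n" by (simp add: n_def norm_divide)
    have "- 1 / z - of_real u = - (of_real u * (z - of_real (- 1 / u))) / z"
      using ne[OF z] u by (simp add: field_simps)
    hence e2: "norm (- 1 / z - of_real u) = u * norm (z - of_real (- 1 / u)) / n"
      using u by (simp add: norm_divide norm_mult n_def del: of_real_divide of_real_minus)
    have "- 1 / z - 1 = - (z - of_real (- 1)) / z" using ne[OF z] by (simp add: field_simps)
    hence e3: "norm (- 1 / z - 1) = norm (z - of_real (- 1)) / n"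
      by (simp only: norm_divide norm_minus_cancel n_def)
    have "norm (?h (- 1 / z) * (1 / z\<^sup>2)) = (1 / n) powr (-2/3) * (u * norm (z - of_real (- 1 / u)) / n) powr (- b) *
        (norm (z - of_real (- 1)) / n) powr (-2/3) * n powr (-2)"
      unfolding norm_mult norm_sc_integrand[OF ne[OF inv_up[OF z]]] e1 e2 e3
      using n by (simp add: norm_divide norm_power n_def[symmetric] powr_minus powr_numeral divide_simps)
    also have "\<dots> = u powr (- b) * norm (z - of_real (- 1 / u)) powr (- b) * norm (z - of_real (- 1)) powr (-2/3) *
        (n powr (2/3) * n powr b * n powr (2/3) * n powr (-2))"
      using n u by (simp add: powr_divide powr_mult powr_minus divide_simps del: of_real_divide of_real_minus)
    also have "n powr (2/3) * n powr b * n powr (2/3) * n powr (-2) = n powr (- (2/3 - b))"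
      by (simp only: powr_add[symmetric]) (simp add: algebra_simps)
    also have "n = norm (z - of_real 0)" by (simp add: n_def)
    also have "u powr (- b) * norm (z - of_real (- 1 / u)) powr (- b) * norm (z - of_real (- 1)) powr (-2/3) *
        norm (z - of_real 0) powr (- (2/3 - b)) = u powr (- b) * (norm (z - of_real 0) powr (- (2/3 - b)) *
        norm (z - of_real (- 1 / u)) powr (- b) * norm (z - of_real (- 1)) powr (- (2/3)))" by simp
    also have "\<dots> \<le> u powr (- b) * (d' powr (-2) * Im z powr (-2/3))"
    proof (rule mult_left_mono)
      have "2 * d' \<le> \<bar>0 - (- 1 / u)\<bar>" "2 * d' \<le> \<bar>- 1 / u - (- 1)\<bar>" "2 * d' \<le> \<bar>0 - (- 1)\<bar>"
        using u by (auto simp: d'_def min_def field_simps abs_if)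
      thus "norm (z - of_real 0) powr (- (2/3 - b)) * norm (z - of_real (- 1 / u)) powr (- b) *
          norm (z - of_real (- 1)) powr (- (2/3)) \<le> d' powr (-2) * Im z powr (-2/3)"
        using b by (intro product_bound_near_real_line[OF z d']) auto
    qed auto
    finally show ?thesis by simp
  qed
  obtain F2 where F2: "continuous_on closed_upper F2" "\<And>z. Im z > 0 \<Longrightarrow> F2 z = F0 (- 1 / z)"
    using half_plane_extension[OF dinv bound'] by blast
  define F where "F = (\<lambda>z. F1 z - F1 0)"
  define L where "L = F2 0 - F1 0"
  have inv_cu: "Im (- 1 / z) \<ge> 0" if "Im z \<ge> 0" for z
    using that by (simp add: Im_divide)
  \<comment> \<open>Both sides equal \<open>F0 z\<close> in the open half-plane and are continuous
    up to the real line away from 0.\<close>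
  have F12: "F1 z = F2 (- 1 / z)" if "Im z \<ge> 0" "z \<noteq> 0" for z
  proof (rule eq_at_closed_upper[where e = 1 and f = F1 and g = "\<lambda>w. F2 (- 1 / w)"])
    show "continuous (at z within closed_upper) F1"
      using F1(1) that by (simp add: continuous_on_eq_continuous_within)
    have "continuous (at z within closed_upper) (\<lambda>w. - 1 / w)"
      using that by (intro continuous_intros) auto
    moreover have "continuous (at (- 1 / z) within (\<lambda>w. - 1 / w) ` closed_upper) F2"
    proof (rule continuous_within_subset)
      show "continuous (at (- 1 / z) within closed_upper) F2"
        using F2(1) inv_cu[OF that(1)] by (simp add: continuous_on_eq_continuous_within)
      show "(\<lambda>w. - 1 / w) ` closed_upper \<subseteq> closed_upper" using inv_cu by auto
    qed
    ultimately show "continuous (at z within closed_upper) (\<lambda>w. F2 (- 1 / w))"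
      by (rule continuous_within_compose2)
    fix w :: complex assume "Im w > 0"
    thus "F1 w = F2 (- 1 / w)" using F1(2) F2(2)[OF inv_up, of w] ne[of w] by simp
  qed (use that in auto)
  have "sc_map b u F L"
    unfolding sc_map_def
  proof (intro conjI allI impI)
    show contF: "continuous_on closed_upper F" unfolding F_def by (intro continuous_intros F1(1))
    show "F 0 = 0" by (simp add: F_def)
    show dF: "(F has_field_derivative ?h z) (at z)" if "Im z > 0" for z
    proof -
      have "(F1 has_field_derivative ?h z) (at z)"
        by (rule has_field_derivative_transform_within_open[OF F0[OF that] open_upper]) (use that F1(2) in auto)
      from DERIV_diff[OF this DERIV_const[of "F1 0"]] show ?thesis by (simp add: F_def)
    qed
    show "\<exists>B. \<forall>z. Im z \<ge> 0 \<and> norm z > B \<longrightarrow> dist (F z) L < e" if e: "e > 0" for e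
    proof -
      obtain \<delta> where \<delta>: "\<delta> > 0" "\<And>w. Im w \<ge> 0 \<Longrightarrow> dist w 0 < \<delta> \<Longrightarrow> dist (F2 w) (F2 0) < e"
        using F2(1) e unfolding continuous_on_iff by (metis (mono_tags, lifting) mem_Collect_eq order_refl zero_complex.sel(2))
      show ?thesis
      proof (intro exI[of _ "1 / \<delta>"] allI impI, elim conjE)
        fix z :: complex assume z: "Im z \<ge> 0" "norm z > 1 / \<delta>"
        have "1 / \<delta> > 0" using \<delta>(1) by simp
        hence z0: "norm z > 0" using z(2) by linarith
        have "dist (- 1 / z) 0 < \<delta>" using z(2) z0 \<delta>(1) by (simp add: norm_divide field_simps)
        from \<delta>(2)[OF inv_cu[OF z(1)] this] show "dist (F z) L < e"
          using F12[of z] z z0 by (simp add: F_def L_def dist_norm)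
      qed
    qed
    fix x :: real assume x: "x \<notin> {0, u, 1}"
    \<comment> \<open>Within this distance the real part avoids 0, u and 1, so the integrand is
      holomorphic on the whole ball, also below the real line, and has a primitive there.\<close>
    define e where "e = min \<bar>x\<bar> (min \<bar>x - u\<bar> \<bar>x - 1\<bar>)"
    have e: "e > 0" using x by (simp add: e_def)
    let ?B = "ball (complex_of_real x) e"
    have Bsub: "?B \<subseteq> {z. Im z > 0 \<or> (Re z \<noteq> 0 \<and> Re z \<noteq> u \<and> Re z \<noteq> 1)}"
    proof
      fix z assume z: "z \<in> ?B"
      have "\<bar>x - Re z\<bar> \<le> dist (of_real x) z" using abs_Re_le_cmod[of "of_real x - z"] by (simp add: dist_norm)
      also have "\<dots> < e" using z by simp
      finally show "z \<in> {z. Im z > 0 \<or> (Re z \<noteq> 0 \<and> Re z \<noteq> u \<and> Re z \<noteq> 1)}" by (auto simp: e_def)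
    qed
    obtain G0 where "\<And>z. z \<in> ?B \<Longrightarrow> (G0 has_field_derivative ?h z) (at z within ?B)"
      using holomorphic_convex_primitive'[OF convex_ball open_ball holomorphic_on_subset[OF sc_integrand_holomorphic Bsub]] by blast
    hence G0: "(G0 has_field_derivative ?h z) (at z)" if "z \<in> ?B" for z
      using that at_within_open[OF that open_ball] by force
    have "\<exists>c. \<forall>z\<in>?B \<inter> upper_half_plane. F z - G0 z = c"
    proof (rule has_field_derivative_zero_constant)
      show "convex (?B \<inter> upper_half_plane)" by (intro convex_Int convex_ball convex_upper)
      fix z assume z: "z \<in> ?B \<inter> upper_half_plane"
      have "((\<lambda>z. F z - G0 z) has_field_derivative ?h z - ?h z) (at z)"
        by (rule DERIV_diff[OF dF G0]) (use z in auto)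
      thus "((\<lambda>z. F z - G0 z) has_field_derivative 0) (at z within ?B \<inter> upper_half_plane)"
        by (simp add: has_field_derivative_at_within)
    qed
    then obtain c where c: "\<And>z. z \<in> ?B \<Longrightarrow> Im z > 0 \<Longrightarrow> F z - G0 z = c" by auto
    define G where "G = (\<lambda>z. G0 z + c)"
    have dG: "(G has_field_derivative ?h z) (at z)" if "z \<in> ?B" for z
      using DERIV_add[OF G0[OF that] DERIV_const[of c]] by (simp add: G_def)
    have "F z = G z" if z: "z \<in> ?B" "Im z \<ge> 0" for z
    proof -
      obtain e' where e': "e' > 0" "ball z e' \<subseteq> ?B" using z(1) open_ball openE by blast
      show ?thesis
      proof (rule eq_at_closed_upper[OF _ _ z(2) e'(1)])
        show "continuous (at z within closed_upper) F"
          using contF z by (simp add: continuous_on_eq_continuous_within)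
        show "continuous (at z within closed_upper) G"
          using DERIV_isCont[OF dG[OF z(1)]] by (simp add: continuous_at_imp_continuous_within)
        fix w assume w: "w \<in> ball z e'" "Im w > 0"
        hence "w \<in> ?B" using e'(2) by blast
        from c[OF this w(2)] show "F w = G w" by (simp add: G_def algebra_simps)
      qed
    qed
    thus "\<exists>G e. e > 0 \<and> (\<forall>z\<in>ball (complex_of_real x) e. (G has_field_derivative ?h z) (at z)) \<and>
      (\<forall>z\<in>ball (complex_of_real x) e. Im z \<ge> 0 \<longrightarrow> F z = G z)"
      using e dG by blast
  qed
  thus thesis by (rule that)
qed

section \<open>Behaviour along the real line: straight edges\<close>

lemma sc_map_local:
  assumes "sc_map b u F L" "x \<notin> {0, u, 1}"
  obtains G e where "e > 0"
    "\<And>z. z \<in> ball (complex_of_real x) e \<Longrightarrow> (G has_field_derivative sc_integrand b u z) (at z)"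
    "\<And>z. z \<in> ball (complex_of_real x) e \<Longrightarrow> Im z \<ge> 0 \<Longrightarrow> F z = G z"
proof -
  have "\<forall>x. x \<notin> {0, u, 1} \<longrightarrow> (\<exists>G e. e > 0 \<and>
      (\<forall>z\<in>ball (complex_of_real x) e. (G has_field_derivative sc_integrand b u z) (at z)) \<and>
      (\<forall>z\<in>ball (complex_of_real x) e. Im z \<ge> 0 \<longrightarrow> F z = G z))"
    using assms(1) unfolding sc_map_def by (elim conjE)
  from this[THEN spec, THEN mp, OF assms(2)] obtain G e where "e > 0"
    "\<forall>z\<in>ball (complex_of_real x) e. (G has_field_derivative sc_integrand b u z) (at z)"
    "\<forall>z\<in>ball (complex_of_real x) e. Im z \<ge> 0 \<longrightarrow> F z = G z"
    by (elim exE conjE)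
  thus thesis by (intro that[of e G]) auto
qed

lemma sc_map_real_derivative:
  assumes "sc_map b u F L" "x \<notin> {0, u, 1}"
  shows "((\<lambda>t. F (of_real t)) has_vector_derivative sc_integrand b u (of_real x)) (at x)"
proof -
  obtain G e where e: "e > 0"
    and G: "\<And>z. z \<in> ball (complex_of_real x) e \<Longrightarrow> (G has_field_derivative sc_integrand b u z) (at z)"
    and FG: "\<And>z. z \<in> ball (complex_of_real x) e \<Longrightarrow> Im z \<ge> 0 \<Longrightarrow> F z = G z"
    by (rule sc_map_local[OF assms]) (rule that; assumption)
  have "((\<lambda>t. G (of_real t)) has_vector_derivative sc_integrand b u (of_real x)) (at x)"
    by (rule has_vector_derivative_real_field[OF G]) (use e in auto)
  thus ?thesis
  proof (rule has_vector_derivative_transform_within_open[of _ _ _ "ball x e"])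
    fix y assume "y \<in> ball x e"
    hence "complex_of_real y \<in> ball (of_real x) e" by (simp add: dist_norm flip: of_real_diff)
    thus "G (of_real y) = F (of_real y)" using FG[of "of_real y"] by simp
  qed (use e in auto)
qed

lemma sc_map_locally_injective:
  assumes "sc_map b u F L" "x \<notin> {0, u, 1}"
  obtains e where "e > 0" "inj_on F (ball (of_real x) e \<inter> closed_upper)"
proof -
  obtain G e where e: "e > 0"
    and G: "\<And>z. z \<in> ball (complex_of_real x) e \<Longrightarrow> (G has_field_derivative sc_integrand b u z) (at z)"
    and FG: "\<And>z. z \<in> ball (complex_of_real x) e \<Longrightarrow> Im z \<ge> 0 \<Longrightarrow> F z = G z"
    by (rule sc_map_local[OF assms]) (rule that; assumption)
  let ?B = "ball (complex_of_real x) e"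
  have hol: "G holomorphic_on ?B"
    unfolding holomorphic_on_open[OF open_ball] using G by blast
  have x: "complex_of_real x \<in> ?B" using e by simp
  have "deriv G (of_real x) \<noteq> 0" using DERIV_imp_deriv[OF G[OF x]] by simp
  then obtain r where r: "r > 0" "ball (of_real x) r \<subseteq> ?B" "inj_on G (ball (of_real x) r)"
    using has_complex_derivative_locally_injective[OF hol x open_ball] by blast
  have "inj_on F (ball (of_real x) r \<inter> closed_upper)"
  proof (rule inj_onI)
    fix z w assume zw: "z \<in> ball (of_real x) r \<inter> closed_upper" "w \<in> ball (of_real x) r \<inter> closed_upper" "F z = F w"
    hence "z \<in> ?B" "w \<in> ?B" using r(2) by blast+
    hence "G z = G w" using FG[of z] FG[of w] zw by simp
    thus "z = w" using inj_onD[OF r(3)] zw by blast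
  qed
  thus thesis using r(1) that by blast
qed

lemma straight_curve:
  fixes g :: "real \<Rightarrow> complex"
  assumes ac: "a < c" and cont: "continuous_on {a..c} g" and d: "d \<noteq> 0"
    and deriv: "\<And>x. a < x \<Longrightarrow> x < c \<Longrightarrow> (g has_vector_derivative of_real (w x) * d) (at x)"
    and pos: "\<And>x. a < x \<Longrightarrow> x < c \<Longrightarrow> w x > 0"
  obtains J where "continuous_on {a..c} J" "J a = 0" "strict_mono_on {a..c} J"
    "\<And>x. a \<le> x \<Longrightarrow> x \<le> c \<Longrightarrow> g x = g a + of_real (J x) * d"
    "\<And>x. a < x \<Longrightarrow> x < c \<Longrightarrow> (J has_real_derivative w x) (at x)"
proof -
  \<comment> \<open>Division by the direction makes the derivative real and positive: the imaginary
    part is constant and the real part increases.\<close>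
  define k where "k = (\<lambda>x. (g x - g a) / d)"
  have contk: "continuous_on {a..c} k" unfolding k_def using d by (intro continuous_intros cont) auto
  have dk: "(k has_vector_derivative of_real (w x)) (at x)" if "a < x" "x < c" for x
  proof -
    have "(k has_vector_derivative (of_real (w x) * d - 0) / d) (at x)"
      unfolding k_def
      by (intro has_vector_derivative_divide has_vector_derivative_diff deriv that has_vector_derivative_const)
    thus ?thesis using d by simp
  qed
  have dRe: "((\<lambda>x. Re (k x)) has_real_derivative w x) (at x)" if "a < x" "x < c" for x
    using bounded_linear.has_vector_derivative[OF bounded_linear_Re dk[OF that]]
    by (simp add: has_real_derivative_iff_has_vector_derivative)
  have dIm: "((\<lambda>x. Im (k x)) has_real_derivative 0) (at x)" if "a < x" "x < c" for x
    using bounded_linear.has_vector_derivative[OF bounded_linear_Im dk[OF that]]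
    by (simp add: has_real_derivative_iff_has_vector_derivative)
  have ka: "k a = 0" by (simp add: k_def)
  have Im0: "Im (k x) = 0" if "a \<le> x" "x \<le> c" for x
  proof (cases "x = a")
    case False
    have "Im (k x) = Im (k a)"
    proof (rule DERIV_isconst2[of a c "\<lambda>x. Im (k x)" x])
      show "continuous_on {a..c} (\<lambda>x. Im (k x))" by (intro continuous_intros contk)
    qed (use ac dIm that in auto)
    thus ?thesis using ka by simp
  qed (simp add: ka)
  define J where "J = (\<lambda>x. Re (k x))"
  have contJ: "continuous_on {a..c} J" unfolding J_def by (intro continuous_intros contk)
  show thesis
  proof (rule that[of J])
    show "strict_mono_on {a..c} J"
    proof (rule strict_mono_onI)
      fix x y assume xy: "x \<in> {a..c}" "y \<in> {a..c}" "x < y"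
      show "J x < J y"
      proof (rule DERIV_pos_imp_increasing_open[OF \<open>x < y\<close>])
        show "\<exists>D. (J has_real_derivative D) (at t) \<and> D > 0" if "x < t" "t < y" for t
          using dRe[of t] pos[of t] xy that by (auto simp: J_def)
        show "continuous_on {x..y} J" by (rule continuous_on_subset[OF contJ]) (use xy in auto)
      qed
    qed
    show "g x = g a + of_real (J x) * d" if "a \<le> x" "x \<le> c" for x
    proof -
      have "of_real (J x) = k x" using Im0[OF that] by (simp add: J_def complex_eq_iff)
      thus ?thesis using d by (simp add: k_def)
    qed
    show "(J has_real_derivative w x) (at x)" if "a < x" "x < c" for x
      using dRe[OF that] by (simp add: J_def)
  qed (use contJ ka in \<open>auto simp: J_def\<close>)
qed

lemma straight_segment:
  fixes g :: "real \<Rightarrow> complex"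
  assumes "a < c" "continuous_on {a..c} g" "d \<noteq> 0"
    and "\<And>x. a < x \<Longrightarrow> x < c \<Longrightarrow> (g has_vector_derivative of_real (w x) * d) (at x)"
    and "\<And>x. a < x \<Longrightarrow> x < c \<Longrightarrow> w x > 0"
  obtains l where "l > 0" "g c = g a + of_real l * d" "(w has_integral l) {a..c}"
    "bij_betw g {a<..<c} ((\<lambda>t. g a + of_real t * d) ` {0<..<l})"
proof -
  obtain J where J: "continuous_on {a..c} J" "J a = 0" "strict_mono_on {a..c} J"
    "\<And>x. a \<le> x \<Longrightarrow> x \<le> c \<Longrightarrow> g x = g a + of_real (J x) * d"
    "\<And>x. a < x \<Longrightarrow> x < c \<Longrightarrow> (J has_real_derivative w x) (at x)"
    using straight_curve[OF assms] by blast
  have mono: "J x < J y" if "a \<le> x" "x < y" "y \<le> c" for x y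
    using strict_mono_onD[OF J(3), of x y] that by auto
  have img: "J ` {a<..<c} = {0<..<J c}"
  proof
    show "J ` {a<..<c} \<subseteq> {0<..<J c}" using mono[of a] mono[of _ c] J(2) by auto
    show "{0<..<J c} \<subseteq> J ` {a<..<c}"
    proof
      fix y assume y: "y \<in> {0<..<J c}"
      then obtain x where x: "a \<le> x" "x \<le> c" "J x = y" using IVT'[of J a y c] J(1,2) assms(1) by auto
      moreover have "x \<noteq> a" "x \<noteq> c" using x y J(2) by auto
      ultimately show "y \<in> J ` {a<..<c}" by force
    qed
  qed
  have inj: "inj_on g {a<..<c}"
  proof (rule inj_onI)
    fix x y assume xy: "x \<in> {a<..<c}" "y \<in> {a<..<c}" "g x = g y"
    hence "J x = J y" using J(4)[of x] J(4)[of y] assms(3) by auto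
    thus "x = y" using mono[of x y] mono[of y x] xy by (cases x y rule: linorder_cases) auto
  qed
  have "g ` {a<..<c} = (\<lambda>t. g a + of_real t * d) ` (J ` {a<..<c})"
    unfolding image_image by (rule image_cong[OF refl], rule J(4)) auto
  hence "bij_betw g {a<..<c} ((\<lambda>t. g a + of_real t * d) ` {0<..<J c})"
    using inj img by (simp add: bij_betw_def)
  moreover have "(w has_integral J c - J a) {a..c}"
  proof (rule fundamental_theorem_of_calculus_interior[OF less_imp_le[OF assms(1)] J(1)])
    fix x assume "x \<in> {a<..<c}"
    thus "(J has_vector_derivative w x) (at x)"
      using J(5)[of x] by (simp add: has_real_derivative_iff_has_vector_derivative)
  qed
  moreover have "J c > 0" using mono[of a c] assms(1) J(2) by simp
  moreover have "g c = g a + of_real (J c) * d" using J(4)[of c] assms(1) by simp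
  ultimately show thesis unfolding J(2) by (intro that[of "J c"]) simp_all
qed

text \<open>The length \<open>l\<close> is read off from the limit \<open>L\<close> instead of an
  improper integral; monotonicity of the parameter \<open>J\<close> makes \<open>l\<close> its
  supremum.\<close>

lemma straight_ray:
  fixes g :: "real \<Rightarrow> complex"
  assumes cont: "continuous_on {a..} g" and d: "d \<noteq> 0"
    and deriv: "\<And>x. a < x \<Longrightarrow> (g has_vector_derivative of_real (w x) * d) (at x)"
    and pos: "\<And>x. a < x \<Longrightarrow> w x > 0" and lim: "(g \<longlongrightarrow> L) at_top"
  obtains l where "l > 0" "L = g a + of_real l * d"
    "bij_betw g {a<..} ((\<lambda>t. g a + of_real t * d) ` {0<..<l})"
proof -
  define J where "J = (\<lambda>x. Re ((g x - g a) / d))"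
  define l where "l = Re ((L - g a) / d)"
  have loc: "g x = g a + of_real (J x) * d \<and> (x < y \<longrightarrow> J x < J y)" if "a \<le> x" "x \<le> y" "a < y" for x y
  proof -
    have c: "continuous_on {a..y} g" by (rule continuous_on_subset[OF cont]) auto
    have dv: "(g has_vector_derivative of_real (w t) * d) (at t)" if "a < t" "t < y" for t
      by (rule deriv[OF that(1)])
    have ps: "w t > 0" if "a < t" "t < y" for t by (rule pos[OF that(1)])
    obtain I where I: "strict_mono_on {a..y} I"
      "\<And>x. a \<le> x \<Longrightarrow> x \<le> y \<Longrightarrow> g x = g a + of_real (I x) * d"
      by (rule straight_curve[of a y g d w, OF \<open>a < y\<close> c d dv ps]) (assumption | rule that)+
    have JI: "J t = I t" if "a \<le> t" "t \<le> y" for t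
      using I(2)[OF that] d by (simp add: J_def)
    show ?thesis using JI[of x] JI[of y] I(2)[of x] strict_mono_onD[OF I(1), of x y] that by auto
  qed
  have gJ: "g x = g a + of_real (J x) * d" if "a \<le> x" for x using loc[of x "x + 1"] that by auto
  have mono: "J x < J y" if "a \<le> x" "x < y" for x y using loc[of x y] that by auto
  have Ja: "J a = 0" by (simp add: J_def)
  have limJ: "(J \<longlongrightarrow> l) at_top" unfolding J_def l_def using d by (intro tendsto_intros lim) auto
  have "((\<lambda>x. g a + of_real (J x) * d) \<longlongrightarrow> g a + of_real l * d) at_top" by (intro tendsto_intros limJ)
  moreover have "eventually (\<lambda>x. g a + of_real (J x) * d = g x) at_top"
    using eventually_ge_at_top[of a] by eventually_elim (rule gJ[symmetric])
  ultimately have "(g \<longlongrightarrow> g a + of_real l * d) at_top" by (auto elim: Lim_transform_eventually)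
  hence L: "L = g a + of_real l * d" using lim by (intro tendsto_unique[of at_top g]) auto
  have Jl: "J x < l" if "a \<le> x" for x
  proof -
    have "eventually (\<lambda>y. J (x + 1) \<le> J y) at_top"
      using eventually_gt_at_top[of "x + 1"] by eventually_elim (use mono[of "x + 1"] that in force)
    hence "J (x + 1) \<le> l" by (intro tendsto_lowerbound[OF limJ]) auto
    thus ?thesis using mono[of x "x + 1"] that by simp
  qed
  have contJ: "continuous_on {a..} J" unfolding J_def using d by (intro continuous_intros cont) auto
  have img: "J ` {a<..} = {0<..<l}"
  proof
    show "J ` {a<..} \<subseteq> {0<..<l}" using mono[of a] Jl Ja by auto
    show "{0<..<l} \<subseteq> J ` {a<..}"
    proof
      fix y assume y: "y \<in> {0<..<l}"
      have "eventually (\<lambda>x. y < J x \<and> x > a) at_top"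
        using order_tendstoD(1)[OF limJ, of y] y eventually_gt_at_top[of a] by (auto intro: eventually_conj)
      then obtain c where c: "y < J c" "c > a" by (auto dest: eventually_happens'[OF trivial_limit_at_top_linorder])
      have "continuous_on {a..c} J" by (rule continuous_on_subset[OF contJ]) auto
      then obtain x where x: "a \<le> x" "x \<le> c" "J x = y" using IVT'[of J a y c] Ja c y by auto
      moreover have "x \<noteq> a" using x y Ja by auto
      ultimately show "y \<in> J ` {a<..}" by force
    qed
  qed
  have inj: "inj_on g {a<..}"
  proof (rule inj_onI)
    fix x y assume xy: "x \<in> {a<..}" "y \<in> {a<..}" "g x = g y"
    hence "J x = J y" using gJ[of x] gJ[of y] d by auto
    thus "x = y" using mono[of x y] mono[of y x] xy by (cases x y rule: linorder_cases) auto
  qed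
  have "g ` {a<..} = (\<lambda>t. g a + of_real t * d) ` (J ` {a<..})"
    unfolding image_image by (rule image_cong[OF refl], rule gJ) auto
  hence "bij_betw g {a<..} ((\<lambda>t. g a + of_real t * d) ` {0<..<l})"
    using inj img by (simp add: bij_betw_def)
  moreover have "l > 0" using Jl[of a] Ja by simp
  ultimately show thesis using L that by blast
qed

section \<open>The parallelogram and the triangle\<close>

lemma omega_eq: "omega = Complex (1/2) (sqrt 3 / 2)"
  using cis_conv_exp[of "pi/3"] by (simp add: omega_def complex_eq_iff cos_60 sin_60 flip: cis_conv_exp)

text \<open>Coordinates with respect to the real basis \<open>1, omega\<close> of the complex plane.\<close>

definition cx :: "complex \<Rightarrow> real" where "cx z = Re z - Im z / sqrt 3"
definition cy :: "complex \<Rightarrow> real" where "cy z = 2 * Im z / sqrt 3"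

lemma cx_cy_simps [simp]:
  "cx (z + w) = cx z + cx w" "cy (z + w) = cy z + cy w"
  "cx (z - w) = cx z - cx w" "cy (z - w) = cy z - cy w"
  "cx (- z) = - cx z" "cy (- z) = - cy z"
  "cx (of_real t * z) = t * cx z" "cy (of_real t * z) = t * cy z"
  "cx (z * of_real t) = t * cx z" "cy (z * of_real t) = t * cy z"
  "cx (of_real t) = t" "cy (of_real t) = 0" "cx 0 = 0" "cy 0 = 0" "cx 1 = 1" "cy 1 = 0"
  "cx omega = 0" "cy omega = 1"
  by (simp_all add: cx_def cy_def omega_eq field_simps)

lemma coords_eq: "z = of_real (cx z) + of_real (cy z) * omega"
  by (simp add: complex_eq_iff cx_def cy_def omega_eq)

lemma coords_eqI: "cx z = cx w \<Longrightarrow> cy z = cy w \<Longrightarrow> z = w"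
  using coords_eq[of z] coords_eq[of w] by simp

lemma linear_cx: "linear cx" and linear_cy: "linear cy"
  by (auto intro!: linearI simp: scaleR_conv_of_real)

lemma continuous_on_cx [continuous_intros]: "continuous_on S f \<Longrightarrow> continuous_on S (\<lambda>x. cx (f x))"
  and continuous_on_cy [continuous_intros]: "continuous_on S f \<Longrightarrow> continuous_on S (\<lambda>x. cy (f x))"
  unfolding cx_def cy_def by (intro continuous_intros; simp)+

lemma norm_omega: "norm omega = 1"
  by (simp add: omega_def norm_exp_imaginary)

lemma parallelogram_coords:
  assumes r: "r > 0"
  shows "parallelogram r = {z. 0 \<le> cx z \<and> cx z \<le> r \<and> 0 \<le> cy z \<and> cy z \<le> 1}"
proof
  have "{z. 0 \<le> cx z \<and> cx z \<le> r \<and> 0 \<le> cy z \<and> cy z \<le> 1} = cx -` {0..r} \<inter> cy -` {0..1}" by auto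
  hence "convex {z. 0 \<le> cx z \<and> cx z \<le> r \<and> 0 \<le> cy z \<and> cy z \<le> 1}"
    by (simp add: convex_Int convex_linear_vimage linear_cx linear_cy)
  thus "parallelogram r \<subseteq> {z. 0 \<le> cx z \<and> cx z \<le> r \<and> 0 \<le> cy z \<and> cy z \<le> 1}"
    unfolding parallelogram_def by (intro hull_minimal) (use r in auto)
  show "{z. 0 \<le> cx z \<and> cx z \<le> r \<and> 0 \<le> cy z \<and> cy z \<le> 1} \<subseteq> parallelogram r"
  proof
    fix z assume z: "z \<in> {z. 0 \<le> cx z \<and> cx z \<le> r \<and> 0 \<le> cy z \<and> cy z \<le> 1}"
    define s where "s = cx z / r"
    have s: "0 \<le> s" "s \<le> 1" "s * r = cx z" using z r by (auto simp: s_def)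
    have conv: "convex (parallelogram r)" by (simp add: parallelogram_def convex_convex_hull)
    have v: "0 \<in> parallelogram r" "of_real r \<in> parallelogram r" "of_real r + omega \<in> parallelogram r" "omega \<in> parallelogram r"
      unfolding parallelogram_def by (auto intro: hull_inc)
    \<comment> \<open>These two points divide the bottom and the top side in the same ratio;
      \<open>z\<close> lies on the segment between them.\<close>
    have p: "(1 - s) *\<^sub>R 0 + s *\<^sub>R of_real r \<in> parallelogram r" "(1 - s) *\<^sub>R omega + s *\<^sub>R (of_real r + omega) \<in> parallelogram r"
      using s by (intro convexD[OF conv] v; simp)+
    have "(1 - cy z) *\<^sub>R ((1 - s) *\<^sub>R 0 + s *\<^sub>R of_real r) + cy z *\<^sub>R ((1 - s) *\<^sub>R omega + s *\<^sub>R (of_real r + omega)) \<in> parallelogram r"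
      using z by (intro convexD[OF conv] p) auto
    also have "(1 - cy z) *\<^sub>R ((1 - s) *\<^sub>R 0 + s *\<^sub>R of_real r) + cy z *\<^sub>R ((1 - s) *\<^sub>R omega + s *\<^sub>R (of_real r + omega)) = z"
      by (rule coords_eqI) (use s in \<open>auto simp: scaleR_conv_of_real algebra_simps\<close>)
    finally show "z \<in> parallelogram r" .
  qed
qed

lemma triangle_coords: "triangle = {z. 0 \<le> cx z \<and> 0 \<le> cy z \<and> cx z + cy z \<le> 1}"
proof
  have "{z. 0 \<le> cx z \<and> 0 \<le> cy z \<and> cx z + cy z \<le> 1} = cx -` {0..} \<inter> cy -` {0..} \<inter> (\<lambda>z. cx z + cy z) -` {..1}" by auto
  moreover have "linear (\<lambda>z. cx z + cy z)" by (intro linear_compose_add linear_cx linear_cy)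
  ultimately have "convex {z. 0 \<le> cx z \<and> 0 \<le> cy z \<and> cx z + cy z \<le> 1}"
    by (simp add: convex_Int convex_linear_vimage linear_cx linear_cy)
  thus "triangle \<subseteq> {z. 0 \<le> cx z \<and> 0 \<le> cy z \<and> cx z + cy z \<le> 1}"
    unfolding triangle_def by (intro hull_minimal) auto
  show "{z. 0 \<le> cx z \<and> 0 \<le> cy z \<and> cx z + cy z \<le> 1} \<subseteq> triangle"
  proof
    fix z assume z: "z \<in> {z. 0 \<le> cx z \<and> 0 \<le> cy z \<and> cx z + cy z \<le> 1}"
    have "z = (1 - cx z - cy z) *\<^sub>R 0 + cx z *\<^sub>R 1 + cy z *\<^sub>R omega"
      by (rule coords_eqI) (simp_all add: scaleR_conv_of_real)
    thus "z \<in> triangle" unfolding triangle_def convex_hull_3 using z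
      by (intro CollectI exI[of _ "1 - cx z - cy z"] exI[of _ "cx z"] exI[of _ "cy z"]) auto
  qed
qed

text \<open>Room to move in both coordinate directions and both senses turns each weak inequality
  describing a polygon into a strict one.\<close>

lemma interior_pushE:
  assumes "z \<in> interior P"
  obtains e where "e > 0" "z + of_real e \<in> P" "z - of_real e \<in> P" "z + of_real e * omega \<in> P" "z - of_real e * omega \<in> P"
proof -
  obtain d where d: "d > 0" "ball z d \<subseteq> P" using assms by (auto simp: mem_interior)
  show thesis
    by (rule that[of "d / 2"]) (use d in \<open>auto simp: subset_iff dist_norm norm_mult norm_omega\<close>)
qed

lemma interior_parallelogram:
  assumes r: "r > 0"
  shows "interior (parallelogram r) = {z. 0 < cx z \<and> cx z < r \<and> 0 < cy z \<and> cy z < 1}"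
proof
  show "interior (parallelogram r) \<subseteq> {z. 0 < cx z \<and> cx z < r \<and> 0 < cy z \<and> cy z < 1}"
  proof
    fix z assume "z \<in> interior (parallelogram r)"
    then obtain e where e: "e > 0" "z + of_real e \<in> parallelogram r" "z - of_real e \<in> parallelogram r"
      "z + of_real e * omega \<in> parallelogram r" "z - of_real e * omega \<in> parallelogram r" by (rule interior_pushE)
    thus "z \<in> {z. 0 < cx z \<and> cx z < r \<and> 0 < cy z \<and> cy z < 1}" unfolding parallelogram_coords[OF r] by auto
  qed
  have "open {z. 0 < cx z \<and> cx z < r \<and> 0 < cy z \<and> cy z < 1}"
    by (intro open_Collect_conj open_Collect_less continuous_intros)
  thus "{z. 0 < cx z \<and> cx z < r \<and> 0 < cy z \<and> cy z < 1} \<subseteq> interior (parallelogram r)"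
    by (intro interior_maximal) (auto simp: parallelogram_coords[OF r])
qed

lemma interior_triangle: "interior triangle = {z. 0 < cx z \<and> 0 < cy z \<and> cx z + cy z < 1}"
proof
  show "interior triangle \<subseteq> {z. 0 < cx z \<and> 0 < cy z \<and> cx z + cy z < 1}"
  proof
    fix z assume "z \<in> interior triangle"
    then obtain e where e: "e > 0" "z + of_real e \<in> triangle" "z - of_real e \<in> triangle"
      "z + of_real e * omega \<in> triangle" "z - of_real e * omega \<in> triangle" by (rule interior_pushE)
    thus "z \<in> {z. 0 < cx z \<and> 0 < cy z \<and> cx z + cy z < 1}" unfolding triangle_coords by auto
  qed
  have "open {z. 0 < cx z \<and> 0 < cy z \<and> cx z + cy z < 1}"
    by (intro open_Collect_conj open_Collect_less continuous_intros)
  thus "{z. 0 < cx z \<and> 0 < cy z \<and> cx z + cy z < 1} \<subseteq> interior triangle"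
    by (intro interior_maximal) (auto simp: triangle_coords)
qed

lemma compact_convex_polygons:
  "compact (parallelogram r)" "convex (parallelogram r)" "compact triangle" "convex triangle"
  by (auto simp: parallelogram_def triangle_def convex_convex_hull intro!: finite_imp_compact_convex_hull)

lemma frontier_parallelogram:
  "frontier (parallelogram r) = parallelogram r - interior (parallelogram r)"
  using compact_imp_closed[OF compact_convex_polygons(1)] by (simp add: frontier_def)

lemma frontier_triangle: "frontier triangle = triangle - interior triangle"
  using compact_imp_closed[OF compact_convex_polygons(3)] by (simp add: frontier_def)

section \<open>Assembling the boundary from its edges\<close>

lemma bij_betw_real_line:
  fixes E :: "real \<Rightarrow> complex"
  assumes u: "0 < u" "u < 1"
    and bij: "bij_betw E {..<0} A0" "bij_betw E {0<..<u} A1" "bij_betw E {u<..<1} A2" "bij_betw E {1<..} A3"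
    and disj: "E 0 \<notin> A0" "(A0 \<union> {E 0}) \<inter> A1 = {}" "E u \<notin> A0 \<union> {E 0} \<union> A1"
      "(A0 \<union> {E 0} \<union> A1 \<union> {E u}) \<inter> A2 = {}" "E 1 \<notin> A0 \<union> {E 0} \<union> A1 \<union> {E u} \<union> A2"
      "(A0 \<union> {E 0} \<union> A1 \<union> {E u} \<union> A2 \<union> {E 1}) \<inter> A3 = {}"
  shows "bij_betw E UNIV (A0 \<union> {E 0} \<union> A1 \<union> {E u} \<union> A2 \<union> {E 1} \<union> A3)"
proof -
  have pt: "bij_betw E {x} {E x}" for x by (simp add: bij_betw_def)
  have "bij_betw E ({..<0} \<union> {0} \<union> {0<..<u} \<union> {u} \<union> {u<..<1} \<union> {1} \<union> {1<..})
      (A0 \<union> {E 0} \<union> A1 \<union> {E u} \<union> A2 \<union> {E 1} \<union> A3)"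
    by (intro bij_betw_combine bij pt) (use disj in auto)
  moreover have "{..<0} \<union> {0} \<union> {0<..<u} \<union> {u} \<union> {u<..<1} \<union> {1} \<union> {1<..} = (UNIV :: real set)"
    using u by auto
  ultimately show ?thesis by simp
qed

text \<open>Each direction is the constant argument of the integrand on its interval, rotated by
  that of \<open>\<kappa>\<close>. The side over the negative axis is described starting from 0,
  against the orientation of the line, hence the minus sign in the condition on \<open>d4\<close>.
  For the two sides meeting at infinity no integral is recorded.\<close>

lemma sc_map_edges:
  assumes F: "sc_map b u F L" and u: "0 < u" "u < 1" and s: "s > 0"
    and d: "d1 \<noteq> 0" "d2 \<noteq> 0" "d3 \<noteq> 0" "d4 \<noteq> 0"
    and dir: "\<kappa> * cis (- pi * (b + 2/3)) = of_real s * d1" "\<kappa> * cis (- pi * (2/3)) = of_real s * d2"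
      "\<kappa> = of_real s * d3" "\<kappa> * cis (- pi * (4/3 + b)) = - of_real s * d4"
  defines "E \<equiv> \<lambda>x. \<kappa> * F (complex_of_real x)"
  obtains l1 l2 l3 l4 where "l1 > 0" "l2 > 0" "l3 > 0" "l4 > 0" "E 0 = 0"
    "E u = of_real l1 * d1" "E 1 = E u + of_real l2 * d2" "\<kappa> * L = E 1 + of_real l3 * d3" "\<kappa> * L = of_real l4 * d4"
    "((\<lambda>x. s * sc_weight b u x) has_integral l1) {0..u}" "((\<lambda>x. s * sc_weight b u x) has_integral l2) {u..1}"
    "bij_betw E {0<..<u} ((\<lambda>t. of_real t * d1) ` {0<..<l1})"
    "bij_betw E {u<..<1} ((\<lambda>t. E u + of_real t * d2) ` {0<..<l2})"
    "bij_betw E {1<..} ((\<lambda>t. E 1 + of_real t * d3) ` {0<..<l3})"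
    "bij_betw E {..<0} ((\<lambda>t. of_real t * d4) ` {0<..<l4})"
proof -
  let ?w = "\<lambda>x. s * sc_weight b u x"
  have contF: "continuous_on closed_upper F" and F0: "F 0 = 0" using F by (auto simp: sc_map_def)
  have contE: "continuous_on A E" for A
    unfolding E_def by (intro continuous_intros continuous_on_compose2[OF contF]) auto
  have E0: "E 0 = 0" by (simp add: E_def F0)
  have dE: "(E has_vector_derivative \<kappa> * sc_integrand b u (of_real x)) (at x)" if "x \<notin> {0, u, 1}" for x
    unfolding E_def by (intro has_vector_derivative_mult_right sc_map_real_derivative[OF F that])
  have wpos: "?w x > 0" if "x \<notin> {0, u, 1}" for x using sc_weight_pos[of x u b] s that by simp
  have d1: "(E has_vector_derivative of_real (?w x) * d1) (at x)" if "0 < x" "x < u" for x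
  proof -
    have "\<kappa> * sc_integrand b u (of_real x) = of_real (sc_weight b u x) * (\<kappa> * cis (- pi * (b + 2/3)))"
      using sc_integrand_of_real[of x u b] that u by (simp add: add.commute mult.left_commute)
    thus ?thesis using dE[of x] that u unfolding dir(1) by (simp add: mult_ac)
  qed
  have d2: "(E has_vector_derivative of_real (?w x) * d2) (at x)" if "u < x" "x < 1" for x
  proof -
    have "\<kappa> * sc_integrand b u (of_real x) = of_real (sc_weight b u x) * (\<kappa> * cis (- pi * (2/3)))"
      using sc_integrand_of_real[of x u b] that u by (simp add: add.commute mult.left_commute)
    thus ?thesis using dE[of x] that u unfolding dir(2) by (simp add: mult_ac)
  qed
  have d3: "(E has_vector_derivative of_real (?w x) * d3) (at x)" if "1 < x" for x
  proof -
    have "\<kappa> * sc_integrand b u (of_real x) = of_real (sc_weight b u x) * \<kappa>"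
      using sc_integrand_of_real[of x u b] that u by (simp add: mult.commute)
    also have "\<dots> = of_real (?w x) * d3" by (simp add: dir(3))
    finally have eq: "\<kappa> * sc_integrand b u (of_real x) = of_real (?w x) * d3" .
    have "x \<notin> {0, u, 1}" using that u by auto
    from dE[OF this] show ?thesis unfolding eq .
  qed
  have d4: "((\<lambda>x. E (- x)) has_vector_derivative of_real (?w (- x)) * d4) (at x)" if "0 < x" for x
  proof -
    have "(E has_vector_derivative - of_real (?w (- x)) * d4) (at (- x))"
    proof -
      have "\<kappa> * sc_integrand b u (of_real (- x)) = of_real (sc_weight b u (- x)) * (\<kappa> * cis (- pi * (4/3 + b)))"
        using sc_integrand_of_real[of "- x" u b] that u by (simp add: add.commute mult.left_commute)
      thus ?thesis using dE[of "- x"] that u unfolding dir(4) by (simp add: mult_ac)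
    qed
    moreover have "(uminus has_vector_derivative - 1) (at x)"
      by (auto intro!: derivative_eq_intros)
    ultimately have "(E \<circ> uminus has_vector_derivative (- 1) *\<^sub>R (- of_real (?w (- x)) * d4)) (at x)"
      by (intro vector_diff_chain_at)
    thus ?thesis by (simp add: o_def)
  qed
  have far: "\<exists>B. \<forall>z. Im z \<ge> 0 \<and> norm z > B \<longrightarrow> dist (F z) L < e" if "e > 0" for e
    using F that unfolding sc_map_def by (elim conjE) blast
  have lim: "((\<lambda>x. F (of_real (c * x))) \<longlongrightarrow> L) at_top" if c: "\<bar>c\<bar> = 1" for c
  proof (rule tendstoI)
    fix e :: real assume "e > 0"
    then obtain B where B: "\<And>z. Im z \<ge> 0 \<Longrightarrow> norm z > B \<Longrightarrow> dist (F z) L < e" using far by blast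
    have "eventually (\<lambda>x. x > max B 0) at_top" by (rule eventually_gt_at_top)
    thus "eventually (\<lambda>x. dist (F (of_real (c * x))) L < e) at_top"
    proof eventually_elim
      case (elim x)
      thus ?case using B[of "of_real (c * x)"] c by (simp add: norm_mult abs_mult del: of_real_mult)
    qed
  qed
  have limE: "(E \<longlongrightarrow> \<kappa> * L) at_top" "((\<lambda>x. E (- x)) \<longlongrightarrow> \<kappa> * L) at_top"
    using tendsto_mult_left[OF lim[of 1], of \<kappa>] tendsto_mult_left[OF lim[of "- 1"], of \<kappa>] by (simp_all add: E_def)
  obtain l1 where l1: "l1 > 0" "E u = E 0 + of_real l1 * d1" "(?w has_integral l1) {0..u}"
      "bij_betw E {0<..<u} ((\<lambda>t. E 0 + of_real t * d1) ` {0<..<l1})"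
    by (rule straight_segment[of 0 u E d1 ?w, OF u(1) contE d(1) d1]) (use wpos u in auto)
  obtain l2 where l2: "l2 > 0" "E 1 = E u + of_real l2 * d2" "(?w has_integral l2) {u..1}"
      "bij_betw E {u<..<1} ((\<lambda>t. E u + of_real t * d2) ` {0<..<l2})"
    by (rule straight_segment[of u 1 E d2 ?w, OF u(2) contE d(2) d2]) (use wpos u in auto)
  obtain l3 where l3: "l3 > 0" "\<kappa> * L = E 1 + of_real l3 * d3"
      "bij_betw E {1<..} ((\<lambda>t. E 1 + of_real t * d3) ` {0<..<l3})"
    by (rule straight_ray[of 1 E d3 ?w "\<kappa> * L", OF contE d(3) d3 _ limE(1)]) (use wpos u in auto)
  have contE': "continuous_on {0..} (\<lambda>x. E (- x))"
    by (rule continuous_on_compose2[OF contE[of UNIV]]) (auto intro!: continuous_intros)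
  obtain l4 where l4: "l4 > 0" "\<kappa> * L = E (- 0) + of_real l4 * d4"
      "bij_betw (\<lambda>x. E (- x)) {0<..} ((\<lambda>t. E (- 0) + of_real t * d4) ` {0<..<l4})"
    by (rule straight_ray[of 0 "\<lambda>x. E (- x)" d4 "\<lambda>x. ?w (- x)" "\<kappa> * L", OF contE' d(4) d4 _ limE(2)]) (use wpos u in auto)
  have "bij_betw uminus {..<0::real} {0<..}"
    by (rule bij_betwI[where g = uminus]) auto
  from bij_betw_trans[OF this l4(3)] have "bij_betw E {..<0} ((\<lambda>t. of_real t * d4) ` {0<..<l4})"
    by (simp add: o_def E0)
  thus thesis using l1 l2 l3 l4 E0 by (intro that[of l1 l2 l3 l4]) simp_all
qed

lemma half_plane_chart_of_sc_map:
  assumes F: "sc_map b u F L" and u: "0 < u" "u < 1" and \<kappa>: "\<kappa> \<noteq> 0"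
    and P: "compact P" "convex P" "interior P \<noteq> {}"
    and bdry: "bij_betw (\<lambda>x. \<kappa> * F (complex_of_real x)) UNIV (frontier P - {\<kappa> * L})" "\<kappa> * L \<in> frontier P"
  shows "half_plane_chart (case_option (\<kappa> * L) (\<lambda>z. \<kappa> * F z)) P"
proof -
  have contF: "continuous_on closed_upper F"
    and dF: "\<And>z. Im z > 0 \<Longrightarrow> (F has_field_derivative sc_integrand b u z) (at z)"
    using F by (auto simp: sc_map_def)
  have far: "\<exists>B. \<forall>z. Im z \<ge> 0 \<and> norm z > B \<longrightarrow> dist (F z) L < e" if "e > 0" for e
    using F that unfolding sc_map_def by (elim conjE) blast
  have dG: "((\<lambda>z. \<kappa> * F z) has_field_derivative \<kappa> * sc_integrand b u z) (at z)" if "Im z > 0" for z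
    by (rule DERIV_cmult[OF dF[OF that]])
  \<comment> \<open>The point 2 is a convenient real point to the right of all prevertices.\<close>
  obtain e0 where e0: "e0 > 0" "inj_on F (ball (of_real 2) e0 \<inter> closed_upper)"
    by (rule sc_map_locally_injective[OF F, of 2]) (use u in auto)
  show ?thesis
  proof (rule half_plane_chartI[OF _ _ _ _ P _ bdry(2), of _ "of_real 2" e0])
    show "continuous_on closed_upper (\<lambda>z. \<kappa> * F z)" by (intro continuous_intros contF)
    show "(\<lambda>z. \<kappa> * F z) holomorphic_on upper_half_plane"
      unfolding holomorphic_on_open[OF open_upper] using dG by blast
    show "deriv (\<lambda>z. \<kappa> * F z) z \<noteq> 0" if "Im z > 0" for z
      using DERIV_imp_deriv[OF dG[OF that]] \<kappa> by simp
    show "\<exists>B. \<forall>z. Im z \<ge> 0 \<and> norm z > B \<longrightarrow> dist (\<kappa> * F z) (\<kappa> * L) < e" if e: "e > 0" for e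
    proof -
      have "e / norm \<kappa> > 0" using e \<kappa> by simp
      from far[OF this] obtain B where B: "\<And>z. Im z \<ge> 0 \<Longrightarrow> norm z > B \<Longrightarrow> dist (F z) L < e / norm \<kappa>" by blast
      have "dist (\<kappa> * F z) (\<kappa> * L) < e" if "Im z \<ge> 0" "norm z > B" for z
      proof -
        have "dist (\<kappa> * F z) (\<kappa> * L) = norm \<kappa> * dist (F z) L"
          by (simp add: dist_norm norm_mult flip: right_diff_distrib)
        also have "\<dots> < norm \<kappa> * (e / norm \<kappa>)" using B[OF that] \<kappa> by (intro mult_strict_left_mono) auto
        finally show ?thesis using \<kappa> by simp
      qed
      thus ?thesis by blast
    qed
    have 2: "bij_betw Re {z. Im z = 0} UNIV"
      by (rule bij_betwI[where g = complex_of_real]) (auto simp: complex_eq_iff)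
    have "bij_betw ((\<lambda>x. \<kappa> * F (complex_of_real x)) \<circ> Re) {z. Im z = 0} (frontier P - {\<kappa> * L})"
      by (rule bij_betw_trans[OF 2 bdry(1)])
    moreover have "((\<lambda>x. \<kappa> * F (complex_of_real x)) \<circ> Re) z = \<kappa> * F z" if "z \<in> {z. Im z = 0}" for z
    proof -
      have "complex_of_real (Re z) = z" using that by (simp add: complex_eq_iff)
      thus ?thesis by simp
    qed
    ultimately show "bij_betw (\<lambda>z. \<kappa> * F z) {z. Im z = 0} (frontier P - {\<kappa> * L})"
      using bij_betw_cong[of "{z. Im z = 0}" "(\<lambda>x. \<kappa> * F (complex_of_real x)) \<circ> Re" "\<lambda>z. \<kappa> * F z"] by blast
    show "inj_on (\<lambda>z. \<kappa> * F z) (ball (of_real 2) e0 \<inter> closed_upper)"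
      using e0(2) \<kappa> by (auto simp: inj_on_def)
  qed (use e0 in auto)
qed

text \<open>The substitutions x = u t and x = 1 - v t, with v = 1 - u, lead to Euler's integral. The
  exponents 2/3 and 1/3 at the two endpoints add up to 1, so the scale factor of the weight cancels
  that of dx and no power of u or v is left.\<close>

lemma sc_weight_integrals:
  assumes u: "0 < u" "u < 1"
  shows "(sc_weight (1/3) u has_integral Beta (1/3) (2/3) * cubic_F u) {0..u}"
    and "(sc_weight (1/3) u has_integral Beta (1/3) (2/3) * cubic_F (1 - u)) {u..1}"
proof -
  define f where "f = (\<lambda>c t::real. t powr (-2/3) * (1 - t) powr (-1/3) * (1 - c * t) powr (-2/3))"
  have eul: "(f c has_integral Beta (1/3) (2/3) * cubic_F c) {0..1}" if "0 \<le> c" "c < 1" for c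
    unfolding f_def by (rule cubic_F_euler_integral[OF that])
  have scale: "(x / c) powr (-2/3) * (y / c) powr (-1/3) = c * (x powr (-2/3) * y powr (-1/3))"
    if "c > 0" "x \<ge> 0" "y \<ge> 0" for c x y :: real
  proof -
    have "c powr (-2/3) * c powr (-1/3) = c powr (- 1)" by (simp only: powr_add[symmetric]) simp
    hence "c powr (-2/3) * c powr (-1/3) = 1 / c" using that by (simp add: powr_minus inverse_eq_divide)
    hence "1 / (c powr (-2/3) * c powr (-1/3)) = c" by simp
    thus ?thesis using that by (simp add: powr_divide field_simps)
  qed
  have "((\<lambda>x. f u (x / u)) has_integral Beta (1/3) (2/3) * cubic_F u * u) {0..u}"
  proof -
    have "(f u has_integral Beta (1/3) (2/3) * cubic_F u) (cbox 0 1)" using eul[of u] u by simp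
    hence "((\<lambda>x. f u ((1/u) *\<^sub>R x + 0)) has_integral (Beta (1/3) (2/3) * cubic_F u) /\<^sub>R (1/u) ^ DIM(real))
        (cbox ((0 - 0) /\<^sub>R (1/u)) ((1 - 0) /\<^sub>R (1/u)))"
      by (rule has_integral_affinity') (use u in simp)
    moreover have "(1/u) *\<^sub>R x + 0 = x / u" for x by simp
    moreover have "(0 - 0 :: real) /\<^sub>R (1/u) = 0" "(1 - 0) /\<^sub>R (1/u) = u"
      "(Beta (1/3) (2/3) * cubic_F u) /\<^sub>R (1/u) ^ DIM(real) = Beta (1/3) (2/3) * cubic_F u * u"
      using u by simp_all
    ultimately show ?thesis by (simp only: cbox_interval)
  qed
  hence "((\<lambda>x. (1 / u) * f u (x / u)) has_integral (1 / u) * (Beta (1/3) (2/3) * cubic_F u * u)) {0..u}"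
    by (rule has_integral_mult_right)
  hence "((\<lambda>x. (1 / u) * f u (x / u)) has_integral Beta (1/3) (2/3) * cubic_F u) {0..u}" using u by simp
  thus "(sc_weight (1/3) u has_integral Beta (1/3) (2/3) * cubic_F u) {0..u}"
  proof (rule has_integral_eq[rotated])
    fix x assume x: "x \<in> {0..u}"
    have "f u (x / u) = ((x / u) powr (-2/3) * ((u - x) / u) powr (-1/3)) * (1 - x) powr (-2/3)"
      using u by (simp add: f_def diff_divide_distrib)
    also have "\<dots> = u * (x powr (-2/3) * (u - x) powr (-1/3)) * (1 - x) powr (-2/3)"
      by (subst scale) (use x u in auto)
    finally have "f u (x / u) = u * (x powr (-2/3) * (u - x) powr (-1/3)) * (1 - x) powr (-2/3)" .
    moreover have "\<bar>x\<bar> = x" "\<bar>x - u\<bar> = u - x" "\<bar>x - 1\<bar> = 1 - x" using x u by auto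
    ultimately show "(1 / u) * f u (x / u) = sc_weight (1/3) u x"
      using u by (simp add: sc_weight_def)
  qed
  define v where "v = 1 - u"
  have v: "0 < v" "v < 1" using u by (auto simp: v_def)
  have "((\<lambda>x. f v (- x)) has_integral Beta (1/3) (2/3) * cubic_F v) {- 1..- 0}"
    using eul[of v] v by (subst has_integral_reflect_real) auto
  hence "((\<lambda>x. f v (- x)) has_integral Beta (1/3) (2/3) * cubic_F v) (cbox (- 1) (- 0))" by simp
  hence "((\<lambda>x. f v (- ((1/v) *\<^sub>R x + (- 1/v)))) has_integral (Beta (1/3) (2/3) * cubic_F v) /\<^sub>R (1/v) ^ DIM(real))
      (cbox ((- 1 - (- 1/v)) /\<^sub>R (1/v)) ((- 0 - (- 1/v)) /\<^sub>R (1/v)))"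
    by (rule has_integral_affinity') (use v in simp)
  moreover have "- ((1/v) *\<^sub>R x + (- 1/v)) = (1 - x) / v" for x by (simp add: diff_divide_distrib)
  moreover have "(- 1 - (- 1/v)) /\<^sub>R (1/v) = u" "(- 0 - (- 1/v)) /\<^sub>R (1/v) = 1"
    "(Beta (1/3) (2/3) * cubic_F v) /\<^sub>R (1/v) ^ DIM(real) = Beta (1/3) (2/3) * cubic_F v * v"
    using v by (simp_all add: field_simps v_def)
  ultimately have "((\<lambda>x. f v ((1 - x) / v)) has_integral Beta (1/3) (2/3) * cubic_F v * v) {u..1}"
    by (simp only: cbox_interval)
  hence "((\<lambda>x. (1 / v) * f v ((1 - x) / v)) has_integral (1 / v) * (Beta (1/3) (2/3) * cubic_F v * v)) {u..1}"
    by (rule has_integral_mult_right)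
  hence "((\<lambda>x. (1 / v) * f v ((1 - x) / v)) has_integral Beta (1/3) (2/3) * cubic_F (1 - u)) {u..1}"
    using v by (simp add: v_def)
  thus "(sc_weight (1/3) u has_integral Beta (1/3) (2/3) * cubic_F (1 - u)) {u..1}"
  proof (rule has_integral_eq[rotated])
    fix x assume x: "x \<in> {u..1}"
    have "1 - (1 - x) / v = (x - u) / v" using v by (simp add: field_simps v_def)
    hence "f v ((1 - x) / v) = (((1 - x) / v) powr (-2/3) * ((x - u) / v) powr (-1/3)) * x powr (-2/3)"
      using v by (simp add: f_def)
    also have "\<dots> = v * ((1 - x) powr (-2/3) * (x - u) powr (-1/3)) * x powr (-2/3)"
      by (subst scale) (use x v in auto)
    finally have "f v ((1 - x) / v) = v * ((1 - x) powr (-2/3) * (x - u) powr (-1/3)) * x powr (-2/3)" .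
    moreover have "\<bar>x\<bar> = x" "\<bar>x - u\<bar> = x - u" "\<bar>x - 1\<bar> = 1 - x" using x u by auto
    ultimately show "(1 / v) * f v ((1 - x) / v) = sc_weight (1/3) u x"
      using v by (simp add: sc_weight_def mult_ac)
  qed
qed

section \<open>Charts of the parallelogram and of the triangle\<close>

lemma omega_cis: "omega = cis (pi / 3)"
  by (simp add: omega_def cis_conv_exp)

lemma cis_values: "cis (2 * pi / 3) = omega - 1" "cis (- (2 * pi / 3)) = - omega" "cis (- (5 * pi / 3)) = omega"
proof -
  show "cis (2 * pi / 3) = omega - 1" by (simp add: complex_eq_iff omega_eq cos_120 sin_120)
  show "cis (- (2 * pi / 3)) = - omega" by (simp add: complex_eq_iff omega_eq cos_120 sin_120)
  have "cis (- (5 * pi / 3)) = cis (pi / 3) * cis (- (2 * pi))" by (simp add: cis_mult)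
  also have "cis (- (2 * pi)) = 1" by (simp add: complex_eq_iff)
  finally show "cis (- (5 * pi / 3)) = omega" by (simp add: omega_cis)
qed

lemma image_eq_of_section:
  assumes "\<And>t. t \<in> T \<Longrightarrow> f t \<in> A" "\<And>z. z \<in> A \<Longrightarrow> g z \<in> T \<and> f (g z) = z"
  shows "f ` T = A"
  using assms by (force simp: image_iff)

lemma singleton_coords: "{p} = {z. cx z = cx p \<and> cy z = cy p}"
  by (auto intro: coords_eqI)

lemma parallelogram_chart:
  assumes u: "0 < u" "u < 1" and r: "r > 0" and ratio: "cubic_F u / cubic_F (1 - u) = r"
  obtains f where "half_plane_chart f (parallelogram r)" "f None = omega" "f (Some 0) = 0"
    "f (Some (of_real u)) = of_real r" "f (Some 1) = of_real r + omega"
proof -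
  define B where "B = Beta (1/3) (2/3 :: real)"
  have B: "B > 0" by (simp add: B_def Beta_def Gamma_real_pos)
  have F: "cubic_F (1 - u) > 0" using cubic_F_ge_1[of "1 - u"] u by simp
  \<comment> \<open>Before scaling, the side over the interval from u to 1 has length B F(1 - u); it
    is normalised to 1, and the ratio hypothesis gives the side over the interval from 0 to u the
    length r.\<close>
  define s where "s = 1 / (B * cubic_F (1 - u))"
  have s: "s > 0" using B F by (simp add: s_def)
  obtain F L where sc: "sc_map (1/3) u F L" using sc_map_exists[OF u, of "1/3"] by auto
  \<comment> \<open>For b = 1/3 the integrand has argument -pi between 0 and u; the minus sign turns
    this edge onto the positive real axis.\<close>
  define \<kappa> where "\<kappa> = - complex_of_real s"
  have om: "omega \<noteq> 0" by (simp add: omega_def)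
  have dir: "\<kappa> * cis (- pi * (1/3 + 2/3)) = of_real s * 1" "\<kappa> * cis (- pi * (2/3)) = of_real s * omega"
      "\<kappa> = of_real s * (- 1)" "\<kappa> * cis (- pi * (4/3 + 1/3)) = - of_real s * omega"
  proof -
    have "- pi * (1/3 + 2/3) = - pi" "- pi * (2/3) = - (2 * pi / 3)" "- pi * (4/3 + 1/3) = - (5 * pi / 3)" by simp_all
    moreover have "cis (- pi) = - 1" by (simp add: complex_eq_iff)
    ultimately show "\<kappa> * cis (- pi * (1/3 + 2/3)) = of_real s * 1" "\<kappa> * cis (- pi * (2/3)) = of_real s * omega"
      "\<kappa> = of_real s * (- 1)" "\<kappa> * cis (- pi * (4/3 + 1/3)) = - of_real s * omega"
      by (simp_all only: cis_values) (simp_all add: \<kappa>_def)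
  qed
  let ?E = "\<lambda>x. \<kappa> * F (complex_of_real x)"
  obtain l1 l2 l3 l4 where l: "l1 > 0" "l2 > 0" "l3 > 0" "l4 > 0" "?E 0 = 0"
    "?E u = of_real l1 * 1" "?E 1 = ?E u + of_real l2 * omega" "\<kappa> * L = ?E 1 + of_real l3 * (- 1)" "\<kappa> * L = of_real l4 * omega"
    and int: "((\<lambda>x. s * sc_weight (1/3) u x) has_integral l1) {0..u}" "((\<lambda>x. s * sc_weight (1/3) u x) has_integral l2) {u..1}"
    and bij: "bij_betw ?E {0<..<u} ((\<lambda>t. of_real t * 1) ` {0<..<l1})"
    "bij_betw ?E {u<..<1} ((\<lambda>t. ?E u + of_real t * omega) ` {0<..<l2})"
    "bij_betw ?E {1<..} ((\<lambda>t. ?E 1 + of_real t * (- 1)) ` {0<..<l3})"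
    "bij_betw ?E {..<0} ((\<lambda>t. of_real t * omega) ` {0<..<l4})"
    by (rule sc_map_edges[OF sc u s _ om _ om dir]) auto
  have "l1 = s * (B * cubic_F u)"
    using has_integral_unique[OF int(1) has_integral_mult_right[OF sc_weight_integrals(1)[OF u], of s]] by (simp add: B_def)
  hence l1: "l1 = r" using B F ratio by (simp add: s_def field_simps)
  have "l2 = s * (B * cubic_F (1 - u))"
    using has_integral_unique[OF int(2) has_integral_mult_right[OF sc_weight_integrals(2)[OF u], of s]] by (simp add: B_def)
  hence l2: "l2 = 1" using B F by (simp add: s_def)
  have Eu: "?E u = of_real r" and E1: "?E 1 = of_real r + omega" using l l1 l2 by simp_all
  \<comment> \<open>The polygon closes at the image of infinity: comparing coordinates of its two
    expressions determines the remaining lengths.\<close>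
  have eq: "of_real l4 * omega = of_real r + omega - of_real l3" using l E1 by simp
  have l34: "l3 = r" "l4 = 1" using arg_cong[OF eq, of cx] arg_cong[OF eq, of cy] by simp_all
  have kL: "\<kappa> * L = omega" using l l34 by simp
  have ne: "complex_of_real r + omega \<noteq> 0"
  proof
    assume "complex_of_real r + omega = 0"
    from arg_cong[OF this, of cy] show False by simp
  qed
  define A0 A1 A2 A3 where "A0 = {z. cx z = 0 \<and> 0 < cy z \<and> cy z < 1}" and "A1 = {z. cy z = 0 \<and> 0 < cx z \<and> cx z < r}"
    and "A2 = {z. cx z = r \<and> 0 < cy z \<and> cy z < 1}" and "A3 = {z. cy z = 1 \<and> 0 < cx z \<and> cx z < r}"
  note A_defs = A0_def A1_def A2_def A3_def
  have "(\<lambda>t. of_real t * 1) ` {0<..<l1} = A1"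
    unfolding l1 A_defs by (rule image_eq_of_section[where g = cx]) (auto intro!: coords_eqI)
  hence b1: "bij_betw ?E {0<..<u} A1" using bij(1) by simp
  have "(\<lambda>t. ?E u + of_real t * omega) ` {0<..<l2} = A2"
    unfolding l2 Eu A_defs by (rule image_eq_of_section[where g = "cy"]) (auto intro!: coords_eqI)
  hence b2: "bij_betw ?E {u<..<1} A2" using bij(2) by simp
  have "(\<lambda>t. ?E 1 + of_real t * (- 1)) ` {0<..<l3} = A3"
    unfolding l34 E1 A_defs by (rule image_eq_of_section[where g = "\<lambda>z. r - cx z"]) (auto intro!: coords_eqI)
  hence b3: "bij_betw ?E {1<..} A3" using bij(3) by simp
  have "(\<lambda>t. of_real t * omega) ` {0<..<l4} = A0"
    unfolding l34 A_defs by (rule image_eq_of_section[where g = "cy"]) (auto intro!: coords_eqI)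
  hence b0: "bij_betw ?E {..<0} A0" using bij(4) by simp
  have "bij_betw ?E UNIV (A0 \<union> {?E 0} \<union> A1 \<union> {?E u} \<union> A2 \<union> {?E 1} \<union> A3)"
    by (rule bij_betw_real_line[OF u b0 b1 b2 b3]; unfold l(5) Eu E1 A_defs) (use r om ne in auto)
  also have "A0 \<union> {?E 0} \<union> A1 \<union> {?E u} \<union> A2 \<union> {?E 1} \<union> A3 = frontier (parallelogram r) - {\<kappa> * L}"
    unfolding l(5) Eu E1 kL A_defs frontier_parallelogram unfolding interior_parallelogram[OF r] unfolding parallelogram_coords[OF r]
      singleton_coords cx_cy_simps set_eq_iff Un_iff Diff_iff mem_Collect_eq
    using r by (smt (verit))
  finally have bd: "bij_betw ?E UNIV (frontier (parallelogram r) - {\<kappa> * L})" .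
  have "interior (parallelogram r) \<noteq> {}"
  proof -
    have "of_real (r/2) + of_real (1/2) * omega \<in> interior (parallelogram r)"
      unfolding interior_parallelogram[OF r] using r by (simp del: of_real_divide)
    thus ?thesis by blast
  qed
  moreover have "\<kappa> * L \<in> frontier (parallelogram r)"
    unfolding kL frontier_parallelogram unfolding interior_parallelogram[OF r] unfolding parallelogram_coords[OF r] using r by simp
  ultimately have "half_plane_chart (case_option (\<kappa> * L) (\<lambda>z. \<kappa> * F z)) (parallelogram r)"
    using s by (intro half_plane_chart_of_sc_map[OF sc u _ compact_convex_polygons(1,2) _ bd]) (auto simp: \<kappa>_def)
  thus thesis
    using kL l(5) Eu E1 by (intro that[of "case_option (\<kappa> * L) (\<lambda>z. \<kappa> * F z)"]) simp_all
qed

lemma triangle_chart: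
  assumes u: "0 < u" "u < 1"
  obtains f where "half_plane_chart f triangle" "f None = omega" "f (Some 0) = 0" "f (Some 1) = 1"
    "f (Some (of_real u)) = of_real (1 - 1 / Beta (1/3) (1/3) * integral {u..1} (\<lambda>w. w powr (-2/3) * (1 - w) powr (-2/3)))"
proof -
  define B where "B = Beta (1/3) (1/3 :: real)"
  have B: "B > 0" by (simp add: B_def Beta_def Gamma_real_pos)
  \<comment> \<open>For b = 0 the weight is the beta density with total integral B over the unit
    interval, so the side carrying the marked point gets length 1.\<close>
  define s where "s = 1 / B"
  have s: "s > 0" using B by (simp add: s_def)
  obtain F L where sc: "sc_map 0 u F L" using sc_map_exists[OF u, of 0] by auto
  \<comment> \<open>The rotation undoes the argument -2 pi / 3 that the integrand has between 0 and
    1.\<close>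
  define \<kappa> where "\<kappa> = complex_of_real s * cis (2 * pi / 3)"
  have om: "omega \<noteq> 0" by (simp add: omega_def)
  have om1: "omega - 1 \<noteq> 0" by (simp add: omega_eq complex_eq_iff)
  have one: "cis (2 * pi / 3) * cis (- pi * (2/3)) = 1"
    by (simp add: cis_mult mult.commute)
  have two: "cis (2 * pi / 3) * cis (- pi * (4/3)) = - omega"
  proof -
    have "cis (2 * pi / 3) * cis (- pi * (4/3)) = cis (- (2 * pi / 3))" by (simp add: cis_mult field_simps)
    thus ?thesis by (simp add: cis_values)
  qed
  have dir: "\<kappa> * cis (- pi * (0 + 2/3)) = of_real s * 1" "\<kappa> * cis (- pi * (2/3)) = of_real s * 1"
      "\<kappa> = of_real s * (omega - 1)" "\<kappa> * cis (- pi * (4/3 + 0)) = - of_real s * omega"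
    using one two by (simp_all add: \<kappa>_def mult.assoc cis_values(1))
  let ?E = "\<lambda>x. \<kappa> * F (complex_of_real x)"
  obtain l1 l2 l3 l4 where l: "l1 > 0" "l2 > 0" "l3 > 0" "l4 > 0" "?E 0 = 0"
    "?E u = of_real l1 * 1" "?E 1 = ?E u + of_real l2 * 1" "\<kappa> * L = ?E 1 + of_real l3 * (omega - 1)" "\<kappa> * L = of_real l4 * omega"
    and int: "((\<lambda>x. s * sc_weight 0 u x) has_integral l1) {0..u}" "((\<lambda>x. s * sc_weight 0 u x) has_integral l2) {u..1}"
    and bij: "bij_betw ?E {0<..<u} ((\<lambda>t. of_real t * 1) ` {0<..<l1})"
    "bij_betw ?E {u<..<1} ((\<lambda>t. ?E u + of_real t * 1) ` {0<..<l2})"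
    "bij_betw ?E {1<..} ((\<lambda>t. ?E 1 + of_real t * (omega - 1)) ` {0<..<l3})"
    "bij_betw ?E {..<0} ((\<lambda>t. of_real t * omega) ` {0<..<l4})"
    by (rule sc_map_edges[OF sc u s _ _ om1 om dir]) auto
  define w where "w = (\<lambda>x::real. x powr (-2/3) * (1 - x) powr (-2/3))"
  \<comment> \<open>The point u is excepted: there the factor
    \<open>\<bar>x - u\<bar> powr (- 0)\<close> is \<open>0 powr 0 = 0\<close>, not 1. The integrals
    do not feel this single point.\<close>
  have sw: "s * w x = s * sc_weight 0 u x" if "x \<in> {0..1} - {u}" for x
    using that by (simp add: w_def sc_weight_def)
  have i1: "((\<lambda>x. s * w x) has_integral l1) {0..u}"
    by (rule has_integral_spike_finite[OF _ _ int(1), of "{u}"]) (use sw u in auto)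
  have i2: "((\<lambda>x. s * w x) has_integral l2) {u..1}"
    by (rule has_integral_spike_finite[OF _ _ int(2), of "{u}"]) (use sw u in auto)
  have "(w has_integral B) {0..1}"
    using has_integral_Beta_real[of "1/3" "1/3"] by (simp add: w_def B_def)
  from has_integral_mult_right[OF this, of s] have "((\<lambda>x. s * w x) has_integral 1) {0..1}"
    using B by (simp add: s_def)
  moreover have "((\<lambda>x. s * w x) has_integral (l1 + l2)) {0..1}"
    by (rule has_integral_combine[OF _ _ i1 i2]) (use u in auto)
  ultimately have l12: "l1 + l2 = 1" by (rule has_integral_unique[symmetric])
  have "l2 = s * integral {u..1} w" using integral_unique[OF i2] s by simp
  hence l2: "l2 = 1 / B * integral {u..1} w" by (simp add: s_def)
  have Eu: "?E u = of_real l1" using l by simp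
  have "?E 1 = of_real (l1 + l2)" using l by simp
  hence E1: "?E 1 = 1" using l12 by simp
  have eq: "of_real l4 * omega = 1 + of_real l3 * (omega - 1)" using l E1 by simp
  have l34: "l3 = 1" "l4 = 1" using arg_cong[OF eq, of cx] arg_cong[OF eq, of cy] by simp_all
  have kL: "\<kappa> * L = omega" using l l34 by simp
  define A0 A1 A2 A3 where "A0 = {z. cx z = 0 \<and> 0 < cy z \<and> cy z < 1}" and "A1 = {z. cy z = 0 \<and> 0 < cx z \<and> cx z < l1}"
    and "A2 = {z. cy z = 0 \<and> l1 < cx z \<and> cx z < 1}" and "A3 = {z. cx z + cy z = 1 \<and> 0 < cx z \<and> cx z < 1}"
  note A_defs = A0_def A1_def A2_def A3_def
  have l1: "0 < l1" "l1 < 1" using l l12 by simp_all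
  have "(\<lambda>t. of_real t * 1) ` {0<..<l1} = A1"
    unfolding A_defs by (rule image_eq_of_section[where g = "cx"]) (auto intro!: coords_eqI)
  hence b1: "bij_betw ?E {0<..<u} A1" using bij(1) by simp
  have "(\<lambda>t. ?E u + of_real t * 1) ` {0<..<l2} = A2"
    unfolding Eu A_defs
    by (rule image_eq_of_section[where g = "\<lambda>z. cx z - l1"]) (use l12 in \<open>auto intro!: coords_eqI\<close>)
  hence b2: "bij_betw ?E {u<..<1} A2" using bij(2) by simp
  have "(\<lambda>t. ?E 1 + of_real t * (omega - 1)) ` {0<..<l3} = A3"
    unfolding l34 E1 A_defs by (rule image_eq_of_section[where g = "cy"]) (auto intro!: coords_eqI)
  hence b3: "bij_betw ?E {1<..} A3" using bij(3) by simp
  have "(\<lambda>t. of_real t * omega) ` {0<..<l4} = A0"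
    unfolding l34 A_defs by (rule image_eq_of_section[where g = "cy"]) (auto intro!: coords_eqI)
  hence b0: "bij_betw ?E {..<0} A0" using bij(4) by simp
  have "bij_betw ?E UNIV (A0 \<union> {?E 0} \<union> A1 \<union> {?E u} \<union> A2 \<union> {?E 1} \<union> A3)"
    by (rule bij_betw_real_line[OF u b0 b1 b2 b3]; unfold l(5) Eu E1 A_defs) (use l1 in auto)
  also have "A0 \<union> {?E 0} \<union> A1 \<union> {?E u} \<union> A2 \<union> {?E 1} \<union> A3 = frontier triangle - {\<kappa> * L}"
    unfolding l(5) Eu E1 kL A_defs frontier_triangle unfolding interior_triangle unfolding triangle_coords
      singleton_coords cx_cy_simps set_eq_iff Un_iff Diff_iff mem_Collect_eq
    using l1 by (smt (verit))
  finally have bd: "bij_betw ?E UNIV (frontier triangle - {\<kappa> * L})" .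
  have "interior triangle \<noteq> {}"
  proof -
    have "of_real (1/3) + of_real (1/3) * omega \<in> interior triangle"
      unfolding interior_triangle by (simp del: of_real_divide)
    thus ?thesis by blast
  qed
  moreover have "\<kappa> * L \<in> frontier triangle"
    unfolding kL frontier_triangle unfolding interior_triangle unfolding triangle_coords by simp
  moreover have "\<kappa> \<noteq> 0" using s by (simp add: \<kappa>_def)
  ultimately have "half_plane_chart (case_option (\<kappa> * L) (\<lambda>z. \<kappa> * F z)) triangle"
    by (intro half_plane_chart_of_sc_map[OF sc u _ compact_convex_polygons(3,4) _ bd])
  moreover have "l1 = 1 - 1 / B * integral {u..1} w" using l12 l2 by simp
  ultimately show thesis
    using kL l(5) Eu E1 by (intro that[of "case_option (\<kappa> * L) (\<lambda>z. \<kappa> * F z)"]) (simp_all add: B_def w_def)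
qed

section \<open>The prevertex parameter and the Cardy-Smirnov function\<close>

lemma is_prevertex_iff_half_plane_chart:
  "is_prevertex r u \<longleftrightarrow> 0 < u \<and> u < 1 \<and> (\<exists>f. half_plane_chart f (parallelogram r) \<and> f None = omega \<and>
     f (Some 0) = 0 \<and> f (Some (of_real u)) = of_real r \<and> f (Some 1) = of_real r + omega)"
  unfolding is_prevertex_def half_plane_chart_def by blast

lemma chart_of_cubic_T:
  assumes r: "r > 0"
  obtains f where "half_plane_chart f (parallelogram r)" "f None = omega" "f (Some 0) = 0"
    "f (Some (of_real (1 - cubic_T r))) = of_real r" "f (Some 1) = of_real r + omega"
proof -
  have "cubic_F (1 - cubic_T r) / cubic_F (1 - (1 - cubic_T r)) = r"
    using cubic_M_T[OF r] by (simp add: cubic_M_def)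
  thus thesis
    using parallelogram_chart[of "1 - cubic_T r" r] cubic_T_bounds[OF r] r that by auto
qed

text \<open>A chart is determined by its values at 0, 1 and infinity. A second prevertex parameter
  would therefore be a second preimage of the vertex r under the same injective map.\<close>

lemma u_par_eq:
  assumes r: "r > 0" shows "u_par r = 1 - cubic_T r"
  unfolding u_par_def
proof (rule the_equality)
  obtain f where f: "half_plane_chart f (parallelogram r)" "f None = omega" "f (Some 0) = 0"
    "f (Some (of_real (1 - cubic_T r))) = of_real r" "f (Some 1) = of_real r + omega"
    using chart_of_cubic_T[OF r] by blast
  show "is_prevertex r (1 - cubic_T r)"
    unfolding is_prevertex_iff_half_plane_chart using f cubic_T_bounds[OF r] by auto
  fix u assume "is_prevertex r u"
  then obtain g where g: "half_plane_chart g (parallelogram r)" "g None = omega" "g (Some 0) = 0"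
    "g (Some (of_real u)) = of_real r" "g (Some 1) = of_real r + omega"
    unfolding is_prevertex_iff_half_plane_chart by blast
  have top: "Some (complex_of_real x) \<in> topspace closed_half_plane" for x
    by (simp add: topspace_closed_half_plane image_iff)
  have "g (Some (of_real u)) = f (Some (of_real u))"
    by (rule half_plane_chart_unique[OF g(1) f(1)]) (use f g top in auto)
  hence eq: "f (Some (of_real u)) = f (Some (of_real (1 - cubic_T r)))" using g f by simp
  have "inj_on f (topspace closed_half_plane)"
    using f(1) homeomorphic_imp_injective_map by (auto simp: half_plane_chart_def)
  from inj_onD[OF this eq top top] show "u = 1 - cubic_T r"
    by (simp only: option.inject of_real_eq_iff)
qed

lemma v_par_eq: "r > 0 \<Longrightarrow> v_par r = cubic_T r"
  by (simp add: v_par_def u_par_eq)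

text \<open>The charts of the parallelogram and of the triangle use the same u and match at 0, 1 and
  infinity with the three prescribed vertices. So the Cardy map sends r to the marked point on the
  unit side of the triangle, whose distance to 1 is the normalised incomplete beta integral.\<close>

lemma cardy_smirnov_eq:
  assumes r: "r > 0"
  shows "cardy_smirnov r = of_real (1 / Beta (1/3) (1/3) *
    integral {u_par r..1} (\<lambda>w. w powr (-2/3) * (1 - w) powr (-2/3)))"
proof -
  define u where "u = u_par r"
  let ?P = "parallelogram r" and ?H = upper_half_plane
  have u: "0 < u" "u < 1" using cubic_T_bounds[OF r] u_par_eq[OF r] by (auto simp: u_def)
  obtain f where f: "half_plane_chart f ?P" "f None = omega" "f (Some 0) = 0"
    "f (Some (of_real u)) = of_real r" "f (Some 1) = of_real r + omega"
    using chart_of_cubic_T[OF r] u_par_eq[OF r] unfolding u_def by metis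
  obtain S where S: "half_plane_chart S triangle" "S None = omega" "S (Some 0) = 0" "S (Some 1) = 1"
    "S (Some (of_real u)) = of_real (1 - 1 / Beta (1/3) (1/3) * integral {u..1} (\<lambda>w. w powr (-2/3) * (1 - w) powr (-2/3)))"
    using triangle_chart[OF u] by blast
  have hf: "homeomorphic_map closed_half_plane (top_of_set ?P) f" and bf: "biholomorphic_on (\<lambda>z. f (Some z)) ?H (interior ?P)"
    and hS: "homeomorphic_map closed_half_plane (top_of_set triangle) S" and bS: "biholomorphic_on (\<lambda>z. S (Some z)) ?H (interior triangle)"
    using f(1) S(1) by (auto simp: half_plane_chart_def)
  obtain h where h: "homeomorphic_maps closed_half_plane (top_of_set ?P) f h"
    using hf homeomorphic_map_maps by blast
  have hh: "homeomorphic_map (top_of_set ?P) closed_half_plane h"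
    and hf_id: "\<And>x. x \<in> topspace closed_half_plane \<Longrightarrow> h (f x) = x" and fh_id: "\<And>w. w \<in> ?P \<Longrightarrow> f (h w) = w"
    using h by (auto simp: homeomorphic_maps_map)
  have top: "Some z \<in> topspace closed_half_plane \<longleftrightarrow> Im z \<ge> 0" "None \<in> topspace closed_half_plane" for z
    by (auto simp: topspace_closed_half_plane)
  have h_top: "h w \<in> topspace closed_half_plane" if "w \<in> ?P" for w
    using homeomorphic_imp_surjective_map[OF hh] that by auto
  have f_top: "f x \<in> ?P" if "x \<in> topspace closed_half_plane" for x
    using homeomorphic_imp_surjective_map[OF hf] that by auto
  have h_vert: "h 0 = Some 0" "h (of_real r) = Some (of_real u)" "h (of_real r + omega) = Some 1" "h omega = None"
    using hf_id[of "Some 0"] hf_id[of "Some (of_real u)"] hf_id[of "Some 1"] hf_id[of None] f top by simp_all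
  have vert: "0 \<in> ?P" "of_real r \<in> ?P" "of_real r + omega \<in> ?P" "omega \<in> ?P"
    using f_top[of "Some 0"] f_top[of "Some (of_real u)"] f_top[of "Some 1"] f_top[of None] f top by simp_all
  define g0 where "g0 = restrict (S \<circ> h) ?P"
  have g0_eq: "g0 w = S (h w)" if "w \<in> ?P" for w using that by (simp add: g0_def)
  have g0_ext: "g0 \<in> extensional ?P" by (simp add: g0_def)
  have g0_cardy: "is_cardy_map r g0"
    unfolding is_cardy_map_def
  proof (intro conjI)
    show "homeomorphic_map (top_of_set ?P) (top_of_set triangle) g0"
      by (rule homeomorphic_map_eq[OF homeomorphic_map_compose[OF hh hS]]) (simp add: g0_eq)
    let ?i = "inv_into ?H (\<lambda>z. f (Some z))"
    have bi: "biholomorphic_on ?i (interior ?P) ?H"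
      by (rule biholomorphic_on_inverse[OF bf open_interior])
    have im: "(\<lambda>z. f (Some z)) ` ?H = interior ?P" using bf by (auto simp: biholomorphic_on_def bij_betw_def)
    show "biholomorphic_on g0 (interior ?P) (interior triangle)"
    proof (rule biholomorphic_on_cong[OF biholomorphic_on_compose[OF bi bS open_interior] open_interior])
      fix w assume w: "w \<in> interior ?P"
      hence "?i w \<in> ?H" "f (Some (?i w)) = w"
        using inv_into_into[of w "\<lambda>z. f (Some z)" ?H] f_inv_into_f[of w "\<lambda>z. f (Some z)" ?H] im by auto
      hence "h w = Some (?i w)" using hf_id[of "Some (?i w)"] top by auto
      moreover have "w \<in> ?P" using w interior_subset by blast
      ultimately show "S (Some (?i w)) = g0 w" by (simp add: g0_eq)
    qed
    show "g0 0 = 0" "g0 (of_real r + omega) = 1" "g0 omega = omega"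
      using g0_eq vert h_vert S by simp_all
  qed
  have uniq: "g = g0" if g: "is_cardy_map r g" "g \<in> extensional ?P" for g
  proof (rule extensionalityI[OF g(2)])
    show "g0 \<in> extensional ?P" by (rule g0_ext)
    \<comment> \<open>Composed with the chart of the parallelogram, a competing Cardy map becomes a
      chart of the triangle with the same three normalising values as \<open>S\<close>, so the
      uniqueness of charts decides.\<close>
    have "half_plane_chart (g \<circ> f) triangle"
      unfolding half_plane_chart_def
    proof
      show "homeomorphic_map closed_half_plane (top_of_set triangle) (g \<circ> f)"
        using g(1) by (intro homeomorphic_map_compose[OF hf]) (simp add: is_cardy_map_def)
      show "biholomorphic_on (\<lambda>z. (g \<circ> f) (Some z)) ?H (interior triangle)"
        using biholomorphic_on_compose[OF bf _ open_upper] g(1) by (simp add: is_cardy_map_def)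
    qed
    hence "(g \<circ> f) x = S x" if "x \<in> topspace closed_half_plane" for x
      using half_plane_chart_unique[OF _ S(1) _ _ _ that, of "g \<circ> f"] g(1) f S by (simp add: is_cardy_map_def)
    thus "g w = g0 w" if "w \<in> ?P" for w
      using h_top[OF that] fh_id[OF that] g0_eq[OF that] by force
  qed
  have "cardy_map r = g0"
    unfolding cardy_map_def
    by (rule the_equality, rule conjI[OF g0_cardy g0_ext], elim conjE, rule uniq)
  hence "cardy_smirnov r = 1 - S (Some (of_real u))"
    by (simp add: cardy_smirnov_def g0_eq vert h_vert)
  thus ?thesis unfolding S(5) by (simp add: u_def)
qed

lemma Beta_third: "Beta (1/3) (1/3 :: real) = Gamma (1/3) ^ 2 / Gamma (2/3)"
  by (simp add: Beta_def power2_eq_square)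

lemma Gamma_third_squared: "Gamma (1/3) ^ 2 / Gamma (2/3 :: real) = sqrt 3 * Gamma (1/3) ^ 3 / (2 * pi)"
proof -
  have pos: "Gamma (1/3 :: real) > 0" "Gamma (2/3 :: real) > 0" by (simp_all add: Gamma_real_pos)
  have *: "b ^ 2 / c = sqrt 3 * b ^ 3 / (2 * pi)" if "b * c = 2 * pi / sqrt 3" "b > 0" "c > 0" for b c :: real
  proof -
    have "sqrt 3 * (b * c) = 2 * pi" unfolding that(1) by simp
    hence "sqrt 3 * b ^ 3 / (2 * pi) = sqrt 3 * b ^ 3 / (sqrt 3 * (b * c))" by simp
    also have "\<dots> = b ^ 2 / c" using that(2,3) by (simp add: power3_eq_cube power2_eq_square)
    finally show ?thesis by simp
  qed
  show ?thesis by (rule *[OF Gamma_third_times_Gamma_two_thirds pos])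
qed

lemma v_par_eta:
  assumes r: "r > 0"
  defines "\<tau> \<equiv> \<i> * complex_of_real r / complex_of_real (sqrt 3)"
  shows "complex_of_real (v_par r) = 27 * dedekind_eta (3 * \<tau>) ^ 12 /
    (dedekind_eta \<tau> ^ 12 + 27 * dedekind_eta (3 * \<tau>) ^ 12)"
proof -
  have "3 * \<tau> = \<i> * complex_of_real (3 * r) / complex_of_real (sqrt 3)" by (simp add: \<tau>_def)
  hence "dedekind_eta (3 * \<tau>) = of_real (eta_re (3 * r))"
    using dedekind_eta_imaginary[of "3 * r"] r by (simp only:)
  moreover have "dedekind_eta \<tau> = of_real (eta_re r)"
    unfolding \<tau>_def by (rule dedekind_eta_imaginary[OF r])
  ultimately show ?thesis by (simp add: v_par_eq[OF r] cubic_T_def)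
qed

theorem theorem1p2:
  shows "u_par ` {0<..} \<subseteq> {0<..<1} \<and> v_par ` {0<..} \<subseteq> {0<..<1} \<and>
    real_analytic_on u_par {0<..} \<and> real_analytic_on v_par {0<..} \<and>
    (\<forall>r::real. r > 0 \<longrightarrow>
      cardy_smirnov r =
        complex_of_real (1 / Beta (1/3) (1/3) *
          integral {u_par r..1} (\<lambda>w. w powr (-2/3) * (1 - w) powr (-2/3))) \<and>
      1 / Beta (1/3) (1/3) *
          integral {u_par r..1} (\<lambda>w. w powr (-2/3) * (1 - w) powr (-2/3)) =
        3 * v_par r powr (1/3) / Beta (1/3) (1/3) * hyp2F1 (1/3) (2/3) (4/3) (v_par r)) \<and>
    Beta (1/3) (1/3 :: real) = Gamma (1/3) ^ 2 / Gamma (2/3) \<and>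
    Gamma (1/3) ^ 2 / Gamma (2/3 :: real) = sqrt 3 * Gamma (1/3) ^ 3 / (2 * pi) \<and>
    (\<forall>r::real. r > 0 \<longrightarrow>
      (let \<tau> = \<i> * complex_of_real r / complex_of_real (sqrt 3) in
        complex_of_real (v_par r) =
          27 * dedekind_eta (3 * \<tau>) ^ 12 /
            (dedekind_eta \<tau> ^ 12 + 27 * dedekind_eta (3 * \<tau>) ^ 12) \<and>
        u_par r = 1 - v_par r))"
proof (intro conjI allI impI)
  show "u_par ` {0<..} \<subseteq> {0<..<1}" "v_par ` {0<..} \<subseteq> {0<..<1}"
    using cubic_T_bounds by (auto simp: u_par_eq v_par_eq)
  show "real_analytic_on u_par {0<..}"
    by (rule cubic_T_analytic[of _ 1 "- 1"]) (simp add: u_par_eq)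
  show "real_analytic_on v_par {0<..}"
    by (rule cubic_T_analytic[of _ 0 1]) (simp add: v_par_eq)
  fix r :: real assume r: "r > 0"
  show "cardy_smirnov r = complex_of_real (1 / Beta (1/3) (1/3) *
      integral {u_par r..1} (\<lambda>w. w powr (-2/3) * (1 - w) powr (-2/3)))"
    by (rule cardy_smirnov_eq[OF r])
  have "0 < v_par r" "v_par r < 1" using cubic_T_bounds[OF r] by (simp_all add: v_par_eq r)
  from integral_unique[OF incomplete_beta_third[OF this]]
  show "1 / Beta (1/3) (1/3) * integral {u_par r..1} (\<lambda>w. w powr (-2/3) * (1 - w) powr (-2/3)) =
      3 * v_par r powr (1/3) / Beta (1/3) (1/3) * hyp2F1 (1/3) (2/3) (4/3) (v_par r)"
    by (simp add: v_par_def)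
  show "let \<tau> = \<i> * complex_of_real r / complex_of_real (sqrt 3) in
      complex_of_real (v_par r) = 27 * dedekind_eta (3 * \<tau>) ^ 12 /
        (dedekind_eta \<tau> ^ 12 + 27 * dedekind_eta (3 * \<tau>) ^ 12) \<and> u_par r = 1 - v_par r"
    using v_par_eta[OF r] by (simp add: Let_def v_par_def)
qed (rule Beta_third Gamma_third_squared)+

end
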